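(* Let $(M^n,g)$ be a compact Riemannian manifold, and let $\xi$ be a vector field, $h,\lambda$ smooth functions on $M$ and $\rho$ a real constant such that $(M^n,g)$ is an $h$-almost Ricci-Bourguignon soliton, i.e. $\operatorname{Ric}+\frac{h}{2}\mathcal{L}_{\xi}g=(\lambda+\rho R)g$. Write $\xi=\nabla f+Y$ (Hodge–de Rham decomposition), where $f:M\to\mathbb{R}$ is smooth and $Y$ is a vector field with $\operatorname{div}(Y)=0$. Then: 1. $\displaystyle\int_{M}h\left|\nabla^2f-\frac{\Delta f}{n}g\right|^2dM=\frac{n-2}{2n}\int_{M}g(\nabla R,\nabla f)\,dM-\frac{1}{2}\int_{M}h\langle \nabla^2 f,\mathcal{L}_Yg\rangle\,dM;$ 2. $\displaystyle\int_{M}h\left|\nabla^2 f-\frac{\Delta f}{n}g\right|^2dM=\frac{n-2}{2n}\int_{M}g(\nabla R,\nabla f)\,dM+\frac{1}{4}\int_{M}h|\mathcal{L}_Yg|^2\,dM;$ 3. if $h$ is nowhere zero (so that $\frac1h$ is defined), $\displaystyle\int_{M}\frac{1}{h}\left|\operatorname{Ric}-\frac{R}{n}g\right|^2dM=\frac{n-2}{2n}\int_{M}g(\nabla R,\nabla f)\,dM=\frac{n-2}{2n}\int_{M}g(\nabla R,\xi)\,dM.$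
   Context: $\operatorname{Ric}$ is the Ricci tensor and $R$ the scalar curvature of $g$; $\mathcal{L}_\xi g$ is the Lie derivative of $g$ along $\xi$. An $h$-almost Ricci-Bourguignon soliton is a Riemannian manifold $(M^n,g)$ with a vector field $\xi$ (the potential field), smooth functions $h,\lambda$ and a real constant $\rho$ satisfying $\operatorname{Ric}+\frac{h}{2}\mathcal{L}_{\xi}g=(\lambda+\rho R)g$. $\nabla^2 f$ is the Hessian of $f$, $\Delta f$ its trace, and $\langle\cdot,\cdot\rangle$, $|\cdot|$ are the inner product and norm on $(0,2)$-tensors induced by $g$. Compact means compact without boundary; $dM$ is the Riemannian measure. *)

theory Defs
  imports "HOL-Analysis.Analysis"
begin

section \<open>Smooth functions on open subsets of Euclidean space\<close>

definition pderiv_at :: "'n \<Rightarrow> (real ^ 'n \<Rightarrow> real) \<Rightarrow> real ^ 'n \<Rightarrow> real" where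
  "pderiv_at i u x = frechet_derivative u (at x) (axis i 1)"

primrec Ck_on :: "nat \<Rightarrow> (real ^ 'n) set \<Rightarrow> (real ^ 'n \<Rightarrow> real) \<Rightarrow> bool" where
  "Ck_on 0 S u \<longleftrightarrow> continuous_on S u"
| "Ck_on (Suc k) S u \<longleftrightarrow>
     (\<forall>x\<in>S. u differentiable at x) \<and> (\<forall>i. Ck_on k S (pderiv_at i u))"

definition smooth_on :: "(real ^ 'n) set \<Rightarrow> (real ^ 'n \<Rightarrow> real) \<Rightarrow> bool" where
  "smooth_on S u \<longleftrightarrow> (\<forall>k. Ck_on k S u)"


section \<open>Manifolds, fields, metrics\<close>

text \<open>
  A chart is a pair of its domain and its coordinate map; values of the coordinate map outside the
  domain are irrelevant.  A smooth structure is given by an atlas, not necessarily maximal.  The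
  manifold is without boundary because coordinate images are open in \<open>real ^ 'n\<close>; its
  dimension is \<open>CARD('n)\<close>.
\<close>

type_synonym ('a, 'n) chart = "'a set \<times> ('a \<Rightarrow> real ^ 'n)"

abbreviation dom_of :: "('a, 'n::finite) chart \<Rightarrow> 'a set" where
  "dom_of c \<equiv> fst c"

abbreviation coord :: "('a, 'n::finite) chart \<Rightarrow> 'a \<Rightarrow> real ^ 'n" where
  "coord c \<equiv> snd c"

definition point_of :: "('a, 'n::finite) chart \<Rightarrow> real ^ 'n \<Rightarrow> 'a" where
  "point_of c = inv_into (dom_of c) (coord c)"

definition transition :: "('a, 'n::finite) chart \<Rightarrow> ('a, 'n) chart \<Rightarrow> real ^ 'n \<Rightarrow> real ^ 'n" where
  "transition c d = coord d \<circ> point_of c"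

definition smooth_manifold :: "'a topology \<Rightarrow> ('a, 'n::finite) chart set \<Rightarrow> bool" where
  "smooth_manifold M A \<longleftrightarrow>
     Hausdorff_space M \<and> second_countable M \<and>
     (\<Union>c\<in>A. dom_of c) = topspace M \<and>
     (\<forall>c\<in>A. openin M (dom_of c) \<and> open (coord c ` dom_of c) \<and>
        homeomorphic_map (subtopology M (dom_of c)) (top_of_set (coord c ` dom_of c)) (coord c)) \<and>
     (\<forall>c\<in>A. \<forall>d\<in>A. \<forall>i. smooth_on (coord c ` (dom_of c \<inter> dom_of d)) (\<lambda>x. transition c d x $ i))"

definition smooth_fun :: "('a, 'n::finite) chart set \<Rightarrow> ('a \<Rightarrow> real) \<Rightarrow> bool" where
  "smooth_fun A f \<longleftrightarrow> (\<forall>c\<in>A. smooth_on (coord c ` dom_of c) (f \<circ> point_of c))"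

text \<open>
  Tensor fields are families of component functions: the value at \<open>c\<close> and \<open>x\<close> is the array of
  components, in the coordinates of the chart \<open>c\<close>, at the point with coordinates \<open>x\<close>.
\<close>

type_synonym ('a, 'n) vfield = "('a, 'n) chart \<Rightarrow> real ^ 'n \<Rightarrow> real ^ 'n"
type_synonym ('a, 'n) tfield = "('a, 'n) chart \<Rightarrow> real ^ 'n \<Rightarrow> real ^ 'n ^ 'n"

definition vector_field :: "('a, 'n::finite) chart set \<Rightarrow> ('a, 'n) vfield \<Rightarrow> bool" where
  "vector_field A X \<longleftrightarrow>
     (\<forall>c\<in>A. \<forall>i. smooth_on (coord c ` dom_of c) (\<lambda>x. X c x $ i)) \<and>
     (\<forall>c\<in>A. \<forall>d\<in>A. \<forall>p \<in> dom_of c \<inter> dom_of d.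
        X d (coord d p) = jacobian (transition c d) (at (coord c p)) *v X c (coord c p))"

definition riemannian_metric :: "('a, 'n::finite) chart set \<Rightarrow> ('a, 'n) tfield \<Rightarrow> bool" where
  "riemannian_metric A g \<longleftrightarrow>
     (\<forall>c\<in>A. \<forall>i j. smooth_on (coord c ` dom_of c) (\<lambda>x. g c x $ i $ j)) \<and>
     (\<forall>c\<in>A. \<forall>x \<in> coord c ` dom_of c.
        transpose (g c x) = g c x \<and> (\<forall>v. v \<noteq> 0 \<longrightarrow> v \<bullet> (g c x *v v) > 0)) \<and>
     (\<forall>c\<in>A. \<forall>d\<in>A. \<forall>p \<in> dom_of c \<inter> dom_of d.
        let J = jacobian (transition c d) (at (coord c p))
        in g c (coord c p) = transpose J ** g d (coord d p) ** J)"

definition riemannian_manifold ::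
    "'a topology \<Rightarrow> ('a, 'n::finite) chart set \<Rightarrow> ('a, 'n) tfield \<Rightarrow> bool" where
  "riemannian_manifold M A g \<longleftrightarrow> smooth_manifold M A \<and> riemannian_metric A g"

text \<open>The function on the manifold given by a scalar that is computed in coordinates: its value
  at \<open>p\<close> is the common value in all charts around \<open>p\<close>.\<close>

definition at_point ::
    "('a, 'n::finite) chart set \<Rightarrow> (('a, 'n) chart \<Rightarrow> real ^ 'n \<Rightarrow> real) \<Rightarrow> 'a \<Rightarrow> real" where
  "at_point A s p = (THE r. \<forall>c\<in>A. p \<in> dom_of c \<longrightarrow> s c (coord c p) = r)"

text \<open>The unique Borel measure that has density \<open>sqrt (det g)\<close> with respect to Lebesgue measure
  in every chart.\<close>

definition riemannian_measure ::
    "'a topology \<Rightarrow> ('a, 'n::finite) chart set \<Rightarrow> ('a, 'n) tfield \<Rightarrow> 'a measure" where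
  "riemannian_measure M A g = (THE \<mu>.
     space \<mu> = topspace M \<and> sets \<mu> = sigma_sets (topspace M) {U. openin M U} \<and>
     (\<forall>c\<in>A. \<forall>B \<in> sets \<mu>. B \<subseteq> dom_of c \<longrightarrow>
        emeasure \<mu> B =
          (\<integral>\<^sup>+ x. ennreal (sqrt (det (g c x))) * indicator (coord c ` B) x \<partial>lborel)))"


section \<open>Pointwise metric operations\<close>

definition ginv :: "('a, 'n::finite) tfield \<Rightarrow> ('a, 'n) tfield" where
  "ginv g c x = matrix_inv (g c x)"

definition vec_inner ::
    "('a, 'n::finite) tfield \<Rightarrow> ('a, 'n) chart \<Rightarrow> real ^ 'n \<Rightarrow> real ^ 'n \<Rightarrow> real ^ 'n \<Rightarrow> real" where
  "vec_inner g c x v w = (\<Sum>i\<in>UNIV. \<Sum>j\<in>UNIV. g c x $ i $ j * v $ i * w $ j)"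

definition tensor_trace ::
    "('a, 'n::finite) tfield \<Rightarrow> ('a, 'n) chart \<Rightarrow> real ^ 'n \<Rightarrow> real ^ 'n ^ 'n \<Rightarrow> real" where
  "tensor_trace g c x T = (\<Sum>i\<in>UNIV. \<Sum>j\<in>UNIV. ginv g c x $ i $ j * T $ i $ j)"

definition tensor_inner ::
    "('a, 'n::finite) tfield \<Rightarrow> ('a, 'n) chart \<Rightarrow> real ^ 'n \<Rightarrow> real ^ 'n ^ 'n \<Rightarrow> real ^ 'n ^ 'n \<Rightarrow> real" where
  "tensor_inner g c x S T =
     (\<Sum>i\<in>UNIV. \<Sum>j\<in>UNIV. \<Sum>k\<in>UNIV. \<Sum>l\<in>UNIV.
        ginv g c x $ i $ k * ginv g c x $ j $ l * S $ i $ j * T $ k $ l)"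

definition tensor_norm ::
    "('a, 'n::finite) tfield \<Rightarrow> ('a, 'n) chart \<Rightarrow> real ^ 'n \<Rightarrow> real ^ 'n ^ 'n \<Rightarrow> real" where
  "tensor_norm g c x T = sqrt (tensor_inner g c x T T)"


section \<open>Levi-Civita connection and curvature\<close>

text \<open>\<open>christoffel g c x k i j\<close> is the symbol with upper index \<open>k\<close> and lower indices \<open>i\<close>, \<open>j\<close>.\<close>

definition christoffel ::
    "('a, 'n::finite) tfield \<Rightarrow> ('a, 'n) chart \<Rightarrow> real ^ 'n \<Rightarrow> 'n \<Rightarrow> 'n \<Rightarrow> 'n \<Rightarrow> real" where
  "christoffel g c x k i j =
     (\<Sum>l\<in>UNIV. ginv g c x $ k $ l *
        (pderiv_at i (\<lambda>y. g c y $ j $ l) x + pderiv_at j (\<lambda>y. g c y $ i $ l) x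
         - pderiv_at l (\<lambda>y. g c y $ i $ j) x)) / 2"

text \<open>\<open>riemann g c x l k i j\<close> is the component along the coordinate field \<open>l\<close> of
  \<open>R(\<partial>\<^sub>i, \<partial>\<^sub>j) \<partial>\<^sub>k\<close>, where
  \<open>R(X, Y) Z = \<nabla>\<^sub>X \<nabla>\<^sub>Y Z - \<nabla>\<^sub>Y \<nabla>\<^sub>X Z - \<nabla>\<^bsub>[X, Y]\<^esub> Z\<close>.\<close>

definition riemann ::
    "('a, 'n::finite) tfield \<Rightarrow> ('a, 'n) chart \<Rightarrow> real ^ 'n \<Rightarrow> 'n \<Rightarrow> 'n \<Rightarrow> 'n \<Rightarrow> 'n \<Rightarrow> real" where
  "riemann g c x l k i j =
     pderiv_at i (\<lambda>y. christoffel g c y l j k) x - pderiv_at j (\<lambda>y. christoffel g c y l i k) x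
     + (\<Sum>m\<in>UNIV. christoffel g c x l i m * christoffel g c x m j k
                 - christoffel g c x l j m * christoffel g c x m i k)"

definition ricci :: "('a, 'n::finite) tfield \<Rightarrow> ('a, 'n) tfield" where
  "ricci g c x = (\<chi> j k. \<Sum>i\<in>UNIV. riemann g c x i k i j)"

definition scalar_curvature :: "('a, 'n::finite) chart set \<Rightarrow> ('a, 'n) tfield \<Rightarrow> 'a \<Rightarrow> real" where
  "scalar_curvature A g = at_point A (\<lambda>c x. tensor_trace g c x (ricci g c x))"


section \<open>Differential operators\<close>

definition gradient :: "('a, 'n::finite) tfield \<Rightarrow> ('a \<Rightarrow> real) \<Rightarrow> ('a, 'n) vfield" where
  "gradient g f c x = (\<chi> i. \<Sum>j\<in>UNIV. ginv g c x $ i $ j * pderiv_at j (f \<circ> point_of c) x)"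

definition hessian :: "('a, 'n::finite) tfield \<Rightarrow> ('a \<Rightarrow> real) \<Rightarrow> ('a, 'n) tfield" where
  "hessian g f c x = (\<chi> i j. pderiv_at i (pderiv_at j (f \<circ> point_of c)) x
     - (\<Sum>k\<in>UNIV. christoffel g c x k i j * pderiv_at k (f \<circ> point_of c) x))"

definition laplacian :: "('a, 'n::finite) chart set \<Rightarrow> ('a, 'n) tfield \<Rightarrow> ('a \<Rightarrow> real) \<Rightarrow> 'a \<Rightarrow> real" where
  "laplacian A g f = at_point A (\<lambda>c x. tensor_trace g c x (hessian g f c x))"

definition divergence :: "('a, 'n::finite) chart set \<Rightarrow> ('a, 'n) tfield \<Rightarrow> ('a, 'n) vfield \<Rightarrow> 'a \<Rightarrow> real" where
  "divergence A g X = at_point A (\<lambda>c x.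
     \<Sum>i\<in>UNIV. pderiv_at i (\<lambda>y. X c y $ i) x + (\<Sum>k\<in>UNIV. christoffel g c x i i k * X c x $ k))"

definition lie_metric :: "('a, 'n::finite) vfield \<Rightarrow> ('a, 'n) tfield \<Rightarrow> ('a, 'n) tfield" where
  "lie_metric X g c x = (\<chi> i j. \<Sum>k\<in>UNIV.
     X c x $ k * pderiv_at k (\<lambda>y. g c y $ i $ j) x
     + g c x $ k $ j * pderiv_at i (\<lambda>y. X c y $ k) x
     + g c x $ i $ k * pderiv_at j (\<lambda>y. X c y $ k) x)"

definition h_almost_RB_soliton ::
    "'a topology \<Rightarrow> ('a, 'n::finite) chart set \<Rightarrow> ('a, 'n) tfield \<Rightarrow> ('a, 'n) vfield
      \<Rightarrow> ('a \<Rightarrow> real) \<Rightarrow> ('a \<Rightarrow> real) \<Rightarrow> real \<Rightarrow> bool" where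
  "h_almost_RB_soliton M A g \<xi> h lam \<rho> \<longleftrightarrow>
     riemannian_manifold M A g \<and> vector_field A \<xi> \<and> smooth_fun A h \<and> smooth_fun A lam \<and>
     (\<forall>c\<in>A. \<forall>p\<in>dom_of c.
        ricci g c (coord c p) + (h p / 2) *\<^sub>R lie_metric \<xi> g c (coord c p)
          = (lam p + \<rho> * scalar_curvature A g p) *\<^sub>R g c (coord c p))"

definition hodge_decomposition ::
    "'a topology \<Rightarrow> ('a, 'n::finite) chart set \<Rightarrow> ('a, 'n) tfield \<Rightarrow> ('a, 'n) vfield
      \<Rightarrow> ('a \<Rightarrow> real) \<Rightarrow> ('a, 'n) vfield \<Rightarrow> bool" where
  "hodge_decomposition M A g \<xi> f Y \<longleftrightarrow>
     smooth_fun A f \<and> vector_field A Y \<and> (\<forall>p\<in>topspace M. divergence A g Y p = 0) \<and>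
     (\<forall>c\<in>A. \<forall>p\<in>dom_of c. \<xi> c (coord c p) = gradient g f c (coord c p) + Y c (coord c p))"

end

theory Submission
  imports Defs
begin

text \<open>
  Write \<open>H\<close> and \<open>T\<close> for the trace-free parts of \<open>\<nabla>\<^sup>2 f\<close> and \<open>Ric\<close>, and \<open>L\<close> for
  \<open>L\<^sub>Y g\<close>, which is trace-free because \<open>div Y = 0\<close>.  As \<open>L\<^sub>\<xi> g = 2 \<nabla>\<^sup>2 f + L\<close>, the trace-free part
  of the soliton equation reads \<open>T = - h H - (h/2) L\<close>.  Pairing it with \<open>H\<close>, with \<open>L\<close> and with \<open>T / h\<close>
  expresses the three integrands through \<open>\<langle>T, H\<rangle>\<close> and \<open>\<langle>T, L\<rangle>\<close>.  By the contracted Bianchi identity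
  \<open>div (Ric X) = dR(X) / 2 + \<langle>Ric, L\<^sub>X g\<rangle> / 2\<close>, and \<open>div (R X) = dR(X) + R div X\<close>; with \<open>X = \<nabla>f\<close> and
  \<open>X = Y\<close> these two pairings become multiples of \<open>dR(\<nabla>f)\<close> and \<open>dR(Y)\<close> up to divergences, and \<open>dR(Y)\<close> is
  itself the divergence of \<open>R Y\<close>.  Divergences integrate to zero: a partition of unity reduces this to
  one chart, where it says that a partial derivative of a compactly supported function has integral zero.
\<close>

section \<open>Partial derivatives\<close>

text \<open>Two notions in the statement are definite descriptions: \<open>at_point\<close> denotes
  a value only once all charts agree, and \<open>riemannian_measure\<close> only once existence and
  uniqueness are known. Hence the space given to transformation laws and to change of variables.
  Tensor fields are matrices of components, so index calculus becomes matrix algebra: the connection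
  in direction \<open>i\<close> is a matrix \<open>Gam i\<close>, curvature is a commutator, and
  Leibniz rules are the product rule for matrices. Christoffel symbols are never transformed between
  charts; what contains them is traced back to a Lie derivative of the metric: the Hessian is half
  of \<open>lie_metric (gradient g f) g\<close>, and a divergence is half the trace of a Lie
  derivative. The coefficient \<open>(n - 2) / (2 * n)\<close> is 1/2 - 1/n: the 1/2 belongs to the
  contracted Bianchi identity, the 1/n to the trace part \<open>R / n\<close> taken off the Ricci
  tensor. In div (R \<nabla>f) / n - div (Ric \<nabla>f) the factor \<open>lam + \<rho> * R\<close>
  of the soliton equation cancels, which is why it leaves no trace in the formulas.\<close>

definition pd :: "'n::finite \<Rightarrow> (real ^ 'n \<Rightarrow> 'b::real_normed_vector) \<Rightarrow> real ^ 'n \<Rightarrow> 'b" where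
  "pd i F x = frechet_derivative F (at x) (axis i 1)"

text \<open>The codomain of \<open>pd\<close> is any normed space, so a matrix field is
  differentiated as a whole; this equation carries the given definitions, which speak of scalar
  functions, over to it.\<close>

lemma pderiv_at_eq_pd: "pderiv_at i u = pd i u"
  by (auto simp: fun_eq_iff pderiv_at_def pd_def)

lemma pd_eqI: "(F has_derivative D) (at x) \<Longrightarrow> pd i F x = D (axis i 1)"
  unfolding pd_def using frechet_derivative_at by metis

text \<open>Components are controlled only on the open image of a chart.
  \<open>frechet_derivative\<close> is a choice among the derivatives at \<open>x\<close>, and being
  a derivative is a local property, so the values agree even where no derivative exists.\<close>

lemma pd_cong:
  assumes "open S" "x \<in> S" "\<And>y. y \<in> S \<Longrightarrow> F y = G y"
  shows "pd i F x = pd i G x"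
proof -
  have "(F has_derivative D) (at x) \<longleftrightarrow> (G has_derivative D) (at x)" for D
    using has_derivative_transform_within_open[OF _ assms(1,2)] assms(3) by metis
  then show ?thesis unfolding pd_def frechet_derivative_def by simp
qed

lemma differentiable_cong_open:
  assumes "open S" "x \<in> S" "\<And>y. y \<in> S \<Longrightarrow> F y = G y" "F differentiable (at x)"
  shows "G differentiable (at x)"
  using assms unfolding differentiable_def
  by (metis has_derivative_transform_within_open)

lemma pd_const [simp]: "pd i (\<lambda>y. c) x = 0"
  by (rule pd_eqI[THEN trans], rule has_derivative_const, simp)

lemma pd_add:
  assumes "F differentiable (at x)" "G differentiable (at x)"
  shows "pd i (\<lambda>y. F y + G y) x = pd i F x + pd i G x"
  using assms unfolding frechet_derivative_works pd_def
  by (intro pd_eqI[unfolded pd_def, THEN trans] has_derivative_add) auto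

lemma pd_diff:
  assumes "F differentiable (at x)" "G differentiable (at x)"
  shows "pd i (\<lambda>y. F y - G y) x = pd i F x - pd i G x"
  using assms unfolding frechet_derivative_works pd_def
  by (intro pd_eqI[unfolded pd_def, THEN trans] has_derivative_diff) auto

lemma pd_sum:
  assumes "\<And>a. a \<in> I \<Longrightarrow> F a differentiable (at x)"
  shows "pd i (\<lambda>y. \<Sum>a\<in>I. F a y) x = (\<Sum>a\<in>I. pd i (F a) x)"
  using assms unfolding frechet_derivative_works pd_def
  by (intro pd_eqI[unfolded pd_def, THEN trans] has_derivative_sum) auto

lemma pd_bounded_linear:
  assumes "bounded_linear L" "F differentiable (at x)"
  shows "pd i (\<lambda>y. L (F y)) x = L (pd i F x)"
proof -
  have "((\<lambda>y. L (F y)) has_derivative (\<lambda>h. L (frechet_derivative F (at x) h))) (at x)"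
    using bounded_linear.has_derivative[OF assms(1)] assms(2) unfolding frechet_derivative_works by blast
  from pd_eqI[OF this] show ?thesis by (simp add: pd_def)
qed

lemma pd_bounded_bilinear:
  assumes "bounded_bilinear B" "F differentiable (at x)" "G differentiable (at x)"
  shows "pd i (\<lambda>y. B (F y) (G y)) x = B (pd i F x) (G x) + B (F x) (pd i G x)"
proof -
  have "((\<lambda>y. B (F y) (G y)) has_derivative (\<lambda>h. B (F x) (frechet_derivative G (at x) h)
      + B (frechet_derivative F (at x) h) (G x))) (at x)"
    using assms(2,3) bounded_bilinear.FDERIV[OF assms(1)] unfolding frechet_derivative_works by blast
  from pd_eqI[OF this] show ?thesis by (simp add: pd_def add.commute)
qed

lemma pd_mult:
  fixes u v :: "real ^ 'n \<Rightarrow> real"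
  assumes "u differentiable (at x)" "v differentiable (at x)"
  shows "pd i (\<lambda>y. u y * v y) x = pd i u x * v x + u x * pd i v x"
  by (rule pd_bounded_bilinear[OF bounded_bilinear_mult assms])

lemma pd_cmult:
  fixes u :: "real ^ 'n \<Rightarrow> real"
  assumes "u differentiable (at x)"
  shows "pd i (\<lambda>y. c * u y) x = c * pd i u x"
  using pd_mult[of "\<lambda>y. c" x u] assms by simp

lemma differentiable_vec_iff:
  fixes F :: "'a::real_normed_vector \<Rightarrow> 'b::euclidean_space ^ 'm"
  shows "F differentiable (at x) \<longleftrightarrow> (\<forall>a. (\<lambda>y. F y $ a) differentiable (at x))"
proof
  assume "F differentiable (at x)"
  then show "\<forall>a. (\<lambda>y. F y $ a) differentiable (at x)"
    unfolding differentiable_def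
    using bounded_linear.has_derivative[OF bounded_linear_vec_nth] by blast
next
  assume *: "\<forall>a. (\<lambda>y. F y $ a) differentiable (at x)"
  have "(\<lambda>y. F y \<bullet> b) differentiable (at x)" if bB: "b \<in> Basis" for b
  proof -
    obtain a c where b: "b = axis a c" using bB unfolding Basis_vec_def by blast
    have "(\<lambda>y. F y $ a \<bullet> c) differentiable (at x)"
      using * unfolding differentiable_def
      using bounded_linear.has_derivative[OF bounded_linear_inner_left] by blast
    then show ?thesis by (simp add: b inner_axis)
  qed
  then show "F differentiable (at x)"
    unfolding differentiable_componentwise_within[of F] by auto
qed

lemma pd_nth:
  assumes "F differentiable (at x)"
  shows "pd i F x $ a = pd i (\<lambda>y. F y $ a) x"
  using pd_bounded_linear[OF bounded_linear_vec_nth assms] by metis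

lemma has_derivative_pd:
  assumes "F differentiable (at x)"
  shows "(F has_derivative (\<lambda>v. \<Sum>i\<in>UNIV. v $ i *\<^sub>R pd i F x)) (at x)"
proof -
  let ?D = "frechet_derivative F (at x)"
  have D: "(F has_derivative ?D) (at x)" using assms frechet_derivative_works by blast
  have lin: "linear ?D" using D has_derivative_linear by blast
  have "?D v = (\<Sum>i\<in>UNIV. v $ i *\<^sub>R pd i F x)" for v
  proof -
    have "v = (\<Sum>i\<in>UNIV. v $ i *\<^sub>R axis i 1)"
      by (simp add: vec_eq_iff axis_def if_distrib cong: if_cong)
    then have "?D v = ?D (\<Sum>i\<in>UNIV. v $ i *\<^sub>R axis i 1)" by simp
    also have "\<dots> = (\<Sum>i\<in>UNIV. v $ i *\<^sub>R pd i F x)"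
      unfolding pd_def by (simp add: linear_sum[OF lin] linear_scale[OF lin])
    finally show ?thesis .
  qed
  then show ?thesis using D by presburger
qed

lemma pd_chain:
  fixes \<phi> :: "real ^ 'n \<Rightarrow> real ^ 'm"
  assumes "\<phi> differentiable (at x)" "u differentiable (at (\<phi> x))"
  shows "pd i (\<lambda>y. u (\<phi> y)) x = (\<Sum>j\<in>UNIV. pd i (\<lambda>y. \<phi> y $ j) x *\<^sub>R pd j u (\<phi> x))"
proof -
  have "((\<lambda>y. u (\<phi> y)) has_derivative
     (\<lambda>v. \<Sum>j\<in>UNIV. (\<Sum>i\<in>UNIV. v $ i *\<^sub>R pd i \<phi> x) $ j *\<^sub>R pd j u (\<phi> x))) (at x)"
    using has_derivative_compose[OF has_derivative_pd[OF assms(1)] has_derivative_pd[OF assms(2)]] .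
  from pd_eqI[OF this] show ?thesis
    by (simp add: axis_def if_distrib[of "\<lambda>t. t * _"] if_distrib[of "\<lambda>t. t *\<^sub>R _"] pd_nth[OF assms(1)]
        cong: if_cong)
qed

text \<open>Restriction to a coordinate line, the form in which the mean value theorem in one
  variable applies.\<close>

lemma pd_line:
  fixes u :: "real ^ 'n \<Rightarrow> real"
  assumes "u differentiable (at (y + s *\<^sub>R axis i 1))"
  shows "((\<lambda>s. u (y + s *\<^sub>R axis i 1)) has_field_derivative pd i u (y + s *\<^sub>R axis i 1)) (at s)"
proof -
  have 1: "((\<lambda>s. y + s *\<^sub>R axis i 1) has_derivative (\<lambda>h. h *\<^sub>R axis i 1)) (at s)"
    by (auto intro!: derivative_eq_intros)
  have 2: "(\<Sum>j\<in>UNIV. (h *\<^sub>R axis i (1::real)) $ j *\<^sub>R pd j u (y + s *\<^sub>R axis i 1))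
     = pd i u (y + s *\<^sub>R axis i 1) * h" for h
    by (simp add: axis_def if_distrib[of "\<lambda>t. _ * t"] if_distrib[of "\<lambda>t. t * _"] cong: if_cong)
  show ?thesis
    using has_derivative_compose[OF 1 has_derivative_pd[OF assms]]
    unfolding 2 has_field_derivative_def by (simp add: o_def)
qed


section \<open>The classes \<open>Ck_on\<close>\<close>

lemma Ck_on_Suc_pd:
  "Ck_on (Suc k) S u \<longleftrightarrow> (\<forall>x\<in>S. u differentiable (at x)) \<and> (\<forall>i. Ck_on k S (pd i u))"
  by (simp add: pderiv_at_eq_pd)

declare Ck_on.simps(2)[simp del]

lemma Ck_on_1_differentiable: "Ck_on 1 S u \<Longrightarrow> x \<in> S \<Longrightarrow> u differentiable (at x)"
  by (simp add: Ck_on_Suc_pd)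

lemma Ck_on_cong:
  assumes "open S" "\<And>y. y \<in> S \<Longrightarrow> u y = v y"
  shows "Ck_on k S u \<longleftrightarrow> Ck_on k S v"
  using assms(2)
proof (induction k arbitrary: u v)
  case 0
  then show ?case by (simp cong: continuous_on_cong)
next
  case (Suc k)
  have "(\<forall>x\<in>S. u differentiable (at x)) \<longleftrightarrow> (\<forall>x\<in>S. v differentiable (at x))"
    using differentiable_cong_open[OF assms(1)] Suc.prems by metis
  moreover have "Ck_on k S (pd i u) = Ck_on k S (pd i v)" for i
    by (rule Suc.IH) (use pd_cong[OF assms(1)] Suc.prems in blast)
  ultimately show ?case unfolding Ck_on_Suc_pd by blast
qed

lemma Ck_on_Suc_imp: "Ck_on (Suc k) S u \<Longrightarrow> Ck_on k S u"
proof (induction k arbitrary: u)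
  case 0
  then show ?case
    by (auto simp: Ck_on_Suc_pd intro!: continuous_at_imp_continuous_on differentiable_imp_continuous_within)
next
  case (Suc k)
  then show ?case using Ck_on_Suc_pd by blast
qed

lemma Ck_on_continuous: "Ck_on k S u \<Longrightarrow> continuous_on S u"
  by (induction k) (auto dest: Ck_on_Suc_imp)

text \<open>Gluing for cut-off functions: one open set where they are given by a formula, another
  where they vanish.\<close>

lemma Ck_on_open_Un:
  "Ck_on k S u \<Longrightarrow> Ck_on k T u \<Longrightarrow> open S \<Longrightarrow> open T \<Longrightarrow> Ck_on k (S \<union> T) u"
  by (induction k arbitrary: u) (auto simp: Ck_on_Suc_pd intro: continuous_on_open_Un)

lemma Ck_on_const: "Ck_on k S (\<lambda>y. c)"
proof (induction k arbitrary: c)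
  case (Suc k)
  have "pd i (\<lambda>y. c) = (\<lambda>y. 0::real)" for i :: 'a by (simp add: fun_eq_iff)
  then show ?case using Suc by (simp add: Ck_on_Suc_pd)
qed simp

lemma Ck_on_add:
  assumes "open S" "Ck_on k S u" "Ck_on k S v"
  shows "Ck_on k S (\<lambda>y. u y + v y)"
  using assms(2,3)
proof (induction k arbitrary: u v)
  case (Suc k)
  have "Ck_on k S (pd i (\<lambda>y. u y + v y))" for i
    using Ck_on_cong[OF assms(1), of "pd i (\<lambda>y. u y + v y)" "\<lambda>y. pd i u y + pd i v y"]
      Suc pd_add[of u _ v] unfolding Ck_on_Suc_pd by blast
  then show ?case using Suc.prems by (simp add: Ck_on_Suc_pd)
qed (simp add: continuous_on_add)

lemma Ck_on_sum:
  assumes "open S" "\<And>a. a \<in> I \<Longrightarrow> Ck_on k S (u a)"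
  shows "Ck_on k S (\<lambda>y. \<Sum>a\<in>I. u a y)"
  using assms(2)
  by (induction I rule: infinite_finite_induct) (auto intro: Ck_on_const Ck_on_add[OF assms(1)])

lemma Ck_on_mult:
  assumes "open S" "Ck_on k S u" "Ck_on k S v"
  shows "Ck_on k S (\<lambda>y. u y * v y)"
  using assms(2,3)
proof (induction k arbitrary: u v)
  case (Suc k)
  have "Ck_on k S (pd i (\<lambda>y. u y * v y))" for i
  proof -
    have "Ck_on k S (\<lambda>y. pd i u y * v y + u y * pd i v y)"
      using Suc.prems Ck_on_Suc_imp[OF Suc.prems(1)] Ck_on_Suc_imp[OF Suc.prems(2)]
      by (intro Ck_on_add[OF assms(1)] Suc.IH) (auto simp: Ck_on_Suc_pd)
    then show ?thesis
      using Ck_on_cong[OF assms(1), of "pd i (\<lambda>y. u y * v y)" "\<lambda>y. pd i u y * v y + u y * pd i v y"]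
        Suc.prems pd_mult[of u _ v] unfolding Ck_on_Suc_pd by blast
  qed
  then show ?case using Suc.prems by (simp add: Ck_on_Suc_pd)
qed (simp add: continuous_on_mult)

lemma Ck_on_prod:
  assumes "open S" "\<And>a. a \<in> I \<Longrightarrow> Ck_on k S (u a)"
  shows "Ck_on k S (\<lambda>y. \<Prod>a\<in>I. u a y)"
  using assms(2)
  by (induction I rule: infinite_finite_induct) (auto intro: Ck_on_const Ck_on_mult[OF assms(1)])

lemma Ck_on_cmult: "open S \<Longrightarrow> Ck_on k S u \<Longrightarrow> Ck_on k S (\<lambda>y. c * u y)"
  by (intro Ck_on_mult Ck_on_const)

lemma Ck_on_minus: "open S \<Longrightarrow> Ck_on k S u \<Longrightarrow> Ck_on k S (\<lambda>y. - u y)"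
  using Ck_on_cmult[of S k u "-1"] by simp

lemma Ck_on_diff: "open S \<Longrightarrow> Ck_on k S u \<Longrightarrow> Ck_on k S v \<Longrightarrow> Ck_on k S (\<lambda>y. u y - v y)"
  using Ck_on_add[OF _ _ Ck_on_minus, of S k u v] by simp

lemma pd_inverse:
  fixes u :: "real ^ 'n \<Rightarrow> real"
  assumes "u differentiable (at x)" "u x \<noteq> 0"
  shows "pd i (\<lambda>y. inverse (u y)) x = - (pd i u x * (inverse (u x) * inverse (u x)))"
proof -
  have "((\<lambda>y. inverse (u y)) has_derivative
      (\<lambda>h. - (inverse (u x) * frechet_derivative u (at x) h * inverse (u x)))) (at x)"
    using Deriv.has_derivative_inverse[where f=u and x=x, OF assms(2)] assms(1) unfolding frechet_derivative_works by blast
  from pd_eqI[OF this] show ?thesis by (simp add: pd_def)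
qed

lemma Ck_on_inverse:
  assumes "open S" "Ck_on k S u" "\<And>y. y \<in> S \<Longrightarrow> u y \<noteq> 0"
  shows "Ck_on k S (\<lambda>y. inverse (u y))"
  using assms(2)
proof (induction k)
  case 0
  then show ?case using assms(3) by (auto intro: continuous_on_inverse)
next
  case (Suc k)
  let ?w = "\<lambda>i y. - (pd i u y * (inverse (u y) * inverse (u y)))"
  have "Ck_on k S (pd i (\<lambda>y. inverse (u y)))" for i
  proof -
    have "Ck_on k S (?w i)"
      using Suc Ck_on_Suc_imp[OF Suc.prems]
      by (intro Ck_on_minus Ck_on_mult assms(1)) (auto simp: Ck_on_Suc_pd)
    then show ?thesis
      using Ck_on_cong[OF assms(1), of "pd i (\<lambda>y. inverse (u y))" "?w i"]
        Suc.prems pd_inverse[of u] assms(3) unfolding Ck_on_Suc_pd by blast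
  qed
  then show ?case using Suc.prems assms(3) by (auto simp: Ck_on_Suc_pd)
qed

lemma Ck_on_divide:
  assumes "open S" "Ck_on k S u" "Ck_on k S v" "\<And>y. y \<in> S \<Longrightarrow> v y \<noteq> 0"
  shows "Ck_on k S (\<lambda>y. u y / v y)"
  unfolding divide_inverse using assms by (intro Ck_on_mult Ck_on_inverse) auto

text \<open>The induction keeps \<open>u\<close> arbitrary because the chain rule yields
  \<open>pd j u\<close> composed with \<open>\<phi>\<close>, to which the hypothesis applies at the
  lower order.\<close>

lemma Ck_on_compose:
  fixes \<phi> :: "real ^ 'n \<Rightarrow> real ^ 'm"
  assumes "open S" "\<And>j. Ck_on k S (\<lambda>y. \<phi> y $ j)" "\<phi> ` S \<subseteq> T" "Ck_on k T u"
  shows "Ck_on k S (\<lambda>y. u (\<phi> y))"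
  using assms(2,4)
proof (induction k arbitrary: u)
  case 0
  have "continuous_on S \<phi>"
    using continuous_on_vec_lambda[of S "\<lambda>j y. \<phi> y $ j"] 0(1) by (simp add: vec_nth_inverse)
  then show ?case using 0 assms(3) continuous_on_compose2[of T u S \<phi>] by auto
next
  case (Suc k)
  have d: "\<phi> differentiable (at y)" if "y \<in> S" for y
    using Suc.prems(1) that by (simp add: differentiable_vec_iff Ck_on_Suc_pd)
  have d': "u differentiable (at (\<phi> y))" if "y \<in> S" for y
    using Suc.prems(2) that assms(3) by (auto simp: Ck_on_Suc_pd)
  have "(\<lambda>y. u (\<phi> y)) differentiable (at y)" if "y \<in> S" for y
    using differentiable_chain_at[OF d d'] that by (simp add: o_def)
  moreover have "Ck_on k S (pd i (\<lambda>y. u (\<phi> y)))" for i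
  proof -
    have 1: "Ck_on k S (\<lambda>y. pd j u (\<phi> y))" for j
      by (rule Suc.IH) (use Suc.prems(2) in \<open>auto simp: Ck_on_Suc_pd intro: Ck_on_Suc_imp[OF Suc.prems(1)]\<close>)
    have 2: "Ck_on k S (pd i (\<lambda>y. \<phi> y $ j))" for j
      using Suc.prems by (auto simp: Ck_on_Suc_pd)
    have "Ck_on k S (\<lambda>y. \<Sum>j\<in>UNIV. pd i (\<lambda>y. \<phi> y $ j) y * pd j u (\<phi> y))"
      by (intro Ck_on_sum[OF assms(1)] Ck_on_mult[OF assms(1)] 1 2)
    then show ?thesis
      using Ck_on_cong[OF assms(1), of "pd i (\<lambda>y. u (\<phi> y))"
         "\<lambda>y. \<Sum>j\<in>UNIV. pd i (\<lambda>y. \<phi> y $ j) y * pd j u (\<phi> y)"]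
        pd_chain[OF d d'] by simp
  qed
  ultimately show ?case by (simp add: Ck_on_Suc_pd)
qed


section \<open>Symmetry of second derivatives\<close>

text \<open>The mean value theorem is applied twice: along \<open>axis i 1\<close> to a difference
  in direction \<open>j\<close>, then along \<open>axis j 1\<close>. The second difference itself is
  symmetric in \<open>i\<close> and \<open>j\<close>. The radius \<open>2 * t\<close> leaves room
  for two steps of length \<open>t\<close>.\<close>

lemma second_difference:
  fixes u :: "real ^ 'n \<Rightarrow> real"
  assumes "Ck_on 2 S u" "cball x (2 * t) \<subseteq> S" "t > 0"
  shows "\<exists>y\<in>cball x (2 * t).
     u (x + t *\<^sub>R axis i 1 + t *\<^sub>R axis j 1) - u (x + t *\<^sub>R axis i 1) - u (x + t *\<^sub>R axis j 1) + u x
     = t * t * pd j (pd i u) y"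
proof -
  have in_ball: "x + a *\<^sub>R axis i 1 + b *\<^sub>R axis j 1 \<in> cball x (2 * t)"
    if "0 \<le> a" "a \<le> t" "0 \<le> b" "b \<le> t" for a b
  proof -
    have "norm (a *\<^sub>R axis i (1::real) + b *\<^sub>R axis j 1 :: real ^ 'n) \<le> a + b"
      using norm_triangle_ineq[of "a *\<^sub>R axis i (1::real)" "b *\<^sub>R axis j 1"] that by simp
    then have "dist (x + a *\<^sub>R axis i 1 + b *\<^sub>R axis j 1) x \<le> 2 * t"
      using that by (simp add: dist_norm add.assoc)
    then show ?thesis by (simp add: dist_commute)
  qed
  have dif: "u differentiable (at y)" "pd k u differentiable (at y)" if "y \<in> cball x (2 * t)" for y k
    using assms(1,2) that by (auto simp: numeral_2_eq_2 Ck_on_Suc_pd)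
  let ?F = "\<lambda>s. u (x + t *\<^sub>R axis j 1 + s *\<^sub>R axis i 1) - u (x + s *\<^sub>R axis i 1)"
  have "\<exists>a. 0 < a \<and> a < t \<and> ?F t - ?F 0 = (t - 0) *
      (pd i u (x + t *\<^sub>R axis j 1 + a *\<^sub>R axis i 1) - pd i u (x + a *\<^sub>R axis i 1))"
  proof (rule MVT2[OF assms(3)])
    fix s assume s: "0 \<le> s" "s \<le> t"
    show "(?F has_real_derivative pd i u (x + t *\<^sub>R axis j 1 + s *\<^sub>R axis i 1)
        - pd i u (x + s *\<^sub>R axis i 1)) (at s)"
      using in_ball[of s t] in_ball[of s 0] s assms(3)
      by (intro DERIV_diff pd_line dif) (auto simp: algebra_simps)
  qed
  then obtain a where a: "0 < a" "a < t" and
    Fa: "?F t - ?F 0 = t * (pd i u (x + t *\<^sub>R axis j 1 + a *\<^sub>R axis i 1) - pd i u (x + a *\<^sub>R axis i 1))"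
    by auto
  have "\<exists>b. 0 < b \<and> b < t \<and> pd i u ((x + a *\<^sub>R axis i 1) + t *\<^sub>R axis j 1)
       - pd i u ((x + a *\<^sub>R axis i 1) + 0 *\<^sub>R axis j 1)
     = (t - 0) * pd j (pd i u) ((x + a *\<^sub>R axis i 1) + b *\<^sub>R axis j 1)"
    using in_ball[of a] a by (intro MVT2[OF assms(3)] pd_line dif) auto
  then obtain b where b: "0 < b" "b < t" and
    Fb: "pd i u (x + t *\<^sub>R axis j 1 + a *\<^sub>R axis i 1) - pd i u (x + a *\<^sub>R axis i 1)
       = t * pd j (pd i u) (x + a *\<^sub>R axis i 1 + b *\<^sub>R axis j 1)"
    by (auto simp: add.commute add.left_commute)
  show ?thesis
    using Fa Fb in_ball[of a b] a b by (intro bexI) (auto simp: algebra_simps)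
qed

lemma pd_commute:
  fixes u :: "real ^ 'n \<Rightarrow> real"
  assumes "open S" "x \<in> S" "Ck_on 2 S u"
  shows "pd i (pd j u) x = pd j (pd i u) x"
proof -
  obtain r where r: "r > 0" "cball x r \<subseteq> S" using assms(1,2) open_contains_cball by metis
  define t where "t n = r / (2 * real (Suc n))" for n
  have t: "t n > 0" "2 * t n \<le> r" for n using r by (auto simp: t_def field_simps)
  have t0: "(\<lambda>n. 2 * t n) \<longlonglongrightarrow> 0"
  proof -
    have "(\<lambda>n. r * inverse (real (Suc n))) \<longlonglongrightarrow> r * 0"
      by (intro tendsto_mult tendsto_const LIMSEQ_inverse_real_of_nat)
    moreover have "2 * t n = r * inverse (real (Suc n))" for n
      by (simp add: t_def field_simps)
    ultimately show ?thesis by simp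
  qed
  have sub: "cball x (2 * t n) \<subseteq> S" for n using r t(2)[of n] by auto
  \<comment> \<open>Both orders of differencing give the same number, so the two mixed derivatives
    agree at some points \<open>y\<close> and \<open>z\<close>, which tend to \<open>x\<close> as
    \<open>n\<close> grows; continuity does the rest.\<close>
  have "\<exists>y z. y \<in> cball x (2 * t n) \<and> z \<in> cball x (2 * t n) \<and> pd j (pd i u) y = pd i (pd j u) z" for n
  proof -
    obtain y where y: "y \<in> cball x (2 * t n)"
      "u (x + t n *\<^sub>R axis i 1 + t n *\<^sub>R axis j 1) - u (x + t n *\<^sub>R axis i 1) - u (x + t n *\<^sub>R axis j 1) + u x
     = t n * t n * pd j (pd i u) y"
      using second_difference[OF assms(3) sub t(1)] by blast
    obtain z where z: "z \<in> cball x (2 * t n)"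
      "u (x + t n *\<^sub>R axis j 1 + t n *\<^sub>R axis i 1) - u (x + t n *\<^sub>R axis j 1) - u (x + t n *\<^sub>R axis i 1) + u x
     = t n * t n * pd i (pd j u) z"
      using second_difference[OF assms(3) sub t(1)] by blast
    have "t n * t n * pd j (pd i u) y = t n * t n * pd i (pd j u) z"
      using y(2) z(2) by (simp add: algebra_simps)
    then show ?thesis using y z t(1)[of n] by auto
  qed
  then obtain Y Z where YZ: "\<And>n. Y n \<in> cball x (2 * t n)" "\<And>n. Z n \<in> cball x (2 * t n)"
    "\<And>n. pd j (pd i u) (Y n) = pd i (pd j u) (Z n)" by metis
  have lim: "W \<longlonglongrightarrow> x" if "\<And>n. W n \<in> cball x (2 * t n)" for W
  proof (rule metric_tendsto_imp_tendsto[OF t0])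
    show "\<forall>\<^sub>F n in sequentially. dist (W n) x \<le> dist (2 * t n) 0"
      using that t(1) by (auto simp: dist_commute intro!: always_eventually order_trans[OF _ abs_ge_self])
  qed
  have "continuous_on S (pd a (pd b u))" for a b
    using assms(3) by (simp add: numeral_2_eq_2 Ck_on_Suc_pd)
  then have cont: "isCont (pd a (pd b u)) x" for a b
    using assms(1,2) continuous_on_eq_continuous_at by blast
  have "(\<lambda>n. pd j (pd i u) (Y n)) \<longlonglongrightarrow> pd j (pd i u) x"
    using isCont_tendsto_compose[OF cont lim] YZ(1) by blast
  moreover have "(\<lambda>n. pd i (pd j u) (Z n)) \<longlonglongrightarrow> pd i (pd j u) x"
    using isCont_tendsto_compose[OF cont lim] YZ(2) by blast
  ultimately show ?thesis using YZ(3) LIMSEQ_unique by simp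
qed


section \<open>Smooth functions and matrix fields\<close>

lemma smooth_on_const: "smooth_on S (\<lambda>y. c)"
  and smooth_on_add: "open S \<Longrightarrow> smooth_on S u \<Longrightarrow> smooth_on S v \<Longrightarrow> smooth_on S (\<lambda>y. u y + v y)"
  and smooth_on_diff: "open S \<Longrightarrow> smooth_on S u \<Longrightarrow> smooth_on S v \<Longrightarrow> smooth_on S (\<lambda>y. u y - v y)"
  and smooth_on_mult: "open S \<Longrightarrow> smooth_on S u \<Longrightarrow> smooth_on S v \<Longrightarrow> smooth_on S (\<lambda>y. u y * v y)"
  and smooth_on_divide: "open S \<Longrightarrow> smooth_on S u \<Longrightarrow> smooth_on S v \<Longrightarrow> (\<And>y. y \<in> S \<Longrightarrow> v y \<noteq> 0)
    \<Longrightarrow> smooth_on S (\<lambda>y. u y / v y)"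
  by (simp_all add: smooth_on_def Ck_on_const Ck_on_add Ck_on_diff Ck_on_mult Ck_on_divide)

lemma smooth_on_sum:
  "open S \<Longrightarrow> (\<And>a. a \<in> I \<Longrightarrow> smooth_on S (u a)) \<Longrightarrow> smooth_on S (\<lambda>y. \<Sum>a\<in>I. u a y)"
  and smooth_on_prod:
  "open S \<Longrightarrow> (\<And>a. a \<in> I \<Longrightarrow> smooth_on S (u a)) \<Longrightarrow> smooth_on S (\<lambda>y. \<Prod>a\<in>I. u a y)"
  by (simp_all add: smooth_on_def Ck_on_sum Ck_on_prod)

lemma smooth_on_cong: "open S \<Longrightarrow> (\<And>y. y \<in> S \<Longrightarrow> u y = v y) \<Longrightarrow> smooth_on S u \<longleftrightarrow> smooth_on S v"
  unfolding smooth_on_def using Ck_on_cong by blast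

lemma smooth_on_pd: "smooth_on S u \<Longrightarrow> smooth_on S (pd i u)"
  using Ck_on_Suc_pd unfolding smooth_on_def by blast

lemma smooth_on_differentiable: "smooth_on S u \<Longrightarrow> x \<in> S \<Longrightarrow> u differentiable (at x)"
  using Ck_on_Suc_pd unfolding smooth_on_def by blast

lemma smooth_on_continuous: "smooth_on S u \<Longrightarrow> continuous_on S u"
  using Ck_on_continuous unfolding smooth_on_def by blast

lemma smooth_on_pd_commute:
  "open S \<Longrightarrow> smooth_on S u \<Longrightarrow> x \<in> S \<Longrightarrow> pd i (pd j u) x = pd j (pd i u) x"
  using pd_commute unfolding smooth_on_def by blast

section \<open>Matrix-valued functions: product rule, smoothness, derivative of the
  determinant\<close>

lemma bounded_bilinear_matrix_mult:
  "bounded_bilinear ((**) :: real ^ 'm ^ 'n \<Rightarrow> real ^ 'k ^ 'm \<Rightarrow> real ^ 'k ^ 'n)"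
  unfolding bilinear_conv_bounded_bilinear[symmetric] bilinear_def
  by (auto intro!: linearI simp: matrix_matrix_mult_def vec_eq_iff sum.distrib algebra_simps sum_distrib_left)

lemmas matrix_mult_linear =
  bounded_bilinear.add_left[OF bounded_bilinear_matrix_mult]
  bounded_bilinear.add_right[OF bounded_bilinear_matrix_mult]
  bounded_bilinear.diff_left[OF bounded_bilinear_matrix_mult]
  bounded_bilinear.diff_right[OF bounded_bilinear_matrix_mult]
  bounded_bilinear.minus_left[OF bounded_bilinear_matrix_mult]
  bounded_bilinear.minus_right[OF bounded_bilinear_matrix_mult]
  bounded_bilinear.scaleR_left[OF bounded_bilinear_matrix_mult]
  bounded_bilinear.scaleR_right[OF bounded_bilinear_matrix_mult]
  bounded_bilinear.sum_left[OF bounded_bilinear_matrix_mult]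
  bounded_bilinear.sum_right[OF bounded_bilinear_matrix_mult]
  bounded_bilinear.zero_left[OF bounded_bilinear_matrix_mult]
  bounded_bilinear.zero_right[OF bounded_bilinear_matrix_mult]

lemma bounded_linear_transpose: "bounded_linear (transpose :: real ^ 'm ^ 'n \<Rightarrow> real ^ 'n ^ 'm)"
  unfolding linear_conv_bounded_linear[symmetric]
  by (auto intro!: linearI simp: transpose_def vec_eq_iff)

lemmas transpose_linear =
  linear_add[OF bounded_linear.linear[OF bounded_linear_transpose]]
  linear_diff[OF bounded_linear.linear[OF bounded_linear_transpose]]
  linear_neg[OF bounded_linear.linear[OF bounded_linear_transpose]]
  linear_sum[OF bounded_linear.linear[OF bounded_linear_transpose]]
  linear_scale[OF bounded_linear.linear[OF bounded_linear_transpose]]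
  linear_0[OF bounded_linear.linear[OF bounded_linear_transpose]]

lemma matrix_mult_nth: "(A ** B) $ i $ j = (\<Sum>k\<in>UNIV. A $ i $ k * B $ k $ j)"
  by (simp add: matrix_matrix_mult_def)

lemma transpose_nth: "transpose A $ i $ j = A $ j $ i"
  by (simp add: transpose_def)

definition smooth_matrix :: "(real ^ 'n) set \<Rightarrow> (real ^ 'n \<Rightarrow> real ^ 'k ^ 'm) \<Rightarrow> bool" where
  "smooth_matrix S F \<longleftrightarrow> (\<forall>a b. smooth_on S (\<lambda>y. F y $ a $ b))"

lemma smooth_matrix_differentiable:
  fixes F :: "real ^ 'n \<Rightarrow> real ^ 'k ^ 'm"
  assumes "smooth_matrix S F" "x \<in> S" shows "F differentiable (at x)"
  unfolding differentiable_vec_iff using assms smooth_on_differentiable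
  unfolding smooth_matrix_def by blast

lemma pd_matrix_nth:
  fixes F :: "real ^ 'n \<Rightarrow> real ^ 'k ^ 'm"
  assumes "F differentiable (at x)" shows "pd i F x $ a $ b = pd i (\<lambda>y. F y $ a $ b) x"
proof -
  have "(\<lambda>y. F y $ a) differentiable (at x)" using assms differentiable_vec_iff by blast
  then show ?thesis using pd_nth assms by metis
qed

lemma smooth_matrix_pd:
  assumes "open S" "smooth_matrix S F" shows "smooth_matrix S (pd i F)"
  unfolding smooth_matrix_def
proof (intro allI)
  fix a b
  have "smooth_on S (pd i (\<lambda>y. F y $ a $ b))"
    using assms(2) smooth_on_pd unfolding smooth_matrix_def by blast
  then show "smooth_on S (\<lambda>y. pd i F y $ a $ b)"
    using smooth_on_cong[OF assms(1), of "\<lambda>y. pd i F y $ a $ b"]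
      pd_matrix_nth[OF smooth_matrix_differentiable[OF assms(2)]] by metis
qed

lemma smooth_matrix_mult:
  "open S \<Longrightarrow> smooth_matrix S F \<Longrightarrow> smooth_matrix S G \<Longrightarrow> smooth_matrix S (\<lambda>y. F y ** G y)"
  unfolding smooth_matrix_def matrix_mult_nth by (intro allI smooth_on_sum smooth_on_mult) auto

lemma smooth_matrix_add:
  "open S \<Longrightarrow> smooth_matrix S F \<Longrightarrow> smooth_matrix S G \<Longrightarrow> smooth_matrix S (\<lambda>y. F y + G y)"
  unfolding smooth_matrix_def by (auto intro: smooth_on_add)

lemma smooth_matrix_diff:
  "open S \<Longrightarrow> smooth_matrix S F \<Longrightarrow> smooth_matrix S G \<Longrightarrow> smooth_matrix S (\<lambda>y. F y - G y)"
  unfolding smooth_matrix_def by (auto intro: smooth_on_diff)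

lemma smooth_matrix_transpose: "smooth_matrix S F \<Longrightarrow> smooth_matrix S (\<lambda>y. transpose (F y))"
  unfolding smooth_matrix_def transpose_nth by auto

lemma smooth_on_det:
  fixes F :: "real ^ 'n \<Rightarrow> real ^ 'm ^ 'm"
  assumes "open S" "smooth_matrix S F" shows "smooth_on S (\<lambda>y. det (F y))"
  unfolding det_def
  by (intro smooth_on_sum smooth_on_mult smooth_on_prod smooth_on_const assms(1))
     (use assms(2) in \<open>auto simp: smooth_matrix_def\<close>)

lemma pd_matrix_mult:
  fixes F :: "real ^ 'n \<Rightarrow> real ^ 'k ^ 'm" and G :: "real ^ 'n \<Rightarrow> real ^ 'l ^ 'k"
  shows "F differentiable (at x) \<Longrightarrow> G differentiable (at x) \<Longrightarrow>
   pd i (\<lambda>y. F y ** G y) x = pd i F x ** G x + F x ** pd i G x"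
  by (rule pd_bounded_bilinear[OF bounded_bilinear_matrix_mult])

lemma pd_transpose:
  fixes F :: "real ^ 'n \<Rightarrow> real ^ 'k ^ 'm"
  shows "F differentiable (at x) \<Longrightarrow> pd i (\<lambda>y. transpose (F y)) x = transpose (pd i F x)"
  by (rule pd_bounded_linear[OF bounded_linear_transpose])

lemma smooth_matrix_pd_commute:
  assumes "open S" "smooth_matrix S F" "x \<in> S"
  shows "pd i (pd j F) x = pd j (pd i F) x"
proof -
  have *: "pd i (pd j F) x $ a $ b = pd i (pd j (\<lambda>y. F y $ a $ b)) x" for i j a b
  proof -
    have "pd i (pd j F) x $ a $ b = pd i (\<lambda>y. pd j F y $ a $ b) x"
      by (rule pd_matrix_nth) (rule smooth_matrix_differentiable[OF smooth_matrix_pd[OF assms(1,2)] assms(3)])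
    also have "\<dots> = pd i (pd j (\<lambda>y. F y $ a $ b)) x"
      by (rule pd_cong[OF assms(1,3)]) (rule pd_matrix_nth[OF smooth_matrix_differentiable[OF assms(2)]])
    finally show ?thesis .
  qed
  have "smooth_on S (\<lambda>y. F y $ a $ b)" for a b using assms(2) unfolding smooth_matrix_def by blast
  then show ?thesis unfolding vec_eq_iff * using smooth_on_pd_commute assms(1,3) by metis
qed

text \<open>Differentiating the Leibniz expansion gives one determinant per column, with that column
  differentiated. As \<open>F x ** B = mat 1\<close>, the new column is \<open>F x\<close> applied
  to a column of \<open>B ** pd i F x\<close>, and Cramer's lemma evaluates the determinant.\<close>

lemma Jacobi_formula:
  fixes F :: "real ^ 'n \<Rightarrow> real ^ 'm ^ 'm"
  assumes "F differentiable (at x)" "F x ** B = mat 1"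
  shows "pd i (\<lambda>y. det (F y)) x = det (F x) * trace (B ** pd i F x)"
proof -
  have d: "(\<lambda>y. F y $ a $ b) differentiable (at x)" for a b
    using assms(1) unfolding differentiable_vec_iff by blast
  have dd: "((\<lambda>y. F y $ a $ b) has_derivative frechet_derivative (\<lambda>y. F y $ a $ b) (at x)) (at x)" for a b
    using d frechet_derivative_works by blast
  \<comment> \<open>Column \<open>b\<close> is differentiated, the others are kept. Expanding the
    transpose puts the factor with index \<open>b\<close> into column \<open>b\<close>, as Cramer's
    lemma wants it.\<close>
  let ?E = "\<lambda>b. \<chi> r s. if s = b then pd i F x $ r $ s else F x $ r $ s"
  have "((\<lambda>y. det (transpose (F y))) has_derivative (\<lambda>h. \<Sum>p | p permutes UNIV. of_int (sign p) *
     (\<Sum>b\<in>UNIV. frechet_derivative (\<lambda>y. F y $ p b $ b) (at x) h * (\<Prod>c\<in>UNIV - {b}. F x $ p c $ c)))) (at x)"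
    unfolding det_def transpose_nth
    by (intro has_derivative_sum has_derivative_mult_right has_derivative_prod dd)
  from pd_eqI[OF this, of i]
  have "pd i (\<lambda>y. det (F y)) x = (\<Sum>p | p permutes UNIV. of_int (sign p) *
     (\<Sum>b\<in>UNIV. pd i (\<lambda>y. F y $ p b $ b) x * (\<Prod>c\<in>UNIV - {b}. F x $ p c $ c)))"
    by (simp add: pd_def)
  also have "\<dots> = (\<Sum>b\<in>UNIV. \<Sum>p | p permutes UNIV. of_int (sign p) *
     (pd i (\<lambda>y. F y $ p b $ b) x * (\<Prod>c\<in>UNIV - {b}. F x $ p c $ c)))"
    by (simp add: sum_distrib_left) (rule sum.swap)
  also have "\<dots> = (\<Sum>b\<in>UNIV. det (transpose (?E b)))"
  proof (rule sum.cong[OF refl])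
    fix b
    have "(\<Prod>c\<in>UNIV. transpose (?E b) $ c $ p c) =
       pd i (\<lambda>y. F y $ p b $ b) x * (\<Prod>c\<in>UNIV - {b}. F x $ p c $ c)" for p
      by (simp add: prod.remove[of UNIV b] transpose_nth pd_matrix_nth[OF assms(1)])
    then show "(\<Sum>p | p permutes UNIV. of_int (sign p) *
       (pd i (\<lambda>y. F y $ p b $ b) x * (\<Prod>c\<in>UNIV - {b}. F x $ p c $ c))) = det (transpose (?E b))"
      unfolding det_def by simp
  qed
  also have "\<dots> = (\<Sum>b\<in>UNIV. (B ** pd i F x) $ b $ b * det (F x))"
  proof (rule sum.cong[OF refl])
    fix b
    have "(F x *v column b (B ** pd i F x)) $ r = pd i F x $ r $ b" for r
    proof -
      have "(F x *v column b (B ** pd i F x)) $ r = (F x ** (B ** pd i F x)) $ r $ b"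
        by (simp add: matrix_vector_mult_def column_def matrix_mult_nth)
      then show ?thesis by (simp add: matrix_mul_assoc assms(2))
    qed
    then have "?E b = (\<chi> r s. if s = b then (F x *v column b (B ** pd i F x)) $ r else F x $ r $ s)"
      by (simp add: vec_eq_iff)
    then show "det (transpose (?E b)) = (B ** pd i F x) $ b $ b * det (F x)"
      by (simp only: det_transpose cramer_lemma) (simp add: column_def)
  qed
  finally show ?thesis by (simp add: trace_def sum_distrib_left mult.commute)
qed

text \<open>Every matrix on the segment from the identity to \<open>B\<close> is positive definite,
  hence nonsingular, so the determinant keeps the sign it has at the identity.\<close>

lemma det_pos_definite_pos:
  fixes B :: "real ^ 'n ^ 'n"
  assumes "\<And>v. v \<noteq> 0 \<Longrightarrow> v \<bullet> (B *v v) > 0"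
  shows "det B > 0"
proof -
  define F where "F t = (1 - t) *\<^sub>R mat 1 + t *\<^sub>R B" for t :: real
  have nz: "det (F t) \<noteq> 0" if t: "t \<in> {0..1}" for t
  proof
    assume "det (F t) = 0"
    then obtain v where v: "v \<noteq> 0" "F t *v v = 0"
      by (metis invertible_det_nz invertible_left_inverse matrix_left_invertible_ker)
    have "v \<bullet> (F t *v v) = (1 - t) * (v \<bullet> v) + t * (v \<bullet> (B *v v))"
      by (simp add: F_def matrix_vector_mult_add_rdistrib scaleR_matrix_vector_assoc[symmetric] inner_add_right)
    moreover have "\<dots> > 0"
      using t assms[OF v(1)] v(1) by (cases "t = 1") (auto intro: add_pos_nonneg)
    ultimately show False using v(2) by simp
  qed
  have cont: "continuous_on {0..1} (\<lambda>t. det (F t))"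
    unfolding F_def det_def by (intro continuous_intros)
  show ?thesis
  proof (rule ccontr)
    assume "\<not> det B > 0"
    then have "\<exists>t\<ge>0. t \<le> 1 \<and> det (F t) = 0"
      by (intro IVT2' cont) (simp_all add: F_def)
    then show False using nz by auto
  qed
qed


section \<open>Riemannian geometry in one chart\<close>

lemma sum_antisym_eq_0:
  fixes F :: "'i \<Rightarrow> 'i \<Rightarrow> real"
  assumes "\<And>i j. F i j = - F j i"
  shows "(\<Sum>i\<in>I. \<Sum>j\<in>I. F i j) = 0"
proof -
  have "(\<Sum>i\<in>I. \<Sum>j\<in>I. F i j) = (\<Sum>i\<in>I. \<Sum>j\<in>I. F j i)" by (rule sum.swap)
  also have "\<dots> = - (\<Sum>i\<in>I. \<Sum>j\<in>I. F i j)"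
    unfolding sum_negf[symmetric] by (intro sum.cong refl assms)
  finally show ?thesis by simp
qed

text \<open>The identities of the index calculus are local, so they are proved for the components in
  one chart, with \<open>U\<close> as its coordinate image and no atlas.\<close>

locale metric_patch =
  fixes g :: "('a, 'n::finite) tfield" and c :: "('a, 'n) chart" and U :: "(real ^ 'n) set"
  assumes open_U: "open U"
    and smooth_g: "smooth_matrix U (g c)"
    and sym_g: "x \<in> U \<Longrightarrow> transpose (g c x) = g c x"
    and pos_g: "x \<in> U \<Longrightarrow> v \<noteq> 0 \<Longrightarrow> v \<bullet> (g c x *v v) > 0"
begin

abbreviation "G \<equiv> g c"
abbreviation "H \<equiv> ginv g c"

lemma det_g_pos: "x \<in> U \<Longrightarrow> det (G x) > 0"
  by (rule det_pos_definite_pos) (rule pos_g)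

lemma det_g_nz: "x \<in> U \<Longrightarrow> det (G x) \<noteq> 0"
  using det_g_pos[of x] by simp

lemma g_ginv: "x \<in> U \<Longrightarrow> G x ** H x = mat 1"
  and ginv_g: "x \<in> U \<Longrightarrow> H x ** G x = mat 1"
proof -
  assume "x \<in> U"
  then have "invertible (G x)" using det_g_pos[of x] by (simp add: invertible_det_nz)
  then show "G x ** H x = mat 1" "H x ** G x = mat 1"
    unfolding ginv_def matrix_inv_def invertible_def by (metis (mono_tags, lifting) someI_ex)+
qed

lemma sym_ginv: "x \<in> U \<Longrightarrow> transpose (H x) = H x"
proof -
  assume x: "x \<in> U"
  have "transpose (H x) = transpose (H x) ** (G x ** H x)" using g_ginv[OF x] by simp
  also have "\<dots> = transpose (G x ** H x) ** H x"
    by (simp add: matrix_transpose_mul sym_g[OF x] matrix_mul_assoc)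
  finally show ?thesis by (simp add: g_ginv[OF x])
qed

text \<open>Cramer's rule writes each entry as a quotient of determinants with smooth entries and
  nonzero denominator.\<close>

lemma smooth_ginv: "smooth_matrix U H"
  unfolding smooth_matrix_def
proof (intro allI)
  fix a b
  have H: "H y $ a $ b = det (\<chi> i j. if j = a then (axis b 1 :: real ^ 'n) $ i else G y $ i $ j) / det (G y)"
    if "y \<in> U" for y
  proof -
    have "G y *v column b (H y) = axis b 1"
    proof -
      have "(G y *v column b (H y)) $ r = (G y ** H y) $ r $ b" for r
        by (simp add: matrix_vector_mult_def column_def matrix_mult_nth)
      then show ?thesis by (simp add: g_ginv[OF that] vec_eq_iff mat_def axis_def)
    qed
    then have "column b (H y) = (\<chi> k. det (\<chi> i j. if j = k then (axis b 1 :: real ^ 'n) $ i else G y $ i $ j) / det (G y))"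
      using cramer[of "G y"] det_g_pos[OF that] by simp
    then have "column b (H y) $ a = det (\<chi> i j. if j = a then (axis b 1 :: real ^ 'n) $ i else G y $ i $ j) / det (G y)"
      by simp
    then show ?thesis by (simp add: column_def)
  qed
  have "smooth_matrix U (\<lambda>y. \<chi> i j. if j = a then (axis b 1 :: real ^ 'n) $ i else G y $ i $ j)"
    unfolding smooth_matrix_def
  proof (intro allI)
    fix r s
    show "smooth_on U (\<lambda>y. (\<chi> i j. if j = a then (axis b 1 :: real ^ 'n) $ i else G y $ i $ j) $ r $ s)"
      using smooth_g by (cases "s = a") (auto simp: smooth_matrix_def intro: smooth_on_const)
  qed
  then have "smooth_on U (\<lambda>y. det (\<chi> i j. if j = a then (axis b 1 :: real ^ 'n) $ i else G y $ i $ j) / det (G y))"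
    using det_g_nz by (intro smooth_on_divide smooth_on_det open_U smooth_g) blast
  then show "smooth_on U (\<lambda>y. H y $ a $ b)"
    using smooth_on_cong[OF open_U, of "\<lambda>y. H y $ a $ b"] H by simp
qed

lemma g_commute: "x \<in> U \<Longrightarrow> G x $ i $ j = G x $ j $ i"
  using sym_g transpose_nth by metis

lemma ginv_commute: "x \<in> U \<Longrightarrow> H x $ i $ j = H x $ j $ i"
  using sym_ginv transpose_nth by metis

lemma differentiable_g: "x \<in> U \<Longrightarrow> G differentiable (at x)"
  and differentiable_ginv: "x \<in> U \<Longrightarrow> H differentiable (at x)"
  by (rule smooth_matrix_differentiable[OF smooth_g] smooth_matrix_differentiable[OF smooth_ginv]; simp)+

lemma smooth_on_g: "smooth_on U (\<lambda>y. G y $ i $ j)"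
  and smooth_on_ginv: "smooth_on U (\<lambda>y. H y $ i $ j)"
  using smooth_g smooth_ginv unfolding smooth_matrix_def by auto

lemma pd_g_nth: "x \<in> U \<Longrightarrow> pd i G x $ a $ b = pd i (\<lambda>y. G y $ a $ b) x"
  by (rule pd_matrix_nth) (rule differentiable_g)

lemma pd_g_commute: "x \<in> U \<Longrightarrow> pd i G x $ a $ b = pd i G x $ b $ a"
  using pd_g_nth pd_cong[OF open_U, of x "\<lambda>y. G y $ a $ b" "\<lambda>y. G y $ b $ a"] g_commute by metis

text \<open>The connection matrix: covariant differentiation in direction \<open>i\<close> acts on
  the components of a vector field as the partial derivative plus \<open>Gam i\<close>.\<close>

definition Gam :: "'n \<Rightarrow> real ^ 'n \<Rightarrow> real ^ 'n ^ 'n" where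
  "Gam i x = (\<chi> l k. christoffel g c x l i k)"

lemma Gam_nth: "Gam i x $ l $ k = christoffel g c x l i k"
  by (simp add: Gam_def)

lemma Gam_eq:
  assumes "x \<in> U"
  shows "Gam i x $ k $ j = (\<Sum>l\<in>UNIV. H x $ k $ l * (pd i G x $ j $ l + pd j G x $ i $ l - pd l G x $ i $ j)) / 2"
  by (simp add: Gam_def christoffel_def pderiv_at_eq_pd pd_g_nth[OF assms])

lemma Gam_sym: "x \<in> U \<Longrightarrow> Gam i x $ l $ k = Gam k x $ l $ i"
  by (simp add: Gam_eq pd_g_commute[of x _ k i] add.commute)

lemma smooth_Gam: "smooth_matrix U (Gam i)"
  unfolding smooth_matrix_def Gam_def
  by (auto simp: christoffel_def pderiv_at_eq_pd
      intro!: smooth_on_divide smooth_on_sum smooth_on_mult smooth_on_add smooth_on_diff smooth_on_pd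
        smooth_on_g smooth_on_ginv smooth_on_const open_U)

lemma differentiable_Gam: "x \<in> U \<Longrightarrow> Gam i differentiable (at x)"
  by (rule smooth_matrix_differentiable[OF smooth_Gam])

lemma g_Gam:
  assumes "x \<in> U"
  shows "(G x ** Gam i x) $ a $ b = (pd i G x $ b $ a + pd b G x $ i $ a - pd a G x $ i $ b) / 2"
proof -
  let ?C = "\<lambda>l. pd i G x $ b $ l + pd b G x $ i $ l - pd l G x $ i $ b"
  have "(G x ** Gam i x) $ a $ b = (\<Sum>k\<in>UNIV. \<Sum>l\<in>UNIV. G x $ a $ k * H x $ k $ l * ?C l) / 2"
    by (simp add: matrix_mult_nth Gam_eq[OF assms] sum_divide_distrib sum_distrib_left mult.assoc)
  also have "\<dots> = (\<Sum>l\<in>UNIV. (G x ** H x) $ a $ l * ?C l) / 2"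
    unfolding matrix_mult_nth sum_distrib_right by (subst sum.swap) simp
  also have "\<dots> = ?C a / 2"
    by (simp add: g_ginv[OF assms] mat_def if_distrib[of "\<lambda>t. t * _"] cong: if_cong)
  finally show ?thesis .
qed

text \<open>Metric compatibility \<nabla>g = 0, solved for the partial derivative.\<close>

lemma pd_g: 
  assumes "x \<in> U" shows "pd i G x = transpose (Gam i x) ** G x + G x ** Gam i x"
proof -
  have "transpose (Gam i x) ** G x = transpose (G x ** Gam i x)"
    by (simp add: matrix_transpose_mul sym_g[OF assms])
  then show ?thesis
    by (simp add: vec_eq_iff transpose_nth g_Gam[OF assms])
       (simp add: field_simps pd_g_commute[OF assms])
qed

text \<open>The inverse metric is parallel too: differentiate \<open>H y ** G y = mat 1\<close> and
  insert \<open>pd_g\<close>.\<close>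

lemma pd_ginv:
  assumes "x \<in> U" shows "pd i H x = - (Gam i x ** H x + H x ** transpose (Gam i x))"
proof -
  have "pd i (\<lambda>y. H y ** G y) x = pd i (\<lambda>y. mat 1) x"
    by (rule pd_cong[OF open_U assms]) (rule ginv_g)
  then have "pd i H x ** G x + H x ** pd i G x = 0"
    using pd_matrix_mult[OF differentiable_ginv[OF assms] differentiable_g[OF assms]] by simp
  then have "(pd i H x ** G x + H x ** pd i G x) ** H x = 0" by (simp add: matrix_mult_linear)
  then have "pd i H x = - (H x ** pd i G x ** H x)"
    by (simp add: matrix_mult_linear matrix_mul_assoc[symmetric] g_ginv[OF assms] eq_neg_iff_add_eq_0)
  also have "H x ** pd i G x ** H x = H x ** transpose (Gam i x) ** (G x ** H x) + (H x ** G x) ** Gam i x ** H x"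
    by (simp add: pd_g[OF assms] matrix_mult_linear matrix_mul_assoc)
  finally show ?thesis by (simp add: g_ginv ginv_g assms add.commute)
qed

subsection \<open>Curvature\<close>

text \<open>The commutator of the operators "partial derivative plus \<open>Gam\<close>" in the
  directions \<open>i\<close> and \<open>j\<close>, as an endomorphism in the other two
  indices.\<close>

definition Riem :: "'n \<Rightarrow> 'n \<Rightarrow> real ^ 'n \<Rightarrow> real ^ 'n ^ 'n" where
  "Riem i j x = pd i (Gam j) x - pd j (Gam i) x + Gam i x ** Gam j x - Gam j x ** Gam i x"

lemma Riem_nth: "x \<in> U \<Longrightarrow> Riem i j x $ l $ k = riemann g c x l k i j"
  by (simp add: Riem_def riemann_def pderiv_at_eq_pd matrix_mult_nth Gam_nth sum_subtractf
      pd_matrix_nth[OF differentiable_Gam])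

lemma smooth_Riem: "smooth_matrix U (Riem i j)"
  unfolding Riem_def
  by (intro smooth_matrix_diff smooth_matrix_add smooth_matrix_mult smooth_matrix_pd smooth_Gam open_U)

lemma Riem_antisym: "Riem j i x = - Riem i j x"
  by (simp add: Riem_def)

text \<open>The curvature is a commutator of covariant derivatives and so annihilates the parallel
  tensor \<open>H\<close>. Concretely, the second partials of \<open>H\<close>, computed from
  \<open>pd_ginv\<close>, must commute.\<close>

lemma Riem_ginv_antisym:
  assumes x: "x \<in> U" shows "transpose (Riem i j x ** H x) = - (Riem i j x ** H x)"
proof -
  have dd: "pd j (pd i H) x = - (pd j (Gam i) x ** H x - Gam i x ** (Gam j x ** H x + H x ** transpose (Gam j x))
      - (Gam j x ** H x + H x ** transpose (Gam j x)) ** transpose (Gam i x) + H x ** transpose (pd j (Gam i) x))" for i j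
  proof -
    have d: "Gam i differentiable (at x)" "H differentiable (at x)" "(\<lambda>y. transpose (Gam i y)) differentiable (at x)"
      by (intro smooth_matrix_differentiable[OF _ x] smooth_matrix_transpose smooth_Gam smooth_ginv)+
    have d': "(\<lambda>y. Gam i y ** H y) differentiable (at x)" "(\<lambda>y. H y ** transpose (Gam i y)) differentiable (at x)"
      by (intro smooth_matrix_differentiable[OF _ x] smooth_matrix_transpose smooth_matrix_mult smooth_Gam smooth_ginv open_U)+
    have "pd j (pd i H) x = pd j (\<lambda>y. (- 1) *\<^sub>R (Gam i y ** H y + H y ** transpose (Gam i y))) x"
      by (rule pd_cong[OF open_U x]) (simp add: pd_ginv)
    also have "\<dots> = (- 1) *\<^sub>R pd j (\<lambda>y. Gam i y ** H y + H y ** transpose (Gam i y)) x"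
      by (rule pd_bounded_linear[OF bounded_linear_scaleR_right]) (intro differentiable_add d')
    also have "\<dots> = - (pd j (Gam i) x ** H x + Gam i x ** pd j H x + (pd j H x ** transpose (Gam i x) + H x ** transpose (pd j (Gam i) x)))"
      using d by (simp add: pd_add[OF d'] pd_matrix_mult pd_transpose)
    finally show ?thesis by (simp add: pd_ginv[OF x] matrix_mult_linear)
  qed
  have "pd j (pd i H) x = pd i (pd j H) x"
    by (rule smooth_matrix_pd_commute[OF open_U smooth_ginv x])
  then have "Riem i j x ** H x + H x ** transpose (Riem i j x) = 0"
    unfolding dd Riem_def
    by (simp add: matrix_mult_linear transpose_linear matrix_transpose_mul matrix_mul_assoc algebra_simps)
  then show ?thesis
    by (simp add: matrix_transpose_mul sym_ginv[OF x] eq_neg_iff_add_eq_0 add.commute)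
qed

text \<open>The Jacobi identity for the operators "partial derivative plus \<open>Gam\<close>".
  \<open>D\<close> carries connection terms for the endomorphism indices only; those for
  \<open>i\<close> and \<open>j\<close> would cancel in the cyclic sum, the connection being
  symmetric.\<close>

lemma second_Bianchi:
  assumes x: "x \<in> U"
  defines "D \<equiv> \<lambda>m i j. pd m (Riem i j) x + Gam m x ** Riem i j x - Riem i j x ** Gam m x"
  shows "D m i j + D i j m + D j m i = 0"
proof -
  have sm: "smooth_matrix U (pd a (Gam b))" for a b
    by (intro smooth_matrix_pd smooth_Gam open_U)
  note df = smooth_matrix_differentiable[OF _ x]
  have R: "pd m (Riem i j) x = pd m (pd i (Gam j)) x - pd m (pd j (Gam i)) x
     + (pd m (Gam i) x ** Gam j x + Gam i x ** pd m (Gam j) x)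
     - (pd m (Gam j) x ** Gam i x + Gam j x ** pd m (Gam i) x)" for m i j
  proof -
    have d: "Gam i differentiable (at x)" "Gam j differentiable (at x)" by (intro df smooth_Gam)+
    show ?thesis unfolding Riem_def[abs_def]
      by (subst pd_diff pd_add, (intro df smooth_matrix_diff smooth_matrix_add smooth_matrix_mult sm smooth_Gam open_U)+)+
         (simp add: pd_matrix_mult d)
  qed
  have c: "pd a (pd b (Gam e)) x = pd b (pd a (Gam e)) x" for a b e
    by (rule smooth_matrix_pd_commute[OF open_U smooth_Gam x])
  show ?thesis
    unfolding D_def R unfolding Riem_def
    by (simp add: matrix_mult_linear matrix_mul_assoc algebra_simps c[of i m] c[of j m] c[of j i])
qed

end


context metric_patch
begin

lemma ricci_nth: "x \<in> U \<Longrightarrow> ricci g c x $ j $ k = (\<Sum>i\<in>UNIV. Riem i j x $ i $ k)"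
  by (simp add: ricci_def Riem_nth)

lemma smooth_ricci: "smooth_matrix U (ricci g c)"
  unfolding smooth_matrix_def
proof (intro allI)
  fix a b
  have "smooth_on U (\<lambda>y. \<Sum>i\<in>UNIV. Riem i a y $ i $ b)"
    using smooth_Riem by (intro smooth_on_sum open_U) (simp add: smooth_matrix_def)
  then show "smooth_on U (\<lambda>y. ricci g c y $ a $ b)"
    using smooth_on_cong[OF open_U, of "\<lambda>y. ricci g c y $ a $ b"] ricci_nth by simp
qed

text \<open>The Ricci tensor as an endomorphism: it can be applied to vector fields, and its trace
  is the scalar curvature.\<close>

definition Ric_up :: "real ^ 'n \<Rightarrow> real ^ 'n ^ 'n" where
  "Ric_up x = H x ** ricci g c x"

lemma smooth_Ric_up: "smooth_matrix U Ric_up"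
  unfolding Ric_up_def by (intro smooth_matrix_mult smooth_ricci smooth_ginv open_U)

text \<open>Contracting \<open>l\<close> with \<open>i\<close> and \<open>k\<close> with \<open>j\<close> in the second Bianchi identity for the
  raised curvature \<open>Riem i j ** H\<close>, which is antisymmetric in both pairs of indices.\<close>

lemma contracted_Bianchi:
  assumes x: "x \<in> U" and sym: "\<And>y. y \<in> U \<Longrightarrow> transpose (ricci g c y) = ricci g c y"
  shows "(\<Sum>i\<in>UNIV. pd i (\<lambda>y. Ric_up y $ i $ m) x)
    + (\<Sum>i\<in>UNIV. \<Sum>a\<in>UNIV. Gam i x $ i $ a * Ric_up x $ a $ m)
    - (\<Sum>i\<in>UNIV. \<Sum>a\<in>UNIV. Gam i x $ a $ m * Ric_up x $ i $ a)
    = pd m (\<lambda>y. trace (Ric_up y)) x / 2"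
proof -
  \<comment> \<open>Curvature with an index raised. It is antisymmetric in \<open>i\<close>,
    \<open>j\<close> (\<open>anti1\<close>) and in its two matrix indices (\<open>anti2\<close>), so
    the four traces \<open>S1\<close> to \<open>S4\<close> are all \<open>Ric_up\<close> up to
    sign.\<close>
  define p where "p i j y = Riem i j y ** H y" for i j y
  have smp: "smooth_matrix U (p i j)" for i j
    unfolding p_def by (intro smooth_matrix_mult smooth_Riem smooth_ginv open_U)
  have dp: "p i j differentiable (at x)" for i j by (rule smooth_matrix_differentiable[OF smp x])
  have dS: "(\<lambda>y. Ric_up y $ a $ b) differentiable (at x)" for a b
    using smooth_Ric_up x smooth_on_differentiable unfolding smooth_matrix_def by blast
  have dpn: "(\<lambda>y. p i j y $ a $ b) differentiable (at x)" for i j a b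
    using smp x smooth_on_differentiable unfolding smooth_matrix_def by blast
  have anti1: "p j i y $ l $ k = - (p i j y $ l $ k)" for i j l k y
    unfolding p_def Riem_antisym[of j i] by (simp add: matrix_mult_linear)
  have anti2: "p i j y $ k $ l = - (p i j y $ l $ k)" if "y \<in> U" for i j l k y
    using arg_cong[OF Riem_ginv_antisym[OF that, of i j], of "\<lambda>M. M $ l $ k"]
    by (simp add: p_def transpose_nth)
  have S1: "(\<Sum>l\<in>UNIV. p l j y $ l $ k) = Ric_up y $ k $ j" if y: "y \<in> U" for j k y
  proof -
    have "(\<Sum>l\<in>UNIV. p l j y $ l $ k) = (\<Sum>a\<in>UNIV. (\<Sum>l\<in>UNIV. Riem l j y $ l $ a) * H y $ a $ k)"
      unfolding p_def matrix_mult_nth sum_distrib_right by (rule sum.swap)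
    also have "\<dots> = (\<Sum>a\<in>UNIV. H y $ k $ a * ricci g c y $ a $ j)"
    proof (rule sum.cong[OF refl])
      fix a
      have "ricci g c y $ j $ a = ricci g c y $ a $ j"
        using arg_cong[OF sym[OF y], of "\<lambda>M. M $ a $ j"] by (simp add: transpose_nth)
      then show "(\<Sum>l\<in>UNIV. Riem l j y $ l $ a) * H y $ a $ k = H y $ k $ a * ricci g c y $ a $ j"
        by (simp add: ricci_nth[OF y, symmetric] ginv_commute[OF y, of a k])
    qed
    finally show ?thesis by (simp add: Ric_up_def matrix_mult_nth)
  qed
  have S2: "(\<Sum>j\<in>UNIV. p i j y $ a $ j) = Ric_up y $ a $ i" if y: "y \<in> U" for i a y
  proof -
    have "p i j y $ a $ j = p j i y $ j $ a" for j
      using anti2[OF y, of i j a j] anti1[of j i y j a] by simp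
    then show ?thesis using S1[OF y, of i a] by simp
  qed
  have S3: "(\<Sum>j\<in>UNIV. p j m y $ a $ j) = - Ric_up y $ a $ m" if y: "y \<in> U" for a y
  proof -
    have "p j m y $ a $ j = - p j m y $ j $ a" for j by (rule anti2[OF y])
    then show ?thesis using S1[OF y, of m a] by (simp add: sum_negf)
  qed
  have S4: "(\<Sum>j\<in>UNIV. p m j y $ j $ a) = - Ric_up y $ a $ m" if y: "y \<in> U" for a y
  proof -
    have "p m j y $ j $ a = - p j m y $ j $ a" for j by (rule anti1)
    then show ?thesis using S1[OF y, of m a] by (simp add: sum_negf)
  qed

  \<comment> \<open>The covariant derivative of \<open>p i j\<close> in its two upper indices. As
    the inverse metric is parallel, it is the derivative from \<open>second_Bianchi\<close> times
    \<open>H x\<close>, so its cyclic sum vanishes.\<close>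
  define E where "E m i j = pd m (p i j) x + Gam m x ** p i j x + p i j x ** transpose (Gam m x)" for m i j
  have E: "E m i j = (pd m (Riem i j) x + Gam m x ** Riem i j x - Riem i j x ** Gam m x) ** H x" for m i j
  proof -
    have "pd m (p i j) x = pd m (Riem i j) x ** H x + Riem i j x ** pd m H x"
      unfolding p_def[abs_def]
      by (rule pd_matrix_mult) (rule smooth_matrix_differentiable[OF _ x], rule smooth_Riem smooth_ginv)+
    then show ?thesis
      by (simp add: E_def p_def pd_ginv[OF x] matrix_mult_linear matrix_mul_assoc)
  qed
  have cyc: "E m i j + E i j m + E j m i = 0" for i j
    using arg_cong[OF second_Bianchi[OF x, of m i j], of "\<lambda>M. M ** H x"]
    unfolding E by (simp only: matrix_mult_linear)
  have "(\<Sum>i\<in>UNIV. \<Sum>j\<in>UNIV. (E m i j + E i j m + E j m i) $ i $ j) = 0"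
    unfolding cyc by simp
  then have sum0: "(\<Sum>i\<in>UNIV. \<Sum>j\<in>UNIV. E m i j $ i $ j) + (\<Sum>i\<in>UNIV. \<Sum>j\<in>UNIV. E i j m $ i $ j)
     + (\<Sum>i\<in>UNIV. \<Sum>j\<in>UNIV. E j m i $ i $ j) = 0"
    by (simp add: sum.distrib)
  let ?Q = "\<Sum>i\<in>UNIV. \<Sum>a\<in>UNIV. Gam i x $ i $ a * Ric_up x $ a $ m"
  let ?P = "\<Sum>i\<in>UNIV. \<Sum>a\<in>UNIV. Gam i x $ a $ m * Ric_up x $ i $ a"
  let ?D = "\<Sum>i\<in>UNIV. pd i (\<lambda>y. Ric_up y $ i $ m) x"

  \<comment> \<open>This cyclic term gives the derivative of the trace plus \<open>2 * ?P\<close>;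
    the other two give \<open>- ?D - ?Q\<close> each. Hence the factor 1/2 in the result.\<close>
  have 1: "(\<Sum>i\<in>UNIV. \<Sum>j\<in>UNIV. E m i j $ i $ j) = pd m (\<lambda>y. trace (Ric_up y)) x + 2 * ?P"
  proof -
    have "(\<Sum>i\<in>UNIV. \<Sum>j\<in>UNIV. pd m (p i j) x $ i $ j) = pd m (\<lambda>y. trace (Ric_up y)) x"
    proof -
      have "pd m (\<lambda>y. trace (Ric_up y)) x = pd m (\<lambda>y. \<Sum>i\<in>UNIV. \<Sum>j\<in>UNIV. p i j y $ i $ j) x"
        unfolding trace_def by (rule pd_cong[OF open_U x]) (simp add: S2)
      then show ?thesis
        by (simp add: pd_sum dpn pd_matrix_nth[OF dp])
    qed
    moreover have "(\<Sum>i\<in>UNIV. \<Sum>j\<in>UNIV. (Gam m x ** p i j x) $ i $ j) = ?P"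
    proof -
      have "(\<Sum>i\<in>UNIV. \<Sum>j\<in>UNIV. (Gam m x ** p i j x) $ i $ j)
         = (\<Sum>i\<in>UNIV. \<Sum>a\<in>UNIV. Gam m x $ i $ a * (\<Sum>j\<in>UNIV. p i j x $ a $ j))"
        unfolding matrix_mult_nth sum_distrib_left by (intro sum.cong refl sum.swap)
      also have "\<dots> = (\<Sum>i\<in>UNIV. \<Sum>a\<in>UNIV. Gam a x $ i $ m * Ric_up x $ a $ i)"
        by (simp add: S2[OF x] Gam_sym[OF x, of m])
      also have "\<dots> = ?P" by (rule sum.swap)
      finally show ?thesis .
    qed
    moreover have "(\<Sum>i\<in>UNIV. \<Sum>j\<in>UNIV. (p i j x ** transpose (Gam m x)) $ i $ j) = ?P"
    proof -
      have "(\<Sum>i\<in>UNIV. \<Sum>j\<in>UNIV. (p i j x ** transpose (Gam m x)) $ i $ j)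
         = (\<Sum>j\<in>UNIV. \<Sum>i\<in>UNIV. \<Sum>a\<in>UNIV. p i j x $ i $ a * Gam m x $ j $ a)"
        unfolding matrix_mult_nth transpose_nth by (rule sum.swap)
      also have "\<dots> = (\<Sum>j\<in>UNIV. \<Sum>a\<in>UNIV. (\<Sum>i\<in>UNIV. p i j x $ i $ a) * Gam m x $ j $ a)"
        unfolding sum_distrib_right by (intro sum.cong refl sum.swap)
      also have "\<dots> = (\<Sum>j\<in>UNIV. \<Sum>a\<in>UNIV. Gam a x $ j $ m * Ric_up x $ a $ j)"
        by (simp add: S1[OF x] Gam_sym[OF x, of m] mult.commute)
      also have "\<dots> = ?P" by (rule sum.swap)
      finally show ?thesis .
    qed
    ultimately show ?thesis by (simp add: E_def sum.distrib)
  qed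
  have 2: "(\<Sum>i\<in>UNIV. \<Sum>j\<in>UNIV. E i j m $ i $ j) = - ?D - ?Q"
  proof -
    have "(\<Sum>i\<in>UNIV. \<Sum>j\<in>UNIV. pd i (p j m) x $ i $ j) = - ?D"
    proof -
      have "(\<Sum>j\<in>UNIV. pd i (p j m) x $ i $ j) = - pd i (\<lambda>y. Ric_up y $ i $ m) x" for i
      proof -
        have "(\<Sum>j\<in>UNIV. pd i (p j m) x $ i $ j) = pd i (\<lambda>y. \<Sum>j\<in>UNIV. p j m y $ i $ j) x"
          by (simp add: pd_sum dpn pd_matrix_nth[OF dp])
        also have "\<dots> = pd i (\<lambda>y. (-1) * Ric_up y $ i $ m) x"
          by (rule pd_cong[OF open_U x]) (simp add: S3)
        finally show ?thesis by (simp only: pd_cmult[OF dS])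
      qed
      then show ?thesis by (simp add: sum_negf)
    qed
    moreover have "(\<Sum>i\<in>UNIV. \<Sum>j\<in>UNIV. (Gam i x ** p j m x) $ i $ j) = - ?Q"
    proof -
      have "(\<Sum>i\<in>UNIV. \<Sum>j\<in>UNIV. (Gam i x ** p j m x) $ i $ j)
         = (\<Sum>i\<in>UNIV. \<Sum>a\<in>UNIV. Gam i x $ i $ a * (\<Sum>j\<in>UNIV. p j m x $ a $ j))"
        unfolding matrix_mult_nth sum_distrib_left by (intro sum.cong refl sum.swap)
      then show ?thesis by (simp add: S3[OF x] sum_negf)
    qed
    \<comment> \<open>The Christoffel symbol is symmetric in a pair of indices in which
      \<open>p\<close> is antisymmetric. The last sum of the third cyclic term vanishes for the same
      reason.\<close>
    moreover have "(\<Sum>i\<in>UNIV. \<Sum>j\<in>UNIV. (p j m x ** transpose (Gam i x)) $ i $ j) = 0"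
    proof -
      have "(\<Sum>i\<in>UNIV. \<Sum>j\<in>UNIV. (p j m x ** transpose (Gam i x)) $ i $ j)
         = (\<Sum>j\<in>UNIV. \<Sum>i\<in>UNIV. \<Sum>a\<in>UNIV. p j m x $ i $ a * Gam i x $ j $ a)"
        unfolding matrix_mult_nth transpose_nth by (rule sum.swap)
      also have "\<dots> = 0"
      proof (rule sum.neutral, rule ballI, rule sum_antisym_eq_0)
        fix j i a
        show "p j m x $ i $ a * Gam i x $ j $ a = - (p j m x $ a $ i * Gam a x $ j $ i)"
          by (simp add: Gam_sym[OF x, of i j a] anti2[OF x, of j m i a])
      qed
      finally show ?thesis .
    qed
    ultimately show ?thesis by (simp add: E_def sum.distrib)
  qed
  have 3: "(\<Sum>i\<in>UNIV. \<Sum>j\<in>UNIV. E j m i $ i $ j) = - ?D - ?Q"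
  proof -
    have "(\<Sum>i\<in>UNIV. \<Sum>j\<in>UNIV. pd j (p m i) x $ i $ j) = - ?D"
    proof -
      have "(\<Sum>i\<in>UNIV. pd j (p m i) x $ i $ j) = - pd j (\<lambda>y. Ric_up y $ j $ m) x" for j
      proof -
        have "(\<Sum>i\<in>UNIV. pd j (p m i) x $ i $ j) = pd j (\<lambda>y. \<Sum>i\<in>UNIV. p m i y $ i $ j) x"
          by (simp add: pd_sum dpn pd_matrix_nth[OF dp])
        also have "\<dots> = pd j (\<lambda>y. (-1) * Ric_up y $ j $ m) x"
          by (rule pd_cong[OF open_U x]) (simp add: S4)
        finally show ?thesis by (simp only: pd_cmult[OF dS])
      qed
      then show ?thesis by (subst sum.swap) (simp add: sum_negf)
    qed
    moreover have "(\<Sum>i\<in>UNIV. \<Sum>j\<in>UNIV. (p m i x ** transpose (Gam j x)) $ i $ j) = - ?Q"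
    proof -
      have "(\<Sum>i\<in>UNIV. \<Sum>j\<in>UNIV. (p m i x ** transpose (Gam j x)) $ i $ j)
         = (\<Sum>j\<in>UNIV. \<Sum>i\<in>UNIV. \<Sum>a\<in>UNIV. p m i x $ i $ a * Gam j x $ j $ a)"
        unfolding matrix_mult_nth transpose_nth by (rule sum.swap)
      also have "\<dots> = (\<Sum>j\<in>UNIV. \<Sum>a\<in>UNIV. (\<Sum>i\<in>UNIV. p m i x $ i $ a) * Gam j x $ j $ a)"
        unfolding sum_distrib_right by (intro sum.cong refl sum.swap)
      finally show ?thesis by (simp add: S4[OF x] sum_negf mult.commute)
    qed
    moreover have "(\<Sum>i\<in>UNIV. \<Sum>j\<in>UNIV. (Gam j x ** p m i x) $ i $ j) = 0"
      unfolding matrix_mult_nth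
    proof (rule sum.neutral, rule ballI, rule sum_antisym_eq_0)
      fix i j a
      show "Gam j x $ i $ a * p m i x $ a $ j = - (Gam a x $ i $ j * p m i x $ j $ a)"
        by (simp add: Gam_sym[OF x, of j i a] anti2[OF x, of m i a j])
    qed
    ultimately show ?thesis by (simp add: E_def sum.distrib)
  qed
  show ?thesis using sum0 unfolding 1 2 3 by simp
qed

subsection \<open>Covariant derivatives of vector fields\<close>

text \<open>Columns are directions: entry \<open>b\<close>, \<open>i\<close> is the component
  \<open>b\<close> of the covariant derivative in direction \<open>i\<close>. The trace of this
  matrix is the divergence.\<close>

definition nab :: "(real ^ 'n \<Rightarrow> real ^ 'n) \<Rightarrow> real ^ 'n \<Rightarrow> real ^ 'n ^ 'n" where
  "nab V x = (\<chi> b i. pd i (\<lambda>y. V y $ b) x + (\<Sum>a\<in>UNIV. Gam i x $ b $ a * V x $ a))"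

lemma divergence_eq_trace_nab:
  "(\<Sum>i\<in>UNIV. pderiv_at i (\<lambda>y. V y $ i) x + (\<Sum>k\<in>UNIV. christoffel g c x i i k * V x $ k))
   = trace (nab V x)"
  by (simp add: trace_def nab_def pderiv_at_eq_pd Gam_nth)

text \<open>Leibniz rule div (S V) = (div S) V + tr (S \<nabla>V). The connection term subtracted in
  the bracket cancels the one that \<open>nab V\<close> brings in. For \<open>S = Ric_up\<close> the
  bracket is the left side of \<open>contracted_Bianchi\<close>.\<close>

lemma trace_nab_matrix_vector_mult:
  assumes x: "x \<in> U" and S: "smooth_matrix U S" and V: "\<And>b. smooth_on U (\<lambda>y. V y $ b)"
  shows "trace (nab (\<lambda>y. S y *v V y) x)
    = (\<Sum>b\<in>UNIV. ((\<Sum>i\<in>UNIV. pd i (\<lambda>y. S y $ i $ b) x)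
        + (\<Sum>i\<in>UNIV. \<Sum>a\<in>UNIV. Gam i x $ i $ a * S x $ a $ b)
        - (\<Sum>i\<in>UNIV. \<Sum>a\<in>UNIV. Gam i x $ a $ b * S x $ i $ a)) * V x $ b)
      + trace (S x ** nab V x)"
proof -
  have dS: "(\<lambda>y. S y $ a $ b) differentiable (at x)" for a b
    using S x smooth_on_differentiable unfolding smooth_matrix_def by blast
  have dV: "(\<lambda>y. V y $ b) differentiable (at x)" for b
    using V x smooth_on_differentiable by blast
  have "trace (nab (\<lambda>y. S y *v V y) x) = (\<Sum>i\<in>UNIV. \<Sum>b\<in>UNIV. pd i (\<lambda>y. S y $ i $ b) x * V x $ b)
     + (\<Sum>i\<in>UNIV. \<Sum>b\<in>UNIV. S x $ i $ b * pd i (\<lambda>y. V y $ b) x)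
     + (\<Sum>i\<in>UNIV. \<Sum>a\<in>UNIV. \<Sum>b\<in>UNIV. Gam i x $ i $ a * S x $ a $ b * V x $ b)"
    by (simp add: trace_def nab_def matrix_vector_mult_def pd_sum pd_mult dS dV sum.distrib
        sum_distrib_left mult.assoc)
  moreover have "trace (S x ** nab V x) = (\<Sum>i\<in>UNIV. \<Sum>b\<in>UNIV. S x $ i $ b * pd i (\<lambda>y. V y $ b) x)
     + (\<Sum>i\<in>UNIV. \<Sum>b\<in>UNIV. \<Sum>a\<in>UNIV. S x $ i $ b * (Gam i x $ b $ a * V x $ a))"
    by (simp add: trace_def nab_def matrix_mult_nth sum.distrib sum_distrib_left distrib_left)
  moreover have "(\<Sum>b\<in>UNIV. (\<Sum>i\<in>UNIV. pd i (\<lambda>y. S y $ i $ b) x) * V x $ b)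
     = (\<Sum>i\<in>UNIV. \<Sum>b\<in>UNIV. pd i (\<lambda>y. S y $ i $ b) x * V x $ b)"
    unfolding sum_distrib_right by (rule sum.swap)
  moreover have "(\<Sum>b\<in>UNIV. (\<Sum>i\<in>UNIV. \<Sum>a\<in>UNIV. Gam i x $ i $ a * S x $ a $ b) * V x $ b)
     = (\<Sum>i\<in>UNIV. \<Sum>a\<in>UNIV. \<Sum>b\<in>UNIV. Gam i x $ i $ a * S x $ a $ b * V x $ b)"
    unfolding sum_distrib_right by (subst sum.swap) (intro sum.cong refl sum.swap)
  moreover have "(\<Sum>b\<in>UNIV. (\<Sum>i\<in>UNIV. \<Sum>a\<in>UNIV. Gam i x $ a $ b * S x $ i $ a) * V x $ b)
     = (\<Sum>i\<in>UNIV. \<Sum>b\<in>UNIV. \<Sum>a\<in>UNIV. S x $ i $ b * (Gam i x $ b $ a * V x $ a))"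
    unfolding sum_distrib_right
    by (rule trans[OF sum.swap], rule sum.cong[OF refl], rule trans[OF sum.swap]) (simp add: mult_ac)
  ultimately show ?thesis
    by (simp add: distrib_right left_diff_distrib sum.distrib sum_subtractf)
qed

text \<open>By \<nabla>g = 0 the derivatives of the metric split into two Christoffel terms, which
  complete the partial derivatives of \<open>X\<close> to covariant ones.\<close>

lemma lie_metric_eq:
  assumes x: "x \<in> U"
  shows "lie_metric X g c x = G x ** nab (X c) x + transpose (G x ** nab (X c) x)"
proof -
  let ?V = "X c"
  have GN: "(G x ** nab ?V x) $ i $ j = (\<Sum>k\<in>UNIV. G x $ i $ k * pd j (\<lambda>y. ?V y $ k) x)
     + (\<Sum>k\<in>UNIV. ?V x $ k * (G x ** Gam k x) $ i $ j)" for i j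
  proof -
    have "(G x ** nab ?V x) $ i $ j = (\<Sum>k\<in>UNIV. G x $ i $ k * pd j (\<lambda>y. ?V y $ k) x)
      + (\<Sum>l\<in>UNIV. \<Sum>a\<in>UNIV. G x $ i $ l * (Gam j x $ l $ a * ?V x $ a))"
      by (simp add: matrix_mult_nth nab_def distrib_left sum.distrib sum_distrib_left)
    also have "(\<Sum>l\<in>UNIV. \<Sum>a\<in>UNIV. G x $ i $ l * (Gam j x $ l $ a * ?V x $ a))
      = (\<Sum>k\<in>UNIV. ?V x $ k * (G x ** Gam k x) $ i $ j)"
      unfolding matrix_mult_nth sum_distrib_left
      by (subst sum.swap) (simp add: Gam_sym[OF x, of j] mult_ac)
    finally show ?thesis .
  qed
  have "pd k G x $ i $ j = (G x ** Gam k x) $ j $ i + (G x ** Gam k x) $ i $ j" for k i j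
  proof -
    have "transpose (Gam k x) ** G x = transpose (G x ** Gam k x)"
      by (simp add: matrix_transpose_mul sym_g[OF x])
    then show ?thesis by (simp add: pd_g[OF x] transpose_nth)
  qed
  then have pk: "pd k (\<lambda>y. G y $ i $ j) x = (G x ** Gam k x) $ j $ i + (G x ** Gam k x) $ i $ j" for k i j
    using pd_g_nth[OF x] by simp
  show ?thesis
    unfolding vec_eq_iff vector_add_component transpose_nth GN
    by (auto simp: lie_metric_def pderiv_at_eq_pd sum.distrib pk distrib_left g_commute[OF x, of _ j for j] )
qed

end


section \<open>Gradient, Hessian, inner products and volume density in one chart\<close>

context metric_patch
begin

lemma trace_nab_scaleR:
  assumes "u differentiable (at x)" "\<And>b. (\<lambda>y. V y $ b) differentiable (at x)"
  shows "trace (nab (\<lambda>y. u y *\<^sub>R V y) x) = (\<Sum>b\<in>UNIV. V x $ b * pd b u x) + u x * trace (nab V x)"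
  using assms
  by (simp add: trace_def nab_def pd_mult sum.distrib sum_distrib_left algebra_simps)

lemma nab_add:
  assumes "\<And>b. (\<lambda>y. V y $ b) differentiable (at x)" "\<And>b. (\<lambda>y. W y $ b) differentiable (at x)"
  shows "nab (\<lambda>y. V y + W y) x = nab V x + nab W x"
  using assms by (simp add: nab_def vec_eq_iff pd_add sum.distrib algebra_simps)

lemma gradient_eq: "gradient g f c x = H x *v (\<chi> j. pd j (f \<circ> point_of c) x)"
  by (simp add: gradient_def matrix_vector_mult_def pderiv_at_eq_pd)

lemma smooth_gradient:
  assumes "smooth_on U (f \<circ> point_of c)" shows "smooth_on U (\<lambda>y. gradient g f c y $ i)"
  unfolding gradient_def
  by (simp add: pderiv_at_eq_pd) (intro smooth_on_sum smooth_on_mult smooth_on_ginv smooth_on_pd open_U assms)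

lemma smooth_hessian:
  assumes "smooth_on U (f \<circ> point_of c)" shows "smooth_matrix U (hessian g f c)"
proof -
  have "smooth_on U (\<lambda>y. christoffel g c y k i j)" for i j k
    using smooth_Gam[of i] unfolding smooth_matrix_def Gam_def by simp
  then show ?thesis
    unfolding hessian_def smooth_matrix_def pderiv_at_eq_pd vec_lambda_beta
    by (intro allI smooth_on_diff smooth_on_sum smooth_on_mult smooth_on_pd open_U assms)
qed

lemma transpose_hessian:
  assumes "smooth_on U (f \<circ> point_of c)" "x \<in> U"
  shows "transpose (hessian g f c x) = hessian g f c x"
proof -
  have "christoffel g c x k i j = christoffel g c x k j i" for k i j
    using Gam_sym[OF assms(2), of i k j] by (simp add: Gam_def)
  then show ?thesis
    using smooth_on_pd_commute[OF open_U assms]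
    by (simp add: vec_eq_iff transpose_nth hessian_def pderiv_at_eq_pd)
qed

text \<open>Raising an index commutes with covariant differentiation. Of the two terms in
  \<open>pd_ginv\<close> one cancels the connection term of \<open>nab\<close>; the other completes
  the second partials to the Hessian.\<close>

lemma nab_gradient:
  assumes f: "smooth_on U (f \<circ> point_of c)" and x: "x \<in> U"
  shows "nab (gradient g f c) x = H x ** hessian g f c x"
proof -
  let ?u = "f \<circ> point_of c"
  have du: "pd j ?u differentiable (at x)" for j
    by (rule smooth_on_differentiable[OF smooth_on_pd[OF f] x])
  have dH: "(\<lambda>y. H y $ a $ b) differentiable (at x)" for a b
    by (rule smooth_on_differentiable[OF smooth_on_ginv x])
  have pdH: "pd i (\<lambda>y. H y $ b $ j) x
     = - (\<Sum>a\<in>UNIV. Gam i x $ b $ a * H x $ a $ j) - (\<Sum>k\<in>UNIV. H x $ b $ k * Gam i x $ j $ k)" for i b j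
    using arg_cong[OF pd_ginv[OF x, of i], of "\<lambda>M. M $ b $ j"]
      pd_matrix_nth[OF differentiable_ginv[OF x]] by (simp add: matrix_mult_nth transpose_nth)
  have "nab (gradient g f c) x $ b $ i = (H x ** hessian g f c x) $ b $ i" for b i
  proof -
    have 1: "pd i (\<lambda>y. gradient g f c y $ b) x
      = (\<Sum>j\<in>UNIV. pd i (\<lambda>y. H y $ b $ j) x * pd j ?u x) + (\<Sum>j\<in>UNIV. H x $ b $ j * pd i (pd j ?u) x)"
      unfolding gradient_def by (simp add: pderiv_at_eq_pd pd_sum pd_mult du dH sum.distrib)
    have 2: "(\<Sum>j\<in>UNIV. pd i (\<lambda>y. H y $ b $ j) x * pd j ?u x)
       = - (\<Sum>j\<in>UNIV. \<Sum>a\<in>UNIV. Gam i x $ b $ a * H x $ a $ j * pd j ?u x)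
         - (\<Sum>j\<in>UNIV. \<Sum>k\<in>UNIV. H x $ b $ k * Gam i x $ j $ k * pd j ?u x)"
      unfolding pdH by (simp add: left_diff_distrib sum_subtractf sum_negf sum_distrib_right)
    have 3: "(\<Sum>a\<in>UNIV. Gam i x $ b $ a * gradient g f c x $ a)
       = (\<Sum>j\<in>UNIV. \<Sum>a\<in>UNIV. Gam i x $ b $ a * H x $ a $ j * pd j ?u x)"
      unfolding gradient_def by (simp add: pderiv_at_eq_pd sum_distrib_left mult.assoc) (rule sum.swap)
    have 4: "(\<Sum>k\<in>UNIV. \<Sum>j\<in>UNIV. H x $ b $ k * (Gam i x $ j $ k * pd j ?u x))
       = (\<Sum>j\<in>UNIV. \<Sum>k\<in>UNIV. H x $ b $ k * Gam i x $ j $ k * pd j ?u x)"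
      by (subst sum.swap) (simp add: mult.assoc)
    have 5: "hessian g f c x $ k $ i = pd i (pd k ?u) x - (\<Sum>j\<in>UNIV. Gam i x $ j $ k * pd j ?u x)" for k
      using smooth_on_pd_commute[OF open_U f x, of k i] Gam_sym[OF x, of i]
      by (simp add: hessian_def pderiv_at_eq_pd Gam_nth)
    have 6: "(H x ** hessian g f c x) $ b $ i = (\<Sum>k\<in>UNIV. H x $ b $ k * pd i (pd k ?u) x)
       - (\<Sum>k\<in>UNIV. \<Sum>j\<in>UNIV. H x $ b $ k * (Gam i x $ j $ k * pd j ?u x))"
      by (simp add: matrix_mult_nth 5 right_diff_distrib sum_subtractf sum_distrib_left)
    show ?thesis unfolding 6 4 by (simp add: nab_def 1 2 3)
  qed
  then show ?thesis by (simp add: vec_eq_iff)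
qed

lemma lie_metric_gradient:
  assumes f: "smooth_on U (f \<circ> point_of c)" and x: "x \<in> U"
  shows "lie_metric (gradient g f) g c x = 2 *\<^sub>R hessian g f c x"
  unfolding lie_metric_eq[OF x] nab_gradient[OF f x]
  by (simp add: matrix_mul_assoc g_ginv[OF x] transpose_hessian[OF f x] scaleR_2)

lemma transpose_lie_metric: "x \<in> U \<Longrightarrow> transpose (lie_metric X g c x) = lie_metric X g c x"
  by (simp add: lie_metric_eq transpose_linear add.commute)

lemma smooth_lie_metric:
  assumes "\<And>i. smooth_on U (\<lambda>y. X c y $ i)"
  shows "smooth_matrix U (lie_metric X g c)"
  unfolding lie_metric_def smooth_matrix_def pderiv_at_eq_pd
  by (simp, intro allI smooth_on_sum smooth_on_add smooth_on_mult smooth_on_pd smooth_on_g open_U assms)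

lemma tensor_trace_eq:
  assumes "x \<in> U" shows "tensor_trace g c x T = trace (H x ** T)"
  unfolding tensor_trace_def trace_def matrix_mult_nth
  by (subst sum.swap) (simp add: ginv_commute[OF assms, of _ j for j])

lemma tensor_inner_eq:
  assumes "x \<in> U" shows "tensor_inner g c x S T = trace (S ** H x ** transpose T ** H x)"
proof -
  have "tensor_inner g c x S T
    = (\<Sum>i\<in>UNIV. \<Sum>k\<in>UNIV. \<Sum>l\<in>UNIV. \<Sum>j\<in>UNIV. S $ i $ j * H x $ j $ l * T $ k $ l * H x $ k $ i)"
    unfolding tensor_inner_def
    by (rule sum.cong[OF refl], rule trans[OF sum.swap], rule sum.cong[OF refl], rule trans[OF sum.swap])
       (simp add: ginv_commute[OF assms] mult_ac)
  then show ?thesis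
    by (simp add: trace_def matrix_mult_nth transpose_nth sum_distrib_right)
qed

lemma tensor_trace_lie_metric:
  assumes x: "x \<in> U" shows "tensor_trace g c x (lie_metric X g c x) = 2 * trace (nab (X c) x)"
proof -
  have "trace (H x ** transpose (G x ** nab (X c) x)) = trace (transpose (H x ** transpose (G x ** nab (X c) x)))"
    by (simp add: trace_def transpose_nth)
  also have "\<dots> = trace (nab (X c) x)"
    by (simp add: matrix_transpose_mul sym_ginv[OF x] trace_mul_sym[of "_ ** _" "H x"] matrix_mul_assoc ginv_g[OF x])
  finally show ?thesis
    by (simp add: tensor_trace_eq[OF x] lie_metric_eq[OF x] matrix_mult_linear trace_add matrix_mul_assoc ginv_g[OF x])
qed

text \<open>A symmetric \<open>T\<close> pairs equally with the two transposed halves of the Lie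
  derivative.\<close>

lemma tensor_inner_lie_metric:
  assumes x: "x \<in> U" and T: "transpose T = T"
  shows "tensor_inner g c x T (lie_metric X g c x) = 2 * trace (H x ** T ** nab (X c) x)"
proof -
  let ?N = "nab (X c) x"
  have 1: "trace (T ** H x ** transpose ?N) = trace (H x ** T ** ?N)"
  proof -
    have "trace (T ** H x ** transpose ?N) = trace (transpose (T ** H x ** transpose ?N))"
      by (simp add: trace_def transpose_nth)
    also have "\<dots> = trace (?N ** (H x ** T))"
      by (simp add: matrix_transpose_mul sym_ginv[OF x] T matrix_mul_assoc)
    also have "\<dots> = trace ((H x ** T) ** ?N)" by (rule trace_mul_sym)
    finally show ?thesis .
  qed
  have 2: "trace (T ** ?N ** H x) = trace (H x ** T ** ?N)"
    by (subst trace_mul_sym) (simp add: matrix_mul_assoc)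
  have "T ** H x ** lie_metric X g c x ** H x = T ** ((H x ** G x) ** ?N) ** H x + T ** H x ** transpose ?N ** (G x ** H x)"
    by (simp add: lie_metric_eq[OF x] matrix_mult_linear matrix_transpose_mul sym_g[OF x] matrix_mul_assoc)
  then have "T ** H x ** lie_metric X g c x ** H x = T ** ?N ** H x + T ** H x ** transpose ?N"
    by (simp add: ginv_g[OF x] g_ginv[OF x])
  then show ?thesis
    unfolding tensor_inner_eq[OF x] transpose_lie_metric[OF x] by (simp add: trace_add 1 2)
qed

lemma tensor_inner_g:
  assumes x: "x \<in> U" shows "tensor_inner g c x S (G x) = tensor_trace g c x S"
  by (simp add: tensor_inner_eq[OF x] tensor_trace_eq[OF x] sym_g[OF x] matrix_mul_assoc[symmetric] g_ginv[OF x])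
     (simp add: matrix_mul_assoc trace_mul_sym[of S])

lemma tensor_trace_g: "x \<in> U \<Longrightarrow> tensor_trace g c x (G x) = real CARD('n)"
  by (simp add: tensor_trace_eq ginv_g trace_I)

lemma vec_inner_gradient:
  assumes x: "x \<in> U"
  shows "vec_inner g c x (gradient g r c x) v = (\<Sum>j\<in>UNIV. v $ j * pd j (r \<circ> point_of c) x)"
proof -
  have "vec_inner g c x w v = (\<Sum>j\<in>UNIV. v $ j * (G x *v w) $ j)" for w
    unfolding vec_inner_def matrix_vector_mult_def
    by (subst sum.swap) (simp add: sum_distrib_left g_commute[OF x, of _ j for j] mult_ac)
  then show ?thesis
    by (simp add: gradient_eq matrix_vector_mul_assoc g_ginv[OF x])
qed

lemma divergence_Ric_up:
  assumes x: "x \<in> U" and sym: "\<And>y. y \<in> U \<Longrightarrow> transpose (ricci g c y) = ricci g c y"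
    and X: "\<And>b. smooth_on U (\<lambda>y. X c y $ b)"
  shows "trace (nab (\<lambda>y. Ric_up y *v X c y) x)
    = (\<Sum>b\<in>UNIV. X c x $ b * pd b (\<lambda>y. trace (Ric_up y)) x) / 2
      + tensor_inner g c x (ricci g c x) (lie_metric X g c x) / 2"
proof -
  note cB = contracted_Bianchi[OF x]
  show ?thesis
    unfolding trace_nab_matrix_vector_mult[of x Ric_up, OF x smooth_Ric_up X] tensor_inner_lie_metric[OF x sym[OF x]]
    by (subst cB) (simp_all add: sym Ric_up_def[of x] sum_divide_distrib mult.commute)
qed

text \<open>By Jacobi's formula the logarithmic derivative of \<open>det (G y)\<close> is the trace
  of \<open>H ** pd k G\<close>, and metric compatibility makes this twice the trace of
  \<open>Gam k\<close>; the square root removes the 2.\<close>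

lemma pd_sqrt_det:
  assumes x: "x \<in> U"
  shows "(\<lambda>y. sqrt (det (G y))) differentiable (at x)"
    and "pd k (\<lambda>y. sqrt (det (G y))) x = sqrt (det (G x)) * (\<Sum>i\<in>UNIV. Gam i x $ i $ k)"
proof -
  have d: "((\<lambda>y. det (G y)) has_derivative frechet_derivative (\<lambda>y. det (G y)) (at x)) (at x)"
    using smooth_on_differentiable[OF smooth_on_det[OF open_U smooth_g] x] frechet_derivative_works by blast
  have s: "((\<lambda>y. sqrt (det (G y))) has_derivative
      (\<lambda>h. frechet_derivative (\<lambda>y. det (G y)) (at x) h * (inverse (sqrt (det (G x))) / 2))) (at x)"
    using has_derivative_compose[OF d DERIV_real_sqrt[OF det_g_pos[OF x], unfolded has_field_derivative_def]]
    by (simp add: mult.commute)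
  then show "(\<lambda>y. sqrt (det (G y))) differentiable (at x)" unfolding differentiable_def by blast
  have "trace (H x ** pd k G x) = 2 * trace (Gam k x)"
  proof -
    have "trace (H x ** transpose (Gam k x) ** G x) = trace (transpose (Gam k x))"
      by (subst trace_mul_sym) (simp add: matrix_mul_assoc g_ginv[OF x])
    also have "\<dots> = trace (Gam k x)" by (simp add: trace_def transpose_nth)
    finally show ?thesis
      by (simp add: pd_g[OF x] matrix_mult_linear trace_add matrix_mul_assoc ginv_g[OF x])
  qed
  then have "pd k (\<lambda>y. det (G y)) x = det (G x) * (2 * trace (Gam k x))"
    using Jacobi_formula[OF differentiable_g[OF x] g_ginv[OF x]] by simp
  moreover have "trace (Gam k x) = (\<Sum>i\<in>UNIV. Gam i x $ i $ k)"
    unfolding trace_def by (intro sum.cong refl Gam_sym[OF x])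
  moreover have "det (G x) * inverse (sqrt (det (G x))) = sqrt (det (G x))"
    using det_g_pos[OF x] by (simp add: field_simps)
  ultimately show "pd k (\<lambda>y. sqrt (det (G y))) x = sqrt (det (G x)) * (\<Sum>i\<in>UNIV. Gam i x $ i $ k)"
    unfolding pd_eqI[OF s] by (simp add: pd_def)
qed

lemma Ck_on_sqrt_det: "Ck_on 1 U (\<lambda>y. sqrt (det (G y)))"
proof -
  have "continuous_on U (\<lambda>y. sqrt (det (G y)))"
    by (intro continuous_on_real_sqrt smooth_on_continuous smooth_on_det open_U smooth_g)
  moreover have "continuous_on U (\<lambda>y. Gam i y $ i $ k)" for i k
    using smooth_Gam smooth_on_continuous unfolding smooth_matrix_def by blast
  ultimately have "continuous_on U (\<lambda>y. sqrt (det (G y)) * (\<Sum>i\<in>UNIV. Gam i y $ i $ k))" for k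
    by (intro continuous_on_mult continuous_on_sum)
  then have "continuous_on U (pd k (\<lambda>y. sqrt (det (G y))))" for k
    using pd_sqrt_det(2) by (simp cong: continuous_on_cong)
  then show ?thesis using pd_sqrt_det(1) by (simp add: Ck_on_Suc_pd)
qed

text \<open>Weighted with the volume density, the covariant divergence becomes a sum of plain
  partial derivatives, which Lebesgue integration can handle.\<close>

lemma divergence_weighted:
  assumes x: "x \<in> U" and V: "\<And>b. (\<lambda>y. V y $ b) differentiable (at x)"
  shows "(\<Sum>i\<in>UNIV. pd i (\<lambda>y. sqrt (det (G y)) * V y $ i) x) = sqrt (det (G x)) * trace (nab V x)"
proof -
  have "(\<Sum>i\<in>UNIV. (\<Sum>a\<in>UNIV. Gam a x $ a $ i) * V x $ i) = (\<Sum>i\<in>UNIV. \<Sum>a\<in>UNIV. Gam i x $ i $ a * V x $ a)"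
    unfolding sum_distrib_right by (rule sum.swap)
  then show ?thesis
    by (simp add: pd_mult pd_sqrt_det[OF x] V sum.distrib trace_def nab_def distrib_left mult.assoc
        sum_distrib_left[symmetric])
qed

end


section \<open>Positivity of the inner product of tensors\<close>

text \<open>Take a \<open>B\<close>-orthonormal set of greatest size; orthonormal sets are
  independent, so sizes are bounded by the dimension. If some \<open>v\<close> differed from its
  expansion, the normalised remainder would enlarge the set.\<close>

lemma pos_definite_orthonormal_expansion:
  fixes B :: "real ^ 'n ^ 'n"
  assumes sym: "transpose B = B" and pos: "\<And>v. v \<noteq> 0 \<Longrightarrow> v \<bullet> (B *v v) > 0"
  shows "\<exists>E. finite E \<and> (\<forall>v. v = (\<Sum>e\<in>E. (e \<bullet> (B *v v)) *\<^sub>R e))"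
proof -
  define b where "b v w = v \<bullet> (B *v w)" for v w
  have bl: "b (v + v') w = b v w + b v' w" "b w (v + v') = b w v + b w v'"
    "b (r *\<^sub>R v) w = r * b v w" "b w (r *\<^sub>R v) = r * b w v"
    "b (v - v') w = b v w - b v' w" "b w (v - v') = b w v - b w v'" "b 0 w = 0" "b w 0 = 0" for v v' w r
    by (simp_all add: b_def inner_add_left inner_add_right matrix_vector_right_distrib inner_diff_left
        inner_diff_right matrix_vector_mult_diff_distrib matrix_vector_mult_scaleR)
  have bs: "b w (\<Sum>e\<in>E. f e) = (\<Sum>e\<in>E. b w (f e))" for w E and f :: "real ^ 'n \<Rightarrow> real ^ 'n"
    by (induction E rule: infinite_finite_induct) (simp_all add: bl)
  have bc: "b v w = b w v" for v w
  proof -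
    have "v v* B = B *v v" using transpose_matrix_vector[of B v] unfolding sym by (rule HOL.sym)
    then show ?thesis using dot_lmul_matrix[of v B w] by (simp add: b_def inner_commute)
  qed
  define P where "P E \<longleftrightarrow> finite E \<and> (\<forall>e\<in>E. \<forall>e'\<in>E. b e e' = (if e = e' then 1 else 0))" for E
  have card: "card E \<le> CARD('n)" if E: "P E" for E
  proof -
    have "independent E"
    proof
      assume "dependent E"
      then obtain r where r: "\<exists>v\<in>E. r v \<noteq> 0" "(\<Sum>v\<in>E. r v *\<^sub>R v) = 0"
        using dependent_finite[of E] E unfolding P_def by auto
      then obtain e where e: "e \<in> E" "r e \<noteq> 0" by blast
      have "b e (\<Sum>v\<in>E. r v *\<^sub>R v) = (\<Sum>v\<in>E. r v * (if e = v then 1 else 0))"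
        unfolding bs bl using E e(1) by (intro sum.cong refl) (auto simp: P_def)
      also have "\<dots> = r e" using E e(1) by (simp add: P_def if_distrib cong: if_cong)
      finally show False using r(2) e(2) bl(8) by simp
    qed
    then show ?thesis using independent_card_le_dim[of E UNIV] by simp
  qed
  have "P {}" by (simp add: P_def)
  then obtain E where E: "P E" and max: "\<And>E'. P E' \<Longrightarrow> card E' \<le> card E"
    using ex_has_greatest_nat[of P "{}" card "CARD('n) + 1"] card by (metis less_Suc_eq_le Suc_eq_plus1)
  have "v = (\<Sum>e\<in>E. b e v *\<^sub>R e)" for v
  proof (rule ccontr)
    assume "v \<noteq> (\<Sum>e\<in>E. b e v *\<^sub>R e)"
    define w where "w = v - (\<Sum>e\<in>E. b e v *\<^sub>R e)"
    then have "w \<noteq> 0" using \<open>v \<noteq> _\<close> by simp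
    then have ww: "b w w > 0" using pos by (simp add: b_def)
    have ew: "b e w = 0" if e: "e \<in> E" for e
    proof -
      have "b e (\<Sum>a\<in>E. b a v *\<^sub>R a) = (\<Sum>a\<in>E. b a v * (if e = a then 1 else 0))"
        unfolding bs bl using E e by (intro sum.cong refl) (auto simp: P_def)
      also have "\<dots> = b e v" using E e by (simp add: P_def if_distrib cong: if_cong)
      finally show ?thesis by (simp add: w_def bl)
    qed
    define z where "z = (1 / sqrt (b w w)) *\<^sub>R w"
    have zz: "b z z = 1" using ww by (simp add: z_def bl field_simps)
    have ez: "b e z = 0" "b z e = 0" if "e \<in> E" for e
      using ew[OF that] bc[of z e] by (simp_all add: z_def bl)
    have "z \<notin> E" using ez(1)[of z] zz by auto
    moreover have "P (insert z E)" using E zz ez by (auto simp: P_def)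
    ultimately show False using max[of "insert z E"] E by (simp add: P_def)
  qed
  then show ?thesis using E unfolding P_def b_def by blast
qed

text \<open>In an orthonormal frame \<open>E\<close> the inverse metric is the sum of the products
  \<open>e $ i * e $ j\<close>, so the inner product of \<open>T\<close> with itself is a sum of
  squares of frame components. Without this sign the square of \<open>tensor_norm\<close>, a square
  root, could not be replaced by \<open>tensor_inner\<close>.\<close>

lemma (in metric_patch) tensor_inner_nonneg:
  assumes x: "x \<in> U" shows "tensor_inner g c x T T \<ge> 0"
proof -
  obtain E where E: "finite E" "\<And>v. v = (\<Sum>e\<in>E. (e \<bullet> (G x *v v)) *\<^sub>R e)"
    using pos_definite_orthonormal_expansion[OF sym_g[OF x] pos_g[OF x]] by blast
  have H: "H x $ i $ j = (\<Sum>e\<in>E. e $ i * e $ j)" for i j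
  proof -
    have "H x $ i $ j = (H x *v axis j 1) $ i"
      by (simp add: matrix_vector_mult_basis column_def)
    also have "\<dots> = (\<Sum>e\<in>E. (e \<bullet> (G x *v (H x *v axis j 1))) *\<^sub>R e) $ i"
      using E(2) by metis
    also have "\<dots> = (\<Sum>e\<in>E. e $ j * e $ i)"
      by (simp add: matrix_vector_mul_assoc g_ginv[OF x] inner_axis)
    finally show ?thesis by (simp add: mult.commute)
  qed
  have "tensor_inner g c x T T
    = (\<Sum>i\<in>UNIV. \<Sum>j\<in>UNIV. \<Sum>k\<in>UNIV. \<Sum>l\<in>UNIV. \<Sum>e\<in>E. \<Sum>e'\<in>E. (e $ i * e' $ j * T $ i $ j) * (e $ k * e' $ l * T $ k $ l))"
    unfolding tensor_inner_def H sum_product sum_distrib_right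
    by (intro sum.cong refl) (simp add: algebra_simps sum_distrib_left)
  also have "\<dots> = (\<Sum>e\<in>E. \<Sum>e'\<in>E. \<Sum>i\<in>UNIV. \<Sum>j\<in>UNIV. \<Sum>k\<in>UNIV. \<Sum>l\<in>UNIV. (e $ i * e' $ j * T $ i $ j) * (e $ k * e' $ l * T $ k $ l))"
    by (simp only: sum.swap[where A = UNIV and B = E])
  also have "\<dots> = (\<Sum>e\<in>E. \<Sum>e'\<in>E. (\<Sum>i\<in>UNIV. \<Sum>j\<in>UNIV. e $ i * e' $ j * T $ i $ j)\<^sup>2)"
    unfolding power2_eq_square sum_product
    by (rule sum.cong[OF refl], rule sum.cong[OF refl], rule sum.cong[OF refl], rule sum.swap)
  finally show ?thesis by (simp add: sum_nonneg)
qed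

lemma (in metric_patch) tensor_norm_power2:
  "x \<in> U \<Longrightarrow> (tensor_norm g c x T)\<^sup>2 = tensor_inner g c x T T"
  by (simp add: tensor_norm_def tensor_inner_nonneg)


section \<open>Behaviour under change of charts\<close>

locale riemannian =
  fixes M :: "'a topology" and A :: "('a, 'n::finite) chart set" and g :: "('a, 'n) tfield"
  assumes riemannian: "riemannian_manifold M A g"
begin

abbreviation "U c \<equiv> coord c ` dom_of c"
abbreviation "W c d \<equiv> coord c ` (dom_of c \<inter> dom_of d)"

lemma topspace_eq: "topspace M = (\<Union>c\<in>A. dom_of c)"
  and Hausdorff: "Hausdorff_space M"
  using riemannian by (auto simp: riemannian_manifold_def smooth_manifold_def)

lemma open_U: "c \<in> A \<Longrightarrow> open (U c)"
  and openin_dom: "c \<in> A \<Longrightarrow> openin M (dom_of c)"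
  and homeo_coord: "c \<in> A \<Longrightarrow> homeomorphic_map (subtopology M (dom_of c)) (top_of_set (U c)) (coord c)"
  using riemannian by (auto simp: riemannian_manifold_def smooth_manifold_def)

lemma dom_subset: "c \<in> A \<Longrightarrow> dom_of c \<subseteq> topspace M"
  using topspace_eq by blast

lemma topspace_dom: "c \<in> A \<Longrightarrow> topspace (subtopology M (dom_of c)) = dom_of c"
  using dom_subset[of c] by (simp only: topspace_subtopology Int_absorb1)

lemma inj_coord: "c \<in> A \<Longrightarrow> inj_on (coord c) (dom_of c)"
  using homeomorphic_imp_injective_map[OF homeo_coord] topspace_dom by simp

lemma point_of_coord [simp]: "c \<in> A \<Longrightarrow> p \<in> dom_of c \<Longrightarrow> point_of c (coord c p) = p"
  unfolding point_of_def by (simp add: inj_coord)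

lemma coord_point_of [simp]: "x \<in> U c \<Longrightarrow> coord c (point_of c x) = x"
  and point_of_in: "x \<in> U c \<Longrightarrow> point_of c x \<in> dom_of c"
  unfolding point_of_def by (simp_all add: f_inv_into_f inv_into_into)

lemma open_coord_image: "c \<in> A \<Longrightarrow> openin M V \<Longrightarrow> V \<subseteq> dom_of c \<Longrightarrow> open (coord c ` V)"
proof -
  assume c: "c \<in> A" "openin M V" "V \<subseteq> dom_of c"
  then have "openin (subtopology M (dom_of c)) V"
    by (metis inf.absorb_iff1 openin_subtopology)
  then have "openin (top_of_set (U c)) (coord c ` V)"
    using homeomorphic_map_openness[OF homeo_coord[OF c(1)], of V] c(3) dom_subset[OF c(1)] by auto
  then show ?thesis using open_U[OF c(1)] openin_open_eq by blast
qed

lemma open_W: "c \<in> A \<Longrightarrow> d \<in> A \<Longrightarrow> open (W c d)"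
  by (intro open_coord_image openin_Int openin_dom) auto

lemma metric_patch: "c \<in> A \<Longrightarrow> metric_patch g c (U c)"
  using riemannian open_U
  by unfold_locales
    (auto simp: riemannian_manifold_def riemannian_metric_def smooth_matrix_def)

lemma transition_coord: "c \<in> A \<Longrightarrow> p \<in> dom_of c \<Longrightarrow> transition c d (coord c p) = coord d p"
  by (simp add: transition_def)

lemma smooth_transition: "c \<in> A \<Longrightarrow> d \<in> A \<Longrightarrow> smooth_on (W c d) (\<lambda>x. transition c d x $ i)"
  using riemannian by (auto simp: riemannian_manifold_def smooth_manifold_def)

lemma differentiable_transition: "c \<in> A \<Longrightarrow> d \<in> A \<Longrightarrow> x \<in> W c d \<Longrightarrow> transition c d differentiable (at x)"
  unfolding differentiable_vec_iff using smooth_transition smooth_on_differentiable by blast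

definition Jac :: "('a, 'n) chart \<Rightarrow> ('a, 'n) chart \<Rightarrow> real ^ 'n \<Rightarrow> real ^ 'n ^ 'n" where
  "Jac c d x = (\<chi> a i. pd i (\<lambda>y. transition c d y $ a) x)"

lemma jacobian_transition: "c \<in> A \<Longrightarrow> d \<in> A \<Longrightarrow> x \<in> W c d \<Longrightarrow> jacobian (transition c d) (at x) = Jac c d x"
  using pd_nth[OF differentiable_transition]
  by (simp add: jacobian_def matrix_def Jac_def vec_eq_iff pd_def)

lemma smooth_Jac: "c \<in> A \<Longrightarrow> d \<in> A \<Longrightarrow> smooth_matrix (W c d) (Jac c d)"
  unfolding smooth_matrix_def Jac_def by (simp add: smooth_on_pd smooth_transition)

lemma metric_transform:
  assumes "c \<in> A" "d \<in> A" "p \<in> dom_of c" "p \<in> dom_of d"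
  shows "g c (coord c p) = transpose (Jac c d (coord c p)) ** g d (coord d p) ** Jac c d (coord c p)"
proof -
  have "\<forall>c\<in>A. \<forall>d\<in>A. \<forall>p \<in> dom_of c \<inter> dom_of d.
        let J = jacobian (transition c d) (at (coord c p))
        in g c (coord c p) = transpose J ** g d (coord d p) ** J"
    using riemannian unfolding riemannian_manifold_def riemannian_metric_def by (elim conjE)
  from this[rule_format, OF assms(1,2), of p] show ?thesis
    using assms(3,4) jacobian_transition[OF assms(1,2), of "coord c p"] unfolding Let_def by simp
qed

lemma vector_field_transform:
  assumes "vector_field A X" "c \<in> A" "d \<in> A" "p \<in> dom_of c" "p \<in> dom_of d"
  shows "X d (coord d p) = Jac c d (coord c p) *v X c (coord c p)"
proof -
  have "\<forall>c\<in>A. \<forall>d\<in>A. \<forall>p \<in> dom_of c \<inter> dom_of d.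
        X d (coord d p) = jacobian (transition c d) (at (coord c p)) *v X c (coord c p)"
    using assms(1) unfolding vector_field_def by (elim conjE)
  from this[rule_format, OF assms(2,3), of p] show ?thesis
    using assms(4,5) jacobian_transition[OF assms(2,3), of "coord c p"] by simp
qed

text \<open>Both claims come from taking determinants in the transformation law of the metric; the
  first because the determinant of the metric is nonzero.\<close>

lemma det_Jac_nz:
  assumes "c \<in> A" "d \<in> A" "p \<in> dom_of c" "p \<in> dom_of d"
  shows "det (Jac c d (coord c p)) \<noteq> 0"
    and "sqrt (det (g c (coord c p))) = \<bar>det (Jac c d (coord c p))\<bar> * sqrt (det (g d (coord d p)))"
proof -
  interpret c: metric_patch g c "U c" by (rule metric_patch[OF assms(1)])
  have "det (g c (coord c p)) = (det (Jac c d (coord c p)))\<^sup>2 * det (g d (coord d p))"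
    by (simp add: metric_transform[OF assms] det_mul power2_eq_square)
  moreover have "det (g c (coord c p)) > 0" using c.det_g_pos assms(3) by blast
  ultimately show "det (Jac c d (coord c p)) \<noteq> 0"
    "sqrt (det (g c (coord c p))) = \<bar>det (Jac c d (coord c p))\<bar> * sqrt (det (g d (coord d p)))"
    by (auto simp: real_sqrt_mult)
qed

text \<open>With a right inverse \<open>K\<close> of the Jacobian, the right-hand side is seen to be
  a left inverse of the metric in the chart \<open>d\<close>.\<close>

lemma ginv_transform:
  assumes cd: "c \<in> A" "d \<in> A" "p \<in> dom_of c" "p \<in> dom_of d"
  shows "ginv g d (coord d p) = Jac c d (coord c p) ** ginv g c (coord c p) ** transpose (Jac c d (coord c p))"
proof -
  interpret c: metric_patch g c "U c" by (rule metric_patch[OF cd(1)])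
  interpret d: metric_patch g d "U d" by (rule metric_patch[OF cd(2)])
  let ?J = "Jac c d (coord c p)" and ?Hc = "ginv g c (coord c p)" and ?Hd = "ginv g d (coord d p)"
    and ?Gd = "g d (coord d p)"
  obtain K where K: "?J ** K = mat 1"
    using det_Jac_nz(1)[OF cd] invertible_det_nz[of ?J] invertible_def by blast
  have "?J ** ?Hc ** transpose ?J ** ?Gd ** ?J = ?J ** (?Hc ** g c (coord c p))"
    by (simp add: metric_transform[OF cd] matrix_mul_assoc)
  also have "\<dots> = ?J" using cd by (simp add: c.ginv_g)
  finally have "?J ** ?Hc ** transpose ?J ** ?Gd ** ?J ** K = ?J ** K" by simp
  then have "?J ** ?Hc ** transpose ?J ** ?Gd = mat 1"
    by (simp add: matrix_mul_assoc[symmetric] K)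
  then have "?J ** ?Hc ** transpose ?J ** (?Gd ** ?Hd) = ?Hd" by (simp add: matrix_mul_assoc)
  then show ?thesis using cd by (simp add: d.g_ginv)
qed

definition tensor_field :: "('a, 'n) tfield \<Rightarrow> bool" where
  "tensor_field T \<longleftrightarrow> (\<forall>c\<in>A. smooth_matrix (U c) (T c)) \<and>
     (\<forall>c\<in>A. \<forall>d\<in>A. \<forall>p\<in>dom_of c \<inter> dom_of d.
       T c (coord c p) = transpose (Jac c d (coord c p)) ** T d (coord d p) ** Jac c d (coord c p))"

text \<open>Agreement on overlaps is what makes the definite description in \<open>at_point\<close>
  denote a value.\<close>

definition invariant :: "(('a, 'n) chart \<Rightarrow> real ^ 'n \<Rightarrow> real) \<Rightarrow> bool" where
  "invariant s \<longleftrightarrow> (\<forall>c\<in>A. \<forall>d\<in>A. \<forall>p\<in>dom_of c \<inter> dom_of d. s c (coord c p) = s d (coord d p))"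

lemma invariantD:
  "invariant s \<Longrightarrow> c \<in> A \<Longrightarrow> d \<in> A \<Longrightarrow> p \<in> dom_of c \<Longrightarrow> p \<in> dom_of d \<Longrightarrow> s c (coord c p) = s d (coord d p)"
  unfolding invariant_def by blast

lemma at_point_eq:
  assumes "invariant s" "c \<in> A" "p \<in> dom_of c"
  shows "at_point A s p = s c (coord c p)"
  unfolding at_point_def
proof (rule the_equality)
  show "\<forall>d\<in>A. p \<in> dom_of d \<longrightarrow> s d (coord d p) = s c (coord c p)"
    using invariantD[OF assms(1)] assms(2,3) by blast
  show "r = s c (coord c p)" if "\<forall>d\<in>A. p \<in> dom_of d \<longrightarrow> s d (coord d p) = r" for r
    using that assms(2,3) by blast
qed

lemma invariant_tensor_trace:
  assumes "tensor_field T" shows "invariant (\<lambda>c x. tensor_trace g c x (T c x))"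
  unfolding invariant_def
proof (intro ballI)
  fix c d p assume cd: "c \<in> A" "d \<in> A" "p \<in> dom_of c \<inter> dom_of d"
  interpret c: metric_patch g c "U c" by (rule metric_patch[OF cd(1)])
  interpret d: metric_patch g d "U d" by (rule metric_patch[OF cd(2)])
  let ?J = "Jac c d (coord c p)" and ?Hc = "ginv g c (coord c p)" and ?Td = "T d (coord d p)"
  have T: "T c (coord c p) = transpose ?J ** ?Td ** ?J"
    using assms cd unfolding tensor_field_def by blast
  have "tensor_trace g c (coord c p) (T c (coord c p)) = trace (?Hc ** transpose ?J ** ?Td ** ?J)"
    using cd by (simp add: c.tensor_trace_eq T matrix_mul_assoc)
  also have "\<dots> = trace (?J ** ?Hc ** transpose ?J ** ?Td)"
    by (subst trace_mul_sym) (simp add: matrix_mul_assoc)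
  also have "\<dots> = tensor_trace g d (coord d p) ?Td"
    using cd ginv_transform[of c d p] by (simp add: d.tensor_trace_eq)
  finally show "tensor_trace g c (coord c p) (T c (coord c p)) = tensor_trace g d (coord d p) ?Td" .
qed

lemma invariant_tensor_inner:
  assumes "tensor_field S" "tensor_field T" shows "invariant (\<lambda>c x. tensor_inner g c x (S c x) (T c x))"
  unfolding invariant_def
proof (intro ballI)
  fix c d p assume cd: "c \<in> A" "d \<in> A" "p \<in> dom_of c \<inter> dom_of d"
  interpret c: metric_patch g c "U c" by (rule metric_patch[OF cd(1)])
  interpret d: metric_patch g d "U d" by (rule metric_patch[OF cd(2)])
  let ?J = "Jac c d (coord c p)" and ?Hc = "ginv g c (coord c p)" and ?Td = "T d (coord d p)"
    and ?Sd = "S d (coord d p)"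
  have T: "T c (coord c p) = transpose ?J ** ?Td ** ?J" "S c (coord c p) = transpose ?J ** ?Sd ** ?J"
    using assms cd unfolding tensor_field_def by blast+
  have "tensor_inner g c (coord c p) (S c (coord c p)) (T c (coord c p))
     = trace (transpose ?J ** (?Sd ** ?J ** ?Hc ** transpose ?J ** transpose ?Td ** ?J ** ?Hc))"
    using cd by (simp add: c.tensor_inner_eq T matrix_mul_assoc matrix_transpose_mul)
  also have "\<dots> = trace (?Sd ** (?J ** ?Hc ** transpose ?J) ** transpose ?Td ** (?J ** ?Hc ** transpose ?J))"
    by (subst trace_mul_sym) (simp add: matrix_mul_assoc)
  also have "\<dots> = tensor_inner g d (coord d p) ?Sd ?Td"
    using cd ginv_transform[of c d p] by (simp add: d.tensor_inner_eq)
  finally show "tensor_inner g c (coord c p) (S c (coord c p)) (T c (coord c p))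
     = tensor_inner g d (coord d p) ?Sd ?Td" .
qed

lemma pd_transition:
  assumes cd: "c \<in> A" "d \<in> A" "p \<in> dom_of c" "p \<in> dom_of d"
    and u: "u differentiable (at (coord d p))"
    and eq: "\<And>q. q \<in> dom_of c \<Longrightarrow> q \<in> dom_of d \<Longrightarrow> v (coord c q) = u (coord d q)"
  shows "pd i v (coord c p) = (\<Sum>a\<in>UNIV. Jac c d (coord c p) $ a $ i *\<^sub>R pd a u (coord d p))"
proof -
  have x: "coord c p \<in> W c d" using cd by blast
  have "pd i v (coord c p) = pd i (\<lambda>y. u (transition c d y)) (coord c p)"
    by (rule pd_cong[OF open_W[OF cd(1,2)] x]) (auto simp: transition_coord cd eq)
  also have "\<dots> = (\<Sum>a\<in>UNIV. Jac c d (coord c p) $ a $ i *\<^sub>R pd a u (coord d p))"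
    using pd_chain[OF differentiable_transition[OF cd(1,2) x], of u i] u
    by (simp add: transition_coord cd Jac_def)
  finally show ?thesis .
qed

lemma vector_field_gradient:
  assumes f: "smooth_fun A f" shows "vector_field A (gradient g f)"
  unfolding vector_field_def
proof (intro conjI ballI allI)
  fix c i assume "c \<in> A"
  then interpret c: metric_patch g c "U c" by (rule metric_patch)
  show "smooth_on (U c) (\<lambda>x. gradient g f c x $ i)"
    using f \<open>c \<in> A\<close> by (intro c.smooth_gradient) (simp add: smooth_fun_def)
next
  fix c d p assume cd: "c \<in> A" "d \<in> A" "p \<in> dom_of c \<inter> dom_of d"
  interpret c: metric_patch g c "U c" by (rule metric_patch[OF cd(1)])
  interpret d: metric_patch g d "U d" by (rule metric_patch[OF cd(2)])
  let ?J = "Jac c d (coord c p)"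
  have "(\<chi> j. pd j (f \<circ> point_of c) (coord c p)) = transpose ?J *v (\<chi> j. pd j (f \<circ> point_of d) (coord d p))"
  proof -
    have "(f \<circ> point_of d) differentiable (at (coord d p))"
      using f cd unfolding smooth_fun_def by (blast intro: smooth_on_differentiable)
    then have "pd i (f \<circ> point_of c) (coord c p) = (\<Sum>a\<in>UNIV. ?J $ a $ i *\<^sub>R pd a (f \<circ> point_of d) (coord d p))" for i
      using cd by (intro pd_transition) auto
    then show ?thesis by (simp add: vec_eq_iff vector_matrix_mult_def mult.commute)
  qed
  then show "gradient g f d (coord d p) = jacobian (transition c d) (at (coord c p)) *v gradient g f c (coord c p)"
    using cd by (simp add: c.gradient_eq d.gradient_eq jacobian_transition ginv_transform[of c d p]
        matrix_vector_mul_assoc matrix_mul_assoc del: transpose_matrix_vector)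
qed

lemma lie_metric_matrix:
  fixes X :: "('a, 'n) vfield"
  assumes c: "c \<in> A" and x: "x \<in> U c"
  defines "D \<equiv> (\<chi> k j. pd j (\<lambda>y. X c y $ k) x)"
  shows "lie_metric X g c x = (\<Sum>k\<in>UNIV. X c x $ k *\<^sub>R pd k (g c) x) + g c x ** D + transpose (g c x ** D)"
proof -
  interpret c: metric_patch g c "U c" by (rule metric_patch[OF c])
  show ?thesis
    by (simp add: vec_eq_iff lie_metric_def pderiv_at_eq_pd D_def transpose_nth matrix_mult_nth
        sum.distrib c.pd_g_nth[OF x] c.g_commute[OF x, of _ j for j])
qed

text \<open>Second derivatives of the transition map enter through the derivatives of the metric
  and, with opposite sign, through those of \<open>X\<close>; in the sum they cancel.\<close>

lemma tensor_field_lie_metric: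
  assumes X: "vector_field A X" shows "tensor_field (lie_metric X g)"
  unfolding tensor_field_def
proof (intro conjI ballI)
  fix c assume c: "c \<in> A"
  then interpret c: metric_patch g c "U c" by (rule metric_patch)
  show "smooth_matrix (U c) (lie_metric X g c)"
    using X c by (intro c.smooth_lie_metric) (simp add: vector_field_def)
next
  fix c d p assume cd: "c \<in> A" "d \<in> A" and p: "p \<in> dom_of c \<inter> dom_of d"
  interpret c: metric_patch g c "U c" by (rule metric_patch[OF cd(1)])
  interpret d: metric_patch g d "U d" by (rule metric_patch[OF cd(2)])
  define x where "x = coord c p"
  define z where "z = coord d p"
  have x: "x \<in> W c d" "x \<in> U c" and z: "z \<in> U d" and phx: "transition c d x = z"
    using cd p by (auto simp: x_def z_def transition_coord)
  let ?J = "Jac c d x" and ?D = "\<chi> k j. pd j (\<lambda>y. X c y $ k) x" and ?D' = "\<chi> k j. pd j (\<lambda>y. X d y $ k) z"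
  let ?G = "g d z"
  \<comment> \<open>The derivative of the Jacobian along \<open>X\<close>. All terms that violate
    the tensor law contain \<open>K\<close> or its transpose.\<close>
  define K where "K = (\<Sum>k\<in>UNIV. X c x $ k *\<^sub>R pd k (Jac c d) x)"
  have dJ: "Jac c d differentiable (at x)"
    by (rule smooth_matrix_differentiable[OF smooth_Jac[OF cd] x(1)])
  have Xz: "X d z = ?J *v X c x"
    using vector_field_transform[OF X cd, of p] p by (simp add: x_def z_def)
  have Gx: "g c x = transpose ?J ** ?G ** ?J"
    using metric_transform[OF cd, of p] p by (simp add: x_def z_def)
  have dXc: "(\<lambda>y. X c y $ a) differentiable (at x)" for a
    using X cd x(2) unfolding vector_field_def by (blast intro: smooth_on_differentiable)
  have dXd: "(\<lambda>y. X d y $ a) differentiable (at z)" for a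
    using X cd z unfolding vector_field_def by (blast intro: smooth_on_differentiable)
  have dGd: "(\<lambda>y. g d (transition c d y)) differentiable (at x)"
    using differentiable_chain_at[OF differentiable_transition[OF cd x(1)], of "g d"] d.differentiable_g[OF z]
    by (simp add: phx o_def)
  have J1: "pd k (g c) x = transpose (pd k (Jac c d) x) ** ?G ** ?J
      + transpose ?J ** (\<Sum>a\<in>UNIV. ?J $ a $ k *\<^sub>R pd a (g d) z) ** ?J
      + transpose ?J ** ?G ** pd k (Jac c d) x" for k
  proof -
    have dT: "(\<lambda>y. transpose (Jac c d y)) differentiable (at x)"
      by (rule smooth_matrix_differentiable[OF smooth_matrix_transpose[OF smooth_Jac[OF cd]] x(1)])
    have "(\<lambda>y. transpose (Jac c d y) ** g d (transition c d y)) differentiable (at x)"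
      using dT dGd unfolding differentiable_def
      using bounded_bilinear.FDERIV[OF bounded_bilinear_matrix_mult] by blast
    moreover have "pd k (g c) x = pd k (\<lambda>y. transpose (Jac c d y) ** g d (transition c d y) ** Jac c d y) x"
      by (rule pd_cong[OF open_W[OF cd] x(1)]) (auto simp: transition_coord cd metric_transform[OF cd])
    moreover have "pd k (\<lambda>y. g d (transition c d y)) x = (\<Sum>a\<in>UNIV. ?J $ a $ k *\<^sub>R pd a (g d) z)"
      using pd_chain[OF differentiable_transition[OF cd x(1)], of "g d" k] d.differentiable_g[OF z]
      by (simp add: phx Jac_def)
    ultimately show ?thesis
      by (simp add: pd_matrix_mult dT dGd dJ pd_transpose phx matrix_mult_linear)
  qed
  \<comment> \<open>Differentiate \<open>X d = J X c\<close>. Symmetry of the second derivatives of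
    the transition map turns the derivative of the Jacobian in direction \<open>i\<close>, applied
    to \<open>X\<close>, into a column of \<open>K\<close>.\<close>
  have J2: "?D' ** ?J = K + ?J ** ?D"
  proof -
    have "(?D' ** ?J) $ a $ i = (K + ?J ** ?D) $ a $ i" for a i
    proof -
      have dJn: "(\<lambda>y. Jac c d y $ a $ k) differentiable (at x)" for k
        using smooth_Jac[OF cd] x(1) unfolding smooth_matrix_def by (blast intro: smooth_on_differentiable)
      have "pd i (\<lambda>y. X d (transition c d y) $ a) x = (\<Sum>b\<in>UNIV. ?J $ b $ i * pd b (\<lambda>y. X d y $ a) z)"
        using pd_chain[OF differentiable_transition[OF cd x(1)], of "\<lambda>y. X d y $ a" i] dXd
        by (simp add: phx Jac_def)
      moreover have "pd i (\<lambda>y. X d (transition c d y) $ a) x = pd i (\<lambda>y. \<Sum>k\<in>UNIV. Jac c d y $ a $ k * X c y $ k) x"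
        by (rule pd_cong[OF open_W[OF cd] x(1)])
           (auto simp: transition_coord cd vector_field_transform[OF X cd] matrix_vector_mult_def)
      moreover have "\<dots> = (\<Sum>k\<in>UNIV. pd i (\<lambda>y. Jac c d y $ a $ k) x * X c x $ k + ?J $ a $ k * pd i (\<lambda>y. X c y $ k) x)"
        by (simp add: pd_sum pd_mult dJn dXc)
      moreover have "pd i (\<lambda>y. Jac c d y $ a $ k) x = pd k (Jac c d) x $ a $ i" for k
      proof -
        have "pd i (\<lambda>y. Jac c d y $ a $ k) x = pd k (\<lambda>y. Jac c d y $ a $ i) x"
          using smooth_on_pd_commute[OF open_W[OF cd] smooth_transition[OF cd] x(1), of i k a]
          by (simp add: Jac_def)
        then show ?thesis by (simp add: pd_matrix_nth[OF dJ])
      qed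
      ultimately show ?thesis
        by (simp add: matrix_mult_nth K_def sum.distrib mult.commute)
    qed
    then show ?thesis unfolding vec_eq_iff by blast
  qed
  have S: "(\<Sum>k\<in>UNIV. X c x $ k *\<^sub>R pd k (g c) x)
     = transpose K ** ?G ** ?J + transpose ?J ** (\<Sum>a\<in>UNIV. X d z $ a *\<^sub>R pd a (g d) z) ** ?J + transpose ?J ** ?G ** K"
  proof -
    have "(\<Sum>a\<in>UNIV. X d z $ a *\<^sub>R pd a (g d) z) = (\<Sum>k\<in>UNIV. X c x $ k *\<^sub>R (\<Sum>a\<in>UNIV. ?J $ a $ k *\<^sub>R pd a (g d) z))"
      unfolding Xz matrix_vector_mult_def
      by (simp add: scaleR_sum_left scaleR_sum_right mult.commute) (rule sum.swap)
    then show ?thesis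
      by (simp add: J1 K_def matrix_mult_linear transpose_linear scaleR_add_right sum.distrib)
  qed
  have GD: "g c x ** ?D = transpose ?J ** (?G ** ?D') ** ?J - transpose ?J ** ?G ** K"
  proof -
    have "g c x ** ?D = transpose ?J ** ?G ** (?J ** ?D)" by (simp add: Gx matrix_mul_assoc)
    also have "?J ** ?D = ?D' ** ?J - K" using J2 by simp
    finally show ?thesis by (simp add: matrix_mult_linear matrix_mul_assoc)
  qed
  have "lie_metric X g c x = transpose ?J ** lie_metric X g d z ** ?J"
    unfolding lie_metric_matrix[OF cd(1) x(2)] lie_metric_matrix[OF cd(2) z] S GD
    by (simp add: matrix_mult_linear transpose_linear matrix_transpose_mul matrix_mul_assoc d.sym_g[OF z])
  then show "lie_metric X g c (coord c p) = transpose (Jac c d (coord c p)) ** lie_metric X g d (coord d p) ** Jac c d (coord c p)"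
    by (simp add: x_def z_def)
qed

end


section \<open>Change of variables for nonnegative functions\<close>

text \<open>Bridge between \<open>absolutely_integrable_on\<close> with \<open>integral\<close>, in
  which the change of variables theorem is phrased, and the nonnegative integral that defines the
  Riemannian measure.\<close>

lemma nn_integral_eq_absolutely_integrable:
  fixes u :: "'a::euclidean_space \<Rightarrow> real"
  assumes m: "(\<lambda>x. indicator S x * u x) \<in> borel_measurable borel" and nn: "\<And>x. x \<in> S \<Longrightarrow> u x \<ge> 0"
  shows "u absolutely_integrable_on S \<longleftrightarrow> (\<integral>\<^sup>+x. ennreal (indicator S x * u x) \<partial>lborel) < \<infinity>"
    and "u absolutely_integrable_on S \<Longrightarrow>
      (\<integral>\<^sup>+x. ennreal (indicator S x * u x) \<partial>lborel) = ennreal (integral S u) \<and> integral S u \<ge> 0"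
proof -
  have nn': "indicator S x * u x \<ge> 0" for x using nn by (simp add: indicator_def)
  have m': "(\<lambda>x. indicator S x * u x) \<in> borel_measurable lborel" using m by simp
  have iff: "u absolutely_integrable_on S \<longleftrightarrow> integrable lborel (\<lambda>x. indicator S x * u x)"
    using integrable_completion[OF m'] by (simp add: set_integrable_def)
  have iff2: "integrable lborel (\<lambda>x. indicator S x * u x) \<longleftrightarrow> (\<integral>\<^sup>+x. ennreal (indicator S x * u x) \<partial>lborel) < \<infinity>"
    using m' nn' by (simp add: integrable_iff_bounded)
  show "u absolutely_integrable_on S \<longleftrightarrow> (\<integral>\<^sup>+x. ennreal (indicator S x * u x) \<partial>lborel) < \<infinity>"
    using iff iff2 by simp
  assume u: "u absolutely_integrable_on S"
  have "integral S u = (\<integral>x. indicator S x * u x \<partial>lborel)"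
    using set_lebesgue_integral_eq_integral(2)[OF u] integral_completion[OF m']
    by (simp add: set_lebesgue_integral_def)
  moreover have "(\<integral>\<^sup>+x. ennreal (indicator S x * u x) \<partial>lborel) = ennreal (\<integral>x. indicator S x * u x \<partial>lborel)"
    using u iff nn' by (intro nn_integral_eq_integral) auto
  moreover have "(\<integral>x. indicator S x * u x \<partial>lborel) \<ge> 0"
    using nn' by (intro integral_nonneg_AE) simp
  ultimately show "(\<integral>\<^sup>+x. ennreal (indicator S x * u x) \<partial>lborel) = ennreal (integral S u) \<and> integral S u \<ge> 0"
    by simp
qed

text \<open>The two sides are absolutely integrable together. If they are, the integrals agree;
  otherwise both nonnegative integrals are infinite.\<close>

lemma nn_integral_change_of_variables_wellorder:
  fixes \<phi> :: "real ^ 'm::{finite,wellorder} \<Rightarrow> real ^ 'm::_" and f :: "real ^ 'm::_ \<Rightarrow> real"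
  assumes S: "S \<in> sets borel"
    and der: "\<And>x. x \<in> S \<Longrightarrow> (\<phi> has_derivative \<phi>' x) (at x)" and inj: "inj_on \<phi> S"
    and nn: "\<And>y. y \<in> \<phi> ` S \<Longrightarrow> f y \<ge> 0"
    and m1: "(\<lambda>x. indicator S x * (\<bar>det (matrix (\<phi>' x))\<bar> * f (\<phi> x))) \<in> borel_measurable borel"
    and m2: "(\<lambda>y. indicator (\<phi> ` S) y * f y) \<in> borel_measurable borel"
  shows "(\<integral>\<^sup>+x. ennreal (indicator S x * (\<bar>det (matrix (\<phi>' x))\<bar> * f (\<phi> x))) \<partial>lborel)
    = (\<integral>\<^sup>+y. ennreal (indicator (\<phi> ` S) y * f y) \<partial>lborel)"
proof -
  let ?D = "\<lambda>x. \<bar>det (matrix (\<phi>' x))\<bar> * f (\<phi> x)"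
  have S': "S \<in> sets lebesgue" using S by simp
  have der': "(\<phi> has_derivative \<phi>' x) (at x within S)" if "x \<in> S" for x
    using der that has_derivative_at_withinI by blast
  have eq: "?D absolutely_integrable_on S \<and> integral S ?D = b \<longleftrightarrow>
      f absolutely_integrable_on (\<phi> ` S) \<and> integral (\<phi> ` S) f = b" for b
    \<comment> \<open>The scalar integrand is wrapped as a vector of dimension 1, since the cited
      theorem is about vector-valued functions.\<close>
    using has_absolute_integral_change_of_variables[OF S' der' inj, of "\<lambda>x. vec (f x)" "vec b :: real ^ 1"]
    by (auto simp: absolutely_integrable_on_1_iff integral_on_1_eq absolutely_integrable_on_def vec_eq_iff)
  have nnD: "?D x \<ge> 0" if "x \<in> S" for x using nn that by simp
  note D = nn_integral_eq_absolutely_integrable[of S ?D, OF m1 nnD]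
  note F = nn_integral_eq_absolutely_integrable[of "\<phi> ` S" f, OF m2 nn]
  show ?thesis
  proof (cases "f absolutely_integrable_on (\<phi> ` S)")
    case True
    then have "?D absolutely_integrable_on S \<and> integral S ?D = integral (\<phi> ` S) f" using eq by blast
    then show ?thesis using D(2) F(2) True by simp
  next
    case False
    then have "\<not> ?D absolutely_integrable_on S" using eq by blast
    then show ?thesis using D(1) F(1) False by (simp add: less_top[symmetric])
  qed
qed

text \<open>The library's change of variables requires a well-ordered index type.  The type \<open>'n idx\<close> is
  a well-ordered copy of the finite type \<open>'n\<close>.\<close>

typedef ('n::finite) idx = "{..<CARD('n)}"
  by (rule exI[of _ 0]) simp

instance idx :: (finite) finite
proof
  have "(UNIV :: 'a idx set) = Abs_idx ` {..<CARD('a)}"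
    using type_definition.Abs_image[OF type_definition_idx] by metis
  then show "finite (UNIV :: 'a idx set)" by (metis finite_imageI finite_lessThan)
qed

instantiation idx :: (finite) wellorder
begin
definition "x \<le> y \<longleftrightarrow> Rep_idx x \<le> Rep_idx y"
definition "x < y \<longleftrightarrow> Rep_idx x < Rep_idx y"
instance
proof
  fix P :: "'a idx \<Rightarrow> bool" and a
  assume *: "\<And>x. (\<And>y. y < x \<Longrightarrow> P y) \<Longrightarrow> P x"
  show "P a" by (induction a rule: measure_induct_rule[of Rep_idx]) (use * less_idx_def in blast)
qed (auto simp: less_eq_idx_def less_idx_def Rep_idx_inject)
end

lemma card_idx: "CARD('n::finite idx) = CARD('n)"
  using type_definition.card[OF type_definition_idx] by simp

text \<open>Any bijection will do: renaming coordinates affects neither Lebesgue measure nor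
  determinants, as the next lemmas show.\<close>

definition idx_bij :: "'n::finite idx \<Rightarrow> 'n" where
  "idx_bij = (SOME b. bij b)"

lemma bij_idx_bij: "bij (idx_bij :: 'n::finite idx \<Rightarrow> 'n)"
proof -
  have "\<exists>b :: 'n idx \<Rightarrow> 'n. bij b"
    using finite_same_card_bij[of "UNIV :: 'n idx set" "UNIV :: 'n set"] card_idx by auto
  then show ?thesis unfolding idx_bij_def by (rule someI_ex)
qed

definition to_idx :: "real ^ 'n \<Rightarrow> real ^ 'n idx" where
  "to_idx x = (\<chi> i. x $ idx_bij i)"

definition from_idx :: "real ^ 'n idx \<Rightarrow> real ^ 'n" where
  "from_idx y = (\<chi> j. y $ inv idx_bij j)"

lemma idx_bij_inv [simp]: "idx_bij (inv idx_bij j) = j" "inv idx_bij (idx_bij i) = i"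
  using bij_idx_bij bij_inv_eq_iff by metis+

lemma from_to_idx [simp]: "from_idx (to_idx x) = x" "to_idx (from_idx y) = y"
  by (simp_all add: from_idx_def to_idx_def vec_eq_iff)

lemma bounded_linear_to_idx: "bounded_linear (to_idx :: real ^ 'n \<Rightarrow> real ^ 'n idx)"
  and bounded_linear_from_idx: "bounded_linear (from_idx :: real ^ 'n idx \<Rightarrow> real ^ 'n)"
  unfolding linear_conv_bounded_linear[symmetric]
  by (auto intro!: linearI simp: to_idx_def from_idx_def vec_eq_iff)

lemma measurable_to_idx [measurable]: "to_idx \<in> borel_measurable borel"
  and measurable_from_idx [measurable]: "from_idx \<in> borel_measurable borel"
  by (intro borel_measurable_continuous_onI linear_continuous_on bounded_linear_to_idx bounded_linear_from_idx)+

lemma prod_Basis_vec: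
  fixes h :: "real ^ 'n \<Rightarrow> real"
  shows "(\<Prod>b\<in>Basis. h b) = (\<Prod>i\<in>UNIV. h (axis i (1::real)))"
proof -
  have "(Basis :: (real ^ 'n) set) = (\<lambda>i. axis i 1) ` UNIV" by (auto simp: Basis_vec_def)
  moreover have "inj (\<lambda>i. axis i 1 :: real ^ 'n)" by (auto simp: inj_def axis_eq_axis)
  ultimately show ?thesis using prod.reindex[of "\<lambda>i. axis i 1" UNIV h] by (simp add: o_def)
qed

text \<open>Lebesgue measure is determined by boxes, and renaming coordinates turns a box into a box
  with the same side lengths.\<close>

lemma lborel_to_idx: "lborel = distr lborel borel (to_idx :: real ^ 'n \<Rightarrow> real ^ 'n idx)"
proof (rule lborel_eqI)
  fix l u :: "real ^ 'n idx" assume le: "\<And>b. b \<in> Basis \<Longrightarrow> l \<bullet> b \<le> u \<bullet> b"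
  have le': "l $ i \<le> u $ i" for i
    using le[of "axis i 1"] by (simp add: inner_axis Basis_vec_def) blast
  have "to_idx -` box l u = box (from_idx l) (from_idx u)"
  proof (intro set_eqI iffI)
    fix x :: "real ^ 'n"
    assume "x \<in> box (from_idx l) (from_idx u)"
    then show "x \<in> to_idx -` box l u"
      by (auto simp: mem_box_cart to_idx_def from_idx_def) (metis idx_bij_inv(2))+
  next
    fix x :: "real ^ 'n"
    assume "x \<in> to_idx -` box l u"
    then show "x \<in> box (from_idx l) (from_idx u)"
      by (auto simp: mem_box_cart to_idx_def from_idx_def) (metis idx_bij_inv(1))+
  qed
  then have "emeasure (distr lborel borel to_idx) (box l u) = emeasure lborel (box (from_idx l) (from_idx u))"
    by (simp add: emeasure_distr)
  also have "\<dots> = (\<Prod>b\<in>Basis. (from_idx u - from_idx l) \<bullet> b)"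
    using le' by (intro emeasure_lborel_box) (auto simp: Basis_vec_def inner_axis from_idx_def)
  also have "(\<Prod>b\<in>Basis. (from_idx u - from_idx l) \<bullet> b) = (\<Prod>j\<in>UNIV. (u - l) $ inv idx_bij j)"
    by (simp add: prod_Basis_vec inner_axis from_idx_def)
  also have "\<dots> = (\<Prod>i\<in>UNIV. (u - l) $ i)"
    by (rule prod.reindex_bij_betw) (simp add: bij_imp_bij_inv bij_idx_bij)
  also have "\<dots> = (\<Prod>b\<in>Basis. (u - l) \<bullet> b)"
    by (simp add: prod_Basis_vec inner_axis)
  finally show "emeasure (distr lborel borel to_idx) (box l u) = (\<Prod>b\<in>Basis. (u - l) \<bullet> b)" .
qed simp

text \<open>Conjugation with \<open>b\<close> is a sign-preserving bijection between the
  permutations of the two index types.\<close>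

lemma det_reindex:
  fixes B :: "real ^ 'n ^ 'n" and b :: "'m::finite \<Rightarrow> 'n"
  assumes b: "bij b"
  shows "det (\<chi> i j. B $ b i $ b j) = det B"
proof -
  let ?m = "map_permutation UNIV b"
  have m: "?m p = b \<circ> p \<circ> inv b" for p
    using b by (simp add: map_permutation_def restrict_id_def bij_is_surj fun_eq_iff)
  have bi: "b (inv b x) = x" "inv b (b y) = y" for x y
    using b by (simp_all add: bij_is_surj surj_f_inv_f bij_is_inj)
  have bij: "bij_betw ?m {p. p permutes UNIV} {p. p permutes UNIV}"
  proof (rule bij_betwI[where g = "\<lambda>q. inv b \<circ> q \<circ> b"])
    have bb: "bij (inv b)" using b bij_imp_bij_inv by blast
    show "?m \<in> {p. p permutes UNIV} \<rightarrow> {p. p permutes UNIV}"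
      using b bb by (auto simp: m dest: permutes_bij intro!: bij_imp_permutes bij_comp)
    show "(\<lambda>q. inv b \<circ> q \<circ> b) \<in> {p. p permutes UNIV} \<rightarrow> {p. p permutes UNIV}"
      using b bb by (auto dest: permutes_bij intro!: bij_imp_permutes bij_comp)
  qed (auto simp: m fun_eq_iff bi)
  have "det B = (\<Sum>p | p permutes (UNIV :: 'm set). of_int (sign (?m p)) * (\<Prod>i\<in>UNIV. B $ i $ ?m p i))"
    unfolding det_def using sum.reindex_bij_betw[OF bij, symmetric] by simp
  also have "\<dots> = (\<Sum>p | p permutes (UNIV :: 'm set). of_int (sign p) * (\<Prod>i\<in>UNIV. B $ b i $ b (p i)))"
  proof (rule sum.cong[OF refl])
    fix p :: "'m \<Rightarrow> 'm" assume "p \<in> {p. p permutes UNIV}"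
    then have "sign (?m p) = sign p"
      using b by (intro sign_map_permutation) (auto simp: bij_is_inj)
    moreover have "(\<Prod>i\<in>UNIV. B $ i $ ?m p i) = (\<Prod>i\<in>UNIV. B $ b i $ b (p i))"
      using prod.reindex_bij_betw[of b UNIV UNIV "\<lambda>i. B $ i $ ?m p i"] b by (simp add: m bi)
    ultimately show "of_int (sign (?m p)) * (\<Prod>i\<in>UNIV. B $ i $ ?m p i)
       = of_int (sign p) * (\<Prod>i\<in>UNIV. B $ b i $ b (p i))" by simp
  qed
  finally show ?thesis by (simp add: det_def)
qed

text \<open>Conjugation with \<open>to_idx\<close> and \<open>from_idx\<close> reduces this to the
  well-ordered index type.\<close>

lemma nn_integral_change_of_variables:
  fixes \<phi> :: "real ^ 'n \<Rightarrow> real ^ 'n" and f :: "real ^ 'n \<Rightarrow> real"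
  assumes S: "S \<in> sets borel"
    and der: "\<And>x. x \<in> S \<Longrightarrow> (\<phi> has_derivative \<phi>' x) (at x)" and inj: "inj_on \<phi> S"
    and nn: "\<And>y. y \<in> \<phi> ` S \<Longrightarrow> f y \<ge> 0"
    and m1: "(\<lambda>x. indicator S x * (\<bar>det (matrix (\<phi>' x))\<bar> * f (\<phi> x))) \<in> borel_measurable borel"
    and m2: "(\<lambda>y. indicator (\<phi> ` S) y * f y) \<in> borel_measurable borel"
  shows "(\<integral>\<^sup>+x. ennreal (indicator S x * (\<bar>det (matrix (\<phi>' x))\<bar> * f (\<phi> x))) \<partial>lborel)
    = (\<integral>\<^sup>+y. ennreal (indicator (\<phi> ` S) y * f y) \<partial>lborel)"
proof -
  define T where "T = (to_idx :: real ^ 'n \<Rightarrow> real ^ 'n idx)"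
  define R where "R = (from_idx :: real ^ 'n idx \<Rightarrow> real ^ 'n)"
  have [simp]: "R (T x) = x" "T (R y) = y" for x y by (simp_all add: T_def R_def)
  have [measurable]: "T \<in> borel_measurable borel" "R \<in> borel_measurable borel"
    by (simp_all add: T_def R_def)
  have blT: "bounded_linear T" and blR: "bounded_linear R"
    by (simp_all add: T_def R_def bounded_linear_to_idx bounded_linear_from_idx)
  define S' where "S' = R -` S"
  define \<psi> where "\<psi> = T \<circ> \<phi> \<circ> R"
  define \<psi>' where "\<psi>' = (\<lambda>y. T \<circ> \<phi>' (R y) \<circ> R)"
  define f' where "f' = f \<circ> R"
  have transfer: "(\<integral>\<^sup>+y. F y \<partial>lborel) = (\<integral>\<^sup>+x. F (T x) \<partial>lborel)"
    if "F \<in> borel_measurable borel" for F :: "real ^ 'n idx \<Rightarrow> ennreal"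
    by (subst lborel_to_idx, subst nn_integral_distr) (use that in \<open>simp_all add: T_def\<close>)
  have detm: "det (matrix (\<psi>' y)) = det (matrix (\<phi>' (R y)))" if "y \<in> S'" for y
  proof -
    have "matrix (\<psi>' y) = (\<chi> i j. matrix (\<phi>' (R y)) $ idx_bij i $ idx_bij j)"
    proof -
      have Rax: "R (axis j 1) = axis (idx_bij j) 1" for j
        by (auto simp: R_def from_idx_def axis_def vec_eq_iff)
      show ?thesis by (simp add: matrix_def \<psi>'_def T_def to_idx_def vec_eq_iff Rax)
    qed
    then show ?thesis by (simp add: det_reindex bij_idx_bij)
  qed
  have img: "T x \<in> \<psi> ` S' \<longleftrightarrow> x \<in> \<phi> ` S" for x
  proof
    assume "T x \<in> \<psi> ` S'"
    then obtain y where "R y \<in> S" "T x = T (\<phi> (R y))" by (auto simp: \<psi>_def S'_def)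
    then have "R (T x) = R (T (\<phi> (R y)))" by simp
    then show "x \<in> \<phi> ` S" using \<open>R y \<in> S\<close> by auto
  next
    assume "x \<in> \<phi> ` S"
    then obtain s where "s \<in> S" "x = \<phi> s" by blast
    then have "T s \<in> S'" "T x = \<psi> (T s)" by (simp_all add: S'_def \<psi>_def)
    then show "T x \<in> \<psi> ` S'" by blast
  qed
  have i1: "indicator S' y * (\<bar>det (matrix (\<psi>' y))\<bar> * f' (\<psi> y))
     = indicator S (R y) * (\<bar>det (matrix (\<phi>' (R y)))\<bar> * f (\<phi> (R y)))" for y
    using detm[of y] by (cases "y \<in> S'") (simp_all add: S'_def f'_def \<psi>_def)
  have i2: "indicator (\<psi> ` S') y * f' y = indicator (\<phi> ` S) (R y) * f (R y)" for y
    using img[of "R y"] by (simp add: f'_def indicator_def)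
  have m1': "(\<lambda>y. indicator S' y * (\<bar>det (matrix (\<psi>' y))\<bar> * f' (\<psi> y))) \<in> borel_measurable borel"
    unfolding i1 by (rule measurable_compose[OF _ m1]) simp
  have m2': "(\<lambda>y. indicator (\<psi> ` S') y * f' y) \<in> borel_measurable borel"
    unfolding i2 by (rule measurable_compose[OF _ m2]) simp
  have "(\<integral>\<^sup>+y. ennreal (indicator S' y * (\<bar>det (matrix (\<psi>' y))\<bar> * f' (\<psi> y))) \<partial>lborel)
    = (\<integral>\<^sup>+y. ennreal (indicator (\<psi> ` S') y * f' y) \<partial>lborel)"
  proof (rule nn_integral_change_of_variables_wellorder[OF _ _ _ _ m1' m2'])
    show "S' \<in> sets borel"
      using measurable_sets[of R borel borel S] S by (simp add: S'_def)
    show "(\<psi> has_derivative \<psi>' y) (at y)" if "y \<in> S'" for y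
    proof -
      have 1: "(R has_derivative R) (at y)" by (rule bounded_linear.has_derivative[OF blR]) (rule has_derivative_ident)
      have 2: "(\<phi> has_derivative \<phi>' (R y)) (at (R y))" using der that by (simp add: S'_def)
      have 3: "(T has_derivative T) (at (\<phi> (R y)))" by (rule bounded_linear.has_derivative[OF blT]) (rule has_derivative_ident)
      show ?thesis
        unfolding \<psi>_def \<psi>'_def o_def by (rule has_derivative_compose[OF has_derivative_compose[OF 1 2] 3])
    qed
    show "inj_on \<psi> S'"
    proof (rule inj_onI)
      fix y z assume "y \<in> S'" "z \<in> S'" "\<psi> y = \<psi> z"
      then have "R (T (\<phi> (R y))) = R (T (\<phi> (R z)))" "R y \<in> S" "R z \<in> S" by (simp_all add: \<psi>_def S'_def)
      then have "R y = R z" using inj by (simp add: inj_on_def)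
      then have "T (R y) = T (R z)" by simp
      then show "y = z" by simp
    qed
    show "f' y \<ge> 0" if "y \<in> \<psi> ` S'" for y
      using nn[of "R y"] img[of "R y"] that by (simp add: f'_def)
  qed
  then have "(\<integral>\<^sup>+x. ennreal (indicator S' (T x) * (\<bar>det (matrix (\<psi>' (T x)))\<bar> * f' (\<psi> (T x)))) \<partial>lborel)
    = (\<integral>\<^sup>+x. ennreal (indicator (\<psi> ` S') (T x) * f' (T x)) \<partial>lborel)"
    using m1' m2' by (simp add: transfer)
  then show ?thesis unfolding i1 i2 by simp
qed


section \<open>The Riemannian measure\<close>

context riemannian
begin

abbreviation "rho c x \<equiv> sqrt (det (g c x))"

definition Borel_M :: "'a measure" where
  "Borel_M = sigma (topspace M) {V. openin M V}"

lemma space_Borel_M: "space Borel_M = topspace M"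
  and sets_Borel_M: "sets Borel_M = sigma_sets (topspace M) {V. openin M V}"
  unfolding Borel_M_def using openin_subset
  by (auto intro!: space_measure_of sets_measure_of)

lemma openin_sets: "openin M V \<Longrightarrow> V \<in> sets Borel_M"
  unfolding sets_Borel_M by (simp add: sigma_sets.Basic)

lemma dom_sets: "c \<in> A \<Longrightarrow> dom_of c \<in> sets Borel_M"
  by (rule openin_sets) (rule openin_dom)

lemma vimage_point_of:
  assumes "c \<in> A" shows "point_of c -` V \<inter> U c = coord c ` (V \<inter> dom_of c)"
proof (intro set_eqI iffI)
  fix x assume x: "x \<in> point_of c -` V \<inter> U c"
  then have "point_of c x \<in> V \<inter> dom_of c" "x = coord c (point_of c x)"
    using point_of_in[of x c] coord_point_of[of x c] by auto
  then show "x \<in> coord c ` (V \<inter> dom_of c)" by blast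
next
  fix x assume "x \<in> coord c ` (V \<inter> dom_of c)"
  then show "x \<in> point_of c -` V \<inter> U c" using assms by auto
qed

lemma measurable_point_of:
  assumes c: "c \<in> A" shows "point_of c \<in> measurable (restrict_space borel (U c)) Borel_M"
  unfolding Borel_M_def
proof (rule measurable_measure_of)
  show "{V. openin M V} \<subseteq> Pow (topspace M)" using openin_subset by auto
  show "point_of c \<in> space (restrict_space borel (U c)) \<rightarrow> topspace M"
    using point_of_coord[OF c] dom_subset[OF c] by (auto simp: space_restrict_space)
  fix V assume "V \<in> {V. openin M V}"
  then have "open (coord c ` (V \<inter> dom_of c))"
    by (intro open_coord_image c openin_Int openin_dom) auto
  then have "coord c ` (V \<inter> dom_of c) \<in> sets (restrict_space borel (U c))"
    using open_U[OF c] by (subst sets_restrict_space_iff) auto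
  then show "point_of c -` V \<inter> space (restrict_space borel (U c)) \<in> sets (restrict_space borel (U c))"
    by (simp add: space_restrict_space vimage_point_of[OF c])
qed

lemma coord_image_sets:
  assumes c: "c \<in> A" and B: "B \<in> sets Borel_M" "B \<subseteq> dom_of c"
  shows "coord c ` B \<in> sets borel"
proof -
  have "point_of c -` B \<inter> U c \<in> sets (restrict_space borel (U c))"
    using measurable_sets[OF measurable_point_of[OF c] B(1)] by (simp add: space_restrict_space)
  moreover have "point_of c -` B \<inter> U c = coord c ` B"
    using B(2) by (simp add: vimage_point_of[OF c] Int_absorb2)
  ultimately show ?thesis
    using open_U[OF c] by (subst (asm) sets_restrict_space_iff) auto
qed

lemma continuous_rho: "c \<in> A \<Longrightarrow> continuous_on (U c) (rho c)"
  using metric_patch.Ck_on_sqrt_det[OF metric_patch] Ck_on_continuous by blast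

lemma rho_pos: "c \<in> A \<Longrightarrow> x \<in> U c \<Longrightarrow> rho c x > 0"
  using metric_patch.det_g_pos[OF metric_patch] by simp

lemma rho_measurable:
  assumes c: "c \<in> A" and S: "S \<in> sets borel" "S \<subseteq> U c"
  shows "(\<lambda>x. indicator S x * rho c x) \<in> borel_measurable borel"
  using borel_measurable_continuous_on_indicator[OF S(1) continuous_on_subset[OF continuous_rho[OF c] S(2)]]
  by simp

definition chart_volume :: "('a, 'n) chart \<Rightarrow> 'a set \<Rightarrow> ennreal" where
  "chart_volume c B = (\<integral>\<^sup>+x. ennreal (rho c x) * indicator (coord c ` B) x \<partial>lborel)"

lemma chart_volume_eq:
  "chart_volume c B = (\<integral>\<^sup>+x. ennreal (indicator (coord c ` B) x * rho c x) \<partial>lborel)"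
  unfolding chart_volume_def by (intro nn_integral_cong) (simp add: indicator_def)

text \<open>Change of variables along the transition map; by \<open>det_Jac_nz\<close> the factor
  \<open>\<bar>det\<bar>\<close> of its Jacobian is exactly the ratio of the two densities.\<close>

lemma chart_volume_unique:
  assumes cd: "c \<in> A" "d \<in> A" and B: "B \<in> sets Borel_M" "B \<subseteq> dom_of c" "B \<subseteq> dom_of d"
  shows "chart_volume c B = chart_volume d B"
proof -
  let ?\<phi> = "transition c d" and ?S = "coord c ` B"
  let ?\<phi>' = "\<lambda>x. frechet_derivative ?\<phi> (at x)"
  have S: "?S \<in> sets borel" "?S \<subseteq> U c" using coord_image_sets[OF cd(1)] B by auto
  have S': "coord d ` B \<in> sets borel" "coord d ` B \<subseteq> U d" using coord_image_sets[OF cd(2)] B by auto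
  have img: "?\<phi> ` ?S = coord d ` B"
    unfolding image_image using B(2) by (intro image_cong refl transition_coord cd) auto
  have xW: "x \<in> W c d" if "x \<in> ?S" for x using that B by auto
  have eq: "indicator ?S x * (\<bar>det (matrix (?\<phi>' x))\<bar> * rho d (?\<phi> x)) = indicator ?S x * rho c x" for x
  proof (cases "x \<in> ?S")
    case True
    then obtain p where p: "p \<in> B" "x = coord c p" by blast
    then have pc: "p \<in> dom_of c" "p \<in> dom_of d" using B by auto
    have "matrix (?\<phi>' x) = Jac c d x"
      using jacobian_transition[OF cd xW[OF True]] by (simp add: jacobian_def)
    then show ?thesis
      using det_Jac_nz(2)[OF cd pc] transition_coord[OF cd(1) pc(1), of d] p by simp
  qed simp
  have "chart_volume c B = (\<integral>\<^sup>+x. ennreal (indicator ?S x * (\<bar>det (matrix (?\<phi>' x))\<bar> * rho d (?\<phi> x))) \<partial>lborel)"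
    by (simp only: chart_volume_eq eq)
  also have "\<dots> = (\<integral>\<^sup>+y. ennreal (indicator (?\<phi> ` ?S) y * rho d y) \<partial>lborel)"
  proof (rule nn_integral_change_of_variables[OF S(1)])
    show "(?\<phi> has_derivative ?\<phi>' x) (at x)" if "x \<in> ?S" for x
      using differentiable_transition[OF cd xW[OF that]] frechet_derivative_works by blast
    show "inj_on ?\<phi> ?S"
    proof (rule inj_onI)
      fix x y assume xy: "x \<in> ?S" "y \<in> ?S" "?\<phi> x = ?\<phi> y"
      then obtain p q where pq: "p \<in> B" "x = coord c p" "q \<in> B" "y = coord c q" by blast
      have "?\<phi> x = coord d p" "?\<phi> y = coord d q"
        unfolding pq(2,4) using pq(1,3) B(2) by (auto intro!: transition_coord[OF cd(1)])
      then have "coord d p = coord d q" using xy(3) by simp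
      then have "p = q" using inj_coord[OF cd(2)] pq B by (auto dest: inj_onD)
      then show "x = y" using pq by simp
    qed
    show "rho d y \<ge> 0" if "y \<in> ?\<phi> ` ?S" for y
      using that rho_pos[OF cd(2), of y] S'(2) unfolding img by auto
    show "(\<lambda>x. indicator ?S x * (\<bar>det (matrix (?\<phi>' x))\<bar> * rho d (?\<phi> x))) \<in> borel_measurable borel"
      unfolding eq by (rule rho_measurable[OF cd(1) S])
    show "(\<lambda>y. indicator (?\<phi> ` ?S) y * rho d y) \<in> borel_measurable borel"
      unfolding img by (rule rho_measurable[OF cd(2) S'])
  qed
  also have "\<dots> = chart_volume d B" by (simp only: img chart_volume_eq)
  finally show ?thesis .
qed

text \<open>A push-forward is a measure on all Borel sets of the manifold, so the countable
  additivity of sums of such measures comes for free.\<close>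

definition chart_measure :: "('a, 'n) chart \<Rightarrow> 'a measure" where
  "chart_measure c = distr (density (restrict_space lborel (U c)) (rho c)) Borel_M (point_of c)"

lemma measurable_rho_restrict:
  assumes c: "c \<in> A" shows "rho c \<in> borel_measurable (restrict_space lborel (U c))"
  using borel_measurable_continuous_on_restrict[OF continuous_rho[OF c]]
  by (simp add: measurable_cong_sets[OF sets_restrict_space_cong[OF sets_lborel]])

lemma emeasure_chart_density:
  assumes c: "c \<in> A" and S: "S \<in> sets borel" "S \<subseteq> U c"
  shows "emeasure (density (restrict_space lborel (U c)) (rho c)) S
    = (\<integral>\<^sup>+x. ennreal (rho c x) * indicator S x \<partial>lborel)"
proof -
  have "S \<in> sets (restrict_space lborel (U c))"
    using S open_U[OF c] by (subst sets_restrict_space_iff) auto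
  then have "emeasure (density (restrict_space lborel (U c)) (rho c)) S
     = (\<integral>\<^sup>+x. ennreal (rho c x) * indicator S x \<partial>restrict_space lborel (U c))"
    using measurable_rho_restrict[OF c] by (intro emeasure_density) auto
  also have "\<dots> = (\<integral>\<^sup>+x. ennreal (rho c x) * indicator S x * indicator (U c) x \<partial>lborel)"
    using open_U[OF c] by (intro nn_integral_restrict_space) auto
  also have "\<dots> = (\<integral>\<^sup>+x. ennreal (rho c x) * indicator S x \<partial>lborel)"
    using S(2) by (intro nn_integral_cong) (auto simp: indicator_def)
  finally show ?thesis .
qed

lemma measurable_point_of_density:
  assumes c: "c \<in> A"
  shows "point_of c \<in> measurable (density (restrict_space lborel (U c)) (rho c)) Borel_M"
  using measurable_point_of[OF c]
  by (simp add: measurable_cong_sets[OF sets_restrict_space_cong[OF sets_lborel]])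

lemma emeasure_chart_measure:
  assumes c: "c \<in> A" and B: "B \<in> sets Borel_M" "B \<subseteq> dom_of c"
  shows "emeasure (chart_measure c) B = chart_volume c B"
proof -
  have "emeasure (chart_measure c) B
    = emeasure (density (restrict_space lborel (U c)) (rho c)) (point_of c -` B \<inter> U c)"
    unfolding chart_measure_def
    by (subst emeasure_distr[OF measurable_point_of_density[OF c] B(1)]) (simp add: space_restrict_space)
  also have "point_of c -` B \<inter> U c = coord c ` B"
    using B(2) by (simp add: vimage_point_of[OF c] Int_absorb2)
  also have "emeasure (density (restrict_space lborel (U c)) (rho c)) (coord c ` B) = chart_volume c B"
    unfolding chart_volume_def
    using coord_image_sets[OF c B] B(2) by (intro emeasure_chart_density[OF c]) auto
  finally show ?thesis .
qed

lemma sets_chart_measure: "sets (chart_measure c) = sets Borel_M"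
  by (simp add: chart_measure_def)

lemma openin_point_of_image:
  assumes c: "c \<in> A" and V: "open V" "V \<subseteq> U c"
  shows "openin M (point_of c ` V)"
proof -
  have eq: "point_of c ` V = {p \<in> topspace (subtopology M (dom_of c)). coord c p \<in> V}"
  proof (intro set_eqI iffI)
    fix p assume "p \<in> point_of c ` V"
    then obtain x where x: "x \<in> V" "p = point_of c x" by blast
    then show "p \<in> {p \<in> topspace (subtopology M (dom_of c)). coord c p \<in> V}"
      using V point_of_in[of x c] coord_point_of[of x c] unfolding topspace_dom[OF c] by auto
  next
    fix p assume "p \<in> {p \<in> topspace (subtopology M (dom_of c)). coord c p \<in> V}"
    then have "coord c p \<in> V" "p = point_of c (coord c p)" unfolding topspace_dom[OF c] using c by auto
    then show "p \<in> point_of c ` V" by blast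
  qed
  have "continuous_map (subtopology M (dom_of c)) (top_of_set (U c)) (coord c)"
    using homeomorphic_imp_continuous_map[OF homeo_coord[OF c]] .
  moreover have "openin (top_of_set (U c)) V" using V by (simp add: open_subset)
  ultimately have "openin (subtopology M (dom_of c)) (point_of c ` V)"
    unfolding eq continuous_map_def by blast
  then show ?thesis using openin_trans_full[OF _ openin_dom[OF c]] by blast
qed

end

section \<open>Existence, uniqueness and finiteness of the Riemannian measure on a compact
  manifold\<close>

locale compact_riemannian = riemannian M A g
  for M :: "'a topology" and A :: "('a, 'n::finite) chart set" and g :: "('a, 'n) tfield" +
  assumes compact: "compact_space M"
begin

text \<open>The open balls cover, while the closed ones still lie in the chart: this bounds the
  density on each ball and gives cut-off functions compact support.\<close>

definition ball_cover :: "'a set \<Rightarrow> ('a \<Rightarrow> ('a, 'n) chart) \<Rightarrow> ('a \<Rightarrow> real) \<Rightarrow> bool" where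
  "ball_cover P ch r \<longleftrightarrow> finite P \<and>
     (\<forall>p\<in>P. ch p \<in> A \<and> r p > 0 \<and> cball (coord (ch p) p) (r p) \<subseteq> U (ch p)) \<and>
     topspace M = (\<Union>p\<in>P. point_of (ch p) ` ball (coord (ch p) p) (r p))"

lemma ball_coverD:
  assumes "ball_cover P ch r"
  shows "finite P" "\<And>p. p \<in> P \<Longrightarrow> ch p \<in> A" "\<And>p. p \<in> P \<Longrightarrow> r p > 0"
    "\<And>p. p \<in> P \<Longrightarrow> cball (coord (ch p) p) (r p) \<subseteq> U (ch p)"
    "topspace M = (\<Union>p\<in>P. point_of (ch p) ` ball (coord (ch p) p) (r p))"
  using assms unfolding ball_cover_def by blast+

lemma ex_ball_cover: "\<exists>P ch r. ball_cover P ch r"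
proof -
  have "\<exists>c. c \<in> A \<and> p \<in> dom_of c" if "p \<in> topspace M" for p
    using that unfolding topspace_eq by blast
  then obtain ch where ch: "\<And>p. p \<in> topspace M \<Longrightarrow> ch p \<in> A" "\<And>p. p \<in> topspace M \<Longrightarrow> p \<in> dom_of (ch p)"
    by metis
  have "\<exists>r>0. cball (coord (ch p) p) r \<subseteq> U (ch p)" if "p \<in> topspace M" for p
    using open_U[OF ch(1)[OF that]] ch(2)[OF that] open_contains_cball by blast
  then obtain r where r: "\<And>p. p \<in> topspace M \<Longrightarrow> r p > 0"
    "\<And>p. p \<in> topspace M \<Longrightarrow> cball (coord (ch p) p) (r p) \<subseteq> U (ch p)" by metis
  let ?N = "\<lambda>p. point_of (ch p) ` ball (coord (ch p) p) (r p)"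
  have sub: "ball (coord (ch p) p) (r p) \<subseteq> U (ch p)" if "p \<in> topspace M" for p
    using r(2)[OF that] ball_subset_cball by blast
  have op: "openin M (?N p)" if "p \<in> topspace M" for p
    by (rule openin_point_of_image[OF ch(1)[OF that] open_ball sub[OF that]])
  have inN: "p \<in> ?N p" if "p \<in> topspace M" for p
  proof (rule image_eqI[of _ _ "coord (ch p) p"])
    show "p = point_of (ch p) (coord (ch p) p)" using ch[OF that] by simp
    show "coord (ch p) p \<in> ball (coord (ch p) p) (r p)" using r(1)[OF that] by simp
  qed
  have "compactin M (topspace M)" using compact by (simp add: compact_space_def)
  then have "\<exists>F. finite F \<and> F \<subseteq> ?N ` topspace M \<and> topspace M \<subseteq> \<Union>F"
    by (rule compactinD) (use op inN in blast)+
  then obtain F where F: "finite F" "F \<subseteq> ?N ` topspace M" "topspace M \<subseteq> \<Union>F" by (elim exE conjE)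
  obtain P where P: "finite P" "P \<subseteq> topspace M" "topspace M \<subseteq> \<Union>(?N ` P)"
    using finite_subset_image[OF F(1,2)] F(3) by (elim exE conjE) simp
  have PM: "p \<in> topspace M" if "p \<in> P" for p using P(2) that by blast
  have cov: "topspace M = (\<Union>p\<in>P. ?N p)" using P(3) op[OF PM] openin_subset by blast
  have "ball_cover P ch r"
    unfolding ball_cover_def using P(1) ch(1)[OF PM] r(1)[OF PM] r(2)[OF PM] cov by blast
  then show ?thesis by blast
qed

text \<open>Compactness reduces the atlas to finitely many domains; removing from each the earlier
  ones makes the pieces disjoint, Borel, and still contained in a chart.\<close>

lemma ex_disjoint_cover:
  "\<exists>m cs D. (\<forall>k<m::nat. cs k \<in> A \<and> D k \<in> sets Borel_M \<and> D k \<subseteq> dom_of (cs k)) \<and>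
    topspace M = (\<Union>k<m. D k) \<and> disjoint_family_on D {..<m}"
proof -
  obtain P ch r where cov: "ball_cover P ch r" using ex_ball_cover by blast
  note P = ball_coverD[OF cov]
  obtain pk :: "nat \<Rightarrow> 'a" and m where pk: "P = pk ` {..<m}"
    using P(1) finite_imp_nat_seg_image_inj_on by (metis lessThan_def)
  define cs where "cs k = ch (pk k)" for k
  define D where "D = disjointed (\<lambda>k. dom_of (cs k))"
  have cs: "cs k \<in> A" if "k < m" for k using P(2) pk that by (auto simp: cs_def)
  have "topspace M \<subseteq> (\<Union>k<m. dom_of (cs k))"
  proof
    fix q assume "q \<in> topspace M"
    then obtain p x where px: "p \<in> P" "x \<in> ball (coord (ch p) p) (r p)" "q = point_of (ch p) x" using P(5) by blast
    then have "x \<in> U (ch p)" using P(4) ball_subset_cball by blast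
    then have "q \<in> dom_of (ch p)" using px point_of_in by metis
    then show "q \<in> (\<Union>k<m. dom_of (cs k))" using px(1) pk by (auto simp: cs_def)
  qed
  then have cover: "topspace M = (\<Union>k<m. dom_of (cs k))" using cs dom_subset by blast
  show ?thesis
  proof (intro exI conjI allI impI)
    show "cs k \<in> A" if "k < m" for k using cs that .
    show "D k \<in> sets Borel_M" if "k < m" for k
      unfolding D_def disjointed_def using that cs
      by (intro sets.Diff sets.finite_UN dom_sets) auto
    show "D k \<subseteq> dom_of (cs k)" if "k < m" for k unfolding D_def disjointed_def by blast
    show "topspace M = (\<Union>k<m. D k)"
      using cover finite_UN_disjointed_eq[of "\<lambda>k. dom_of (cs k)" m] by (simp add: D_def atLeast0LessThan)
    show "disjoint_family_on D {..<m}"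
      using disjoint_family_disjointed[of "\<lambda>k. dom_of (cs k)"] by (auto simp: D_def disjoint_family_on_def)
  qed
qed

definition volume_spec :: "'a measure \<Rightarrow> bool" where
  "volume_spec \<mu> \<longleftrightarrow> space \<mu> = topspace M \<and> sets \<mu> = sigma_sets (topspace M) {V. openin M V} \<and>
     (\<forall>c\<in>A. \<forall>B\<in>sets \<mu>. B \<subseteq> dom_of c \<longrightarrow>
        emeasure \<mu> B = (\<integral>\<^sup>+x. ennreal (rho c x) * indicator (coord c ` B) x \<partial>lborel))"

lemma volume_spec_emeasure:
  assumes "volume_spec \<nu>" "c \<in> A" "B \<in> sets Borel_M" "B \<subseteq> dom_of c"
  shows "emeasure \<nu> B = chart_volume c B"
proof -
  have "sets \<nu> = sets Borel_M" using assms(1) by (simp add: volume_spec_def sets_Borel_M)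
  then have "B \<in> sets \<nu>" using assms(3) by simp
  then show ?thesis
    using assms(1,2,4) unfolding volume_spec_def chart_volume_def by blast
qed

text \<open>Existence: add up the chart measures of the disjoint pieces; the sum has the right
  density in every chart by \<open>chart_volume_unique\<close> on each piece. Uniqueness: the
  density condition fixes a measure on every piece, hence on their union.\<close>

lemma ex1_volume: "\<exists>!\<mu>. volume_spec \<mu>"
proof -
  obtain m :: nat and cs D where all: "\<forall>k<m. cs k \<in> A \<and> D k \<in> sets Borel_M \<and> D k \<subseteq> dom_of (cs k)"
    and cover: "topspace M = (\<Union>k<m. D k)" and disj: "disjoint_family_on D {..<m}"
    using ex_disjoint_cover by blast
  have cs: "cs k \<in> A" and D: "D k \<in> sets Borel_M" and Ddom: "D k \<subseteq> dom_of (cs k)" if "k < m" for k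
    using all that by blast+
  have split: "emeasure \<nu> B = (\<Sum>k<m. emeasure \<nu> (B \<inter> D k))"
    if "sets \<nu> = sets Borel_M" "B \<in> sets Borel_M" for \<nu> B
  proof -
    have "(\<Sum>k<m. emeasure \<nu> (B \<inter> D k)) = emeasure \<nu> (\<Union>k<m. B \<inter> D k)"
    proof (rule sum_emeasure)
      show "(\<lambda>k. B \<inter> D k) ` {..<m} \<subseteq> sets \<nu>" using that D by auto
      show "disjoint_family_on (\<lambda>k. B \<inter> D k) {..<m}"
        using disj unfolding disjoint_family_on_def by blast
    qed simp
    moreover have "(\<Union>k<m. B \<inter> D k) = B"
      using cover sets.sets_into_space[OF that(2)] by (auto simp: space_Borel_M)
    ultimately show ?thesis by simp
  qed
  define \<mu>0 where "\<mu>0 B = (\<Sum>k<m. emeasure (chart_measure (cs k)) (B \<inter> D k))" for B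
  define \<mu> where "\<mu> = measure_of (topspace M) (sets Borel_M) \<mu>0"
  have sp: "space \<mu> = topspace M" and st: "sets \<mu> = sets Borel_M"
    using sets.space_closed[of Borel_M] sets.sigma_sets_eq[of Borel_M]
    by (simp_all add: \<mu>_def space_Borel_M)
  have em: "emeasure \<mu> B = \<mu>0 B" if B: "B \<in> sets Borel_M" for B
    unfolding \<mu>_def
  proof (rule emeasure_measure_of_sigma[OF _ _ _ B])
    show "sigma_algebra (topspace M) (sets Borel_M)"
      using sets.sigma_algebra_axioms[of Borel_M] by (simp add: space_Borel_M)
    show "positive (sets Borel_M) \<mu>0" by (simp add: positive_def \<mu>0_def)
    show "countably_additive (sets Borel_M) \<mu>0"
      unfolding countably_additive_def
    proof (intro allI impI)
      fix F :: "nat \<Rightarrow> 'a set"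
      assume F: "range F \<subseteq> sets Borel_M" "disjoint_family F" "(\<Union>i. F i) \<in> sets Borel_M"
      have "(\<Sum>i. \<mu>0 (F i)) = (\<Sum>k<m. \<Sum>i. emeasure (chart_measure (cs k)) (F i \<inter> D k))"
        unfolding \<mu>0_def by (rule suminf_sum) simp
      also have "\<dots> = (\<Sum>k<m. emeasure (chart_measure (cs k)) (\<Union>i. F i \<inter> D k))"
      proof (intro sum.cong refl suminf_emeasure)
        fix k assume "k \<in> {..<m}"
        then show "range (\<lambda>i. F i \<inter> D k) \<subseteq> sets (chart_measure (cs k))"
          using F(1) D by (auto simp: sets_chart_measure)
        show "disjoint_family (\<lambda>i. F i \<inter> D k)"
          using F(2) unfolding disjoint_family_on_def by blast
      qed
      also have "\<dots> = \<mu>0 (\<Union>i. F i)" by (simp add: \<mu>0_def)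
      finally show "(\<Sum>i. \<mu>0 (F i)) = \<mu>0 (\<Union>i. F i)" .
    qed
  qed
  have spec: "volume_spec \<mu>"
    unfolding volume_spec_def
  proof (intro conjI ballI impI)
    fix c B assume c: "c \<in> A" and B': "B \<in> sets \<mu>" and Bc: "B \<subseteq> dom_of c"
    have B: "B \<in> sets Borel_M" using B' st by simp
    have "emeasure \<mu> B = (\<Sum>k<m. emeasure (chart_measure c) (B \<inter> D k))"
      unfolding em[OF B] \<mu>0_def
    proof (rule sum.cong[OF refl])
      fix k assume "k \<in> {..<m}"
      then have k: "k < m" by simp
      have BD: "B \<inter> D k \<in> sets Borel_M" "B \<inter> D k \<subseteq> dom_of c" "B \<inter> D k \<subseteq> dom_of (cs k)"
        using B D[OF k] Ddom[OF k] Bc by auto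
      show "emeasure (chart_measure (cs k)) (B \<inter> D k) = emeasure (chart_measure c) (B \<inter> D k)"
        by (simp only: emeasure_chart_measure[OF cs[OF k] BD(1,3)] emeasure_chart_measure[OF c BD(1,2)]
            chart_volume_unique[OF cs[OF k] c BD(1,3,2)])
    qed
    also have "\<dots> = emeasure (chart_measure c) B" using split[OF sets_chart_measure B] by simp
    finally show "emeasure \<mu> B = (\<integral>\<^sup>+x. ennreal (rho c x) * indicator (coord c ` B) x \<partial>lborel)"
      using emeasure_chart_measure[OF c B Bc] by (simp add: chart_volume_def)
  qed (use sp st in \<open>simp_all add: sets_Borel_M\<close>)
  have "\<nu> = \<mu>" if "volume_spec \<nu>" for \<nu>
  proof (rule measure_eqI)
    have st': "sets \<nu> = sets Borel_M" using that by (simp add: volume_spec_def sets_Borel_M)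
    show "sets \<nu> = sets \<mu>" using st st' by simp
    fix B assume "B \<in> sets \<nu>"
    then have B: "B \<in> sets Borel_M" using st' by simp
    have "emeasure \<nu> B = (\<Sum>k<m. emeasure \<nu> (B \<inter> D k))" by (rule split[OF st' B])
    also have "\<dots> = (\<Sum>k<m. emeasure \<mu> (B \<inter> D k))"
    proof (rule sum.cong[OF refl])
      fix k assume "k \<in> {..<m}"
      then have k: "k < m" by simp
      have BD: "B \<inter> D k \<in> sets Borel_M" "B \<inter> D k \<subseteq> dom_of (cs k)" using B D[OF k] Ddom[OF k] by auto
      show "emeasure \<nu> (B \<inter> D k) = emeasure \<mu> (B \<inter> D k)"
        using volume_spec_emeasure[OF _ cs[OF k] BD] that spec by simp
    qed
    also have "\<dots> = emeasure \<mu> B" using split[OF st B] by simp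
    finally show "emeasure \<nu> B = emeasure \<mu> B" .
  qed
  with spec show ?thesis by blast
qed

abbreviation "vol \<equiv> riemannian_measure M A g"

lemma volume_spec_vol: "volume_spec vol"
  using theI'[OF ex1_volume] unfolding riemannian_measure_def volume_spec_def .

lemma space_vol: "space vol = topspace M"
  and sets_vol: "sets vol = sets Borel_M"
  using volume_spec_vol by (simp_all add: volume_spec_def sets_Borel_M)

lemma emeasure_vol: "c \<in> A \<Longrightarrow> B \<in> sets Borel_M \<Longrightarrow> B \<subseteq> dom_of c \<Longrightarrow> emeasure vol B = chart_volume c B"
  by (rule volume_spec_emeasure[OF volume_spec_vol])

text \<open>Restricted to the domain, the Riemannian measure is the push-forward of the density
  \<open>rho c\<close> under \<open>point_of c\<close>; a function vanishing elsewhere can be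
  integrated there.\<close>

lemma integral_chart:
  fixes F :: "'a \<Rightarrow> real"
  assumes c: "c \<in> A" and F: "F \<in> borel_measurable vol" "\<And>p. p \<in> topspace M - dom_of c \<Longrightarrow> F p = 0"
  shows "(LINT p|vol. F p) = (LINT x|lborel. indicator (U c) x * (rho c x * F (point_of c x)))"
proof -
  have dom: "dom_of c \<inter> space vol \<in> sets vol"
    using dom_sets[OF c] dom_subset[OF c] by (simp add: sets_vol space_vol Int_absorb2)
  let ?\<nu> = "density (restrict_space lborel (U c)) (rho c)"
  let ?R = "restrict_space vol (dom_of c)"
  have meas: "point_of c \<in> measurable ?\<nu> ?R"
    using measurable_point_of_density[OF c] point_of_coord[OF c]
    by (intro measurable_restrict_space2)
       (auto simp: space_restrict_space measurable_cong_sets[OF refl sets_vol])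
  have R: "?R = distr ?\<nu> ?R (point_of c)"
  proof (rule measure_eqI)
    fix B assume B: "B \<in> sets ?R"
    then have B': "B \<in> sets Borel_M" "B \<subseteq> dom_of c"
      using dom dom_subset[OF c] by (auto simp: sets_restrict_space_iff sets_vol)
    have "emeasure ?R B = emeasure vol B"
      using dom B'(2) by (intro emeasure_restrict_space)
    also have "\<dots> = emeasure ?\<nu> (point_of c -` B \<inter> U c)"
      using emeasure_vol[OF c B'] emeasure_chart_measure[OF c B'] unfolding chart_measure_def
      by (subst (asm) emeasure_distr[OF measurable_point_of_density[OF c] B'(1)]) (simp add: space_restrict_space)
    also have "\<dots> = emeasure (distr ?\<nu> ?R (point_of c)) B"
      by (subst emeasure_distr[OF meas B]) (simp add: space_restrict_space)
    finally show "emeasure ?R B = emeasure (distr ?\<nu> ?R (point_of c)) B" .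
  qed simp
  have "(LINT p|vol. F p) = (LINT p|vol. indicator (dom_of c) p *\<^sub>R F p)"
    using F(2) by (intro Bochner_Integration.integral_cong) (auto simp: space_vol indicator_def)
  also have "\<dots> = (LINT p|?R. F p)"
    using dom by (intro integral_restrict_space[symmetric])
  also have "\<dots> = (LINT p|distr ?\<nu> ?R (point_of c). F p)" using R by simp
  also have "\<dots> = (LINT x|?\<nu>. F (point_of c x))"
    using meas F(1) by (intro integral_distr) (auto intro: measurable_restrict_space1)
  also have "\<dots> = (LINT x|restrict_space lborel (U c). rho c x *\<^sub>R F (point_of c x))"
  proof (rule integral_density)
    have "(\<lambda>x. F (point_of c x)) \<in> borel_measurable ?\<nu>"
      using measurable_compose[OF meas measurable_restrict_space1[OF F(1)]] .
    then show "(\<lambda>x. F (point_of c x)) \<in> borel_measurable (restrict_space lborel (U c))" by simp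
    show "rho c \<in> borel_measurable (restrict_space lborel (U c))" by (rule measurable_rho_restrict[OF c])
    show "AE x in restrict_space lborel (U c). 0 \<le> rho c x"
      using rho_pos[OF c] by (intro AE_I2) (auto simp: space_restrict_space intro: less_imp_le)
  qed
  also have "\<dots> = (LINT x|lborel. indicator (U c) x *\<^sub>R (rho c x *\<^sub>R F (point_of c x)))"
    using open_U[OF c] by (intro integral_restrict_space) auto
  finally show ?thesis by simp
qed

text \<open>Finitely many balls cover, and on each closed ball the continuous density is bounded.
  Continuous functions thereby become integrable.\<close>

lemma finite_measure_vol: "finite_measure vol"
proof (rule finite_measureI)
  obtain P ch r where cov: "ball_cover P ch r" using ex_ball_cover by blast
  note P = ball_coverD[OF cov]
  let ?N = "\<lambda>p. point_of (ch p) ` ball (coord (ch p) p) (r p)"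
  have sub: "ball (coord (ch p) p) (r p) \<subseteq> U (ch p)" if "p \<in> P" for p
    using P(4)[OF that] ball_subset_cball by blast
  have N1: "?N p \<in> sets Borel_M" if "p \<in> P" for p
    by (rule openin_sets[OF openin_point_of_image[OF P(2)[OF that] open_ball sub[OF that]]])
  have N2: "?N p \<subseteq> dom_of (ch p)" if "p \<in> P" for p
    by (rule image_subsetI, rule point_of_in) (rule subsetD[OF sub[OF that]])
  have fin: "emeasure vol (?N p) < \<infinity>" if p: "p \<in> P" for p
  proof -
    let ?B = "cball (coord (ch p) p) (r p)"
    have "continuous_on ?B (rho (ch p))"
      using continuous_on_subset[OF continuous_rho[OF P(2)[OF p]] P(4)[OF p]] .
    then have "bounded (rho (ch p) ` ?B)"
      by (rule compact_imp_bounded[OF compact_continuous_image[OF _ compact_cball]])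
    then obtain K where K': "\<And>y. y \<in> rho (ch p) ` ?B \<Longrightarrow> norm y \<le> K" unfolding bounded_iff by blast
    have K: "rho (ch p) x \<le> K" if "x \<in> ?B" for x
      using K'[OF imageI[OF that]] by (simp only: real_norm_def abs_le_iff)
    have "coord (ch p) ` ?N p = ball (coord (ch p) p) (r p)"
      unfolding image_image using sub[OF p] by (subst image_cong[OF refl, of _ _ id]) auto
    then have "emeasure vol (?N p) = (\<integral>\<^sup>+x. ennreal (rho (ch p) x) * indicator (ball (coord (ch p) p) (r p)) x \<partial>lborel)"
      using emeasure_vol[OF P(2)[OF p] N1[OF p] N2[OF p]] by (simp add: chart_volume_def)
    also have "\<dots> \<le> (\<integral>\<^sup>+x. ennreal K * indicator ?B x \<partial>lborel)"
      using K by (intro nn_integral_mono) (auto simp: indicator_def intro!: ennreal_leI)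
    also have "\<dots> = ennreal K * emeasure lborel ?B" by (simp add: nn_integral_cmult_indicator)
    also have "\<dots> < \<infinity>" using emeasure_lborel_cball_finite[of "coord (ch p) p" "r p"]
      by (simp add: ennreal_mult_less_top del: emeasure_lborel_cball_finite)
    finally show ?thesis .
  qed
  have "emeasure vol (topspace M) \<le> (\<Sum>p\<in>P. emeasure vol (?N p))"
    unfolding P(5) using N1 P(1) by (intro emeasure_subadditive_finite) (auto simp: sets_vol)
  also have "\<dots> < \<infinity>" using fin P(1) by simp
  finally show "emeasure vol (space vol) \<noteq> \<infinity>" by (simp add: space_vol)
qed

lemma continuous_map_integrable:
  assumes F: "continuous_map M euclideanreal F" shows "integrable vol F"
proof -
  interpret finite_measure vol by (rule finite_measure_vol)
  have "F \<in> borel_measurable Borel_M"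
  proof (rule borel_measurableI)
    fix V :: "real set" assume "open V"
    then have "openin M {p \<in> topspace M. F p \<in> V}" using F unfolding continuous_map_def by auto
    moreover have "{p \<in> topspace M. F p \<in> V} = F -` V \<inter> space Borel_M" by (auto simp: space_Borel_M)
    ultimately show "F -` V \<inter> space Borel_M \<in> sets Borel_M" using openin_sets by metis
  qed
  then have m: "F \<in> borel_measurable vol" by (simp add: measurable_cong_sets[OF sets_vol refl])
  have "compactin euclideanreal (F ` topspace M)"
    using image_compactin[OF _ F] compact by (simp add: compact_space_def)
  then have "bounded (F ` topspace M)" by (simp add: compact_imp_bounded)
  then obtain K where "\<And>p. p \<in> topspace M \<Longrightarrow> norm (F p) \<le> K" unfolding bounded_iff by blast
  then show ?thesis
    by (intro integrable_const_bound[where B = K, OF _ m] AE_I2) (simp add: space_vol)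
qed

lemma continuous_map_chartwise:
  assumes F: "\<And>c. c \<in> A \<Longrightarrow> continuous_on (U c) (\<lambda>x. F (point_of c x))"
  shows "continuous_map M euclideanreal (F :: 'a \<Rightarrow> real)"
  unfolding continuous_map_def
proof (intro conjI allI impI)
  fix V :: "real set" assume "openin euclideanreal V"
  then have V: "open V" by simp
  let ?N = "\<lambda>c. point_of c ` (U c \<inter> (\<lambda>x. F (point_of c x)) -` V)"
  have "openin M (?N c)" if "c \<in> A" for c
    using F[OF that] open_U[OF that] V
    by (intro openin_point_of_image[OF that] continuous_open_preimage) auto
  then have "openin M (\<Union>c\<in>A. ?N c)" by blast
  moreover have "{p \<in> topspace M. F p \<in> V} = (\<Union>c\<in>A. ?N c)"
  proof (intro set_eqI iffI)
    fix p assume "p \<in> {p \<in> topspace M. F p \<in> V}"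
    then have p: "p \<in> topspace M" "F p \<in> V" by auto
    obtain c where c: "c \<in> A" "p \<in> dom_of c" using p(1) unfolding topspace_eq by blast
    then have "coord c p \<in> U c \<inter> (\<lambda>x. F (point_of c x)) -` V" using p(2) by simp
    then have "point_of c (coord c p) \<in> ?N c" by (rule imageI)
    then show "p \<in> (\<Union>c\<in>A. ?N c)" using c by auto
  next
    fix p assume "p \<in> (\<Union>c\<in>A. ?N c)"
    then obtain c x where "c \<in> A" "x \<in> U c" "F (point_of c x) \<in> V" "p = point_of c x" by blast
    then show "p \<in> {p \<in> topspace M. F p \<in> V}"
      using point_of_in[of x c] dom_subset[of c] by blast
  qed
  ultimately show "openin M {p \<in> topspace M. F p \<in> V}" by simp
qed auto

end


section \<open>The divergence theorem\<close>

lemma continuous_support_integrable: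
  fixes w :: "'a::euclidean_space \<Rightarrow> real"
  assumes "continuous_on UNIV w" "\<And>x. norm x > R \<Longrightarrow> w x = 0"
  shows "integrable lborel w"
proof -
  have "integrable lborel (\<lambda>x. indicator (cball 0 R) x *\<^sub>R w x)"
    by (rule borel_integrable_compact[OF compact_cball continuous_on_subset[OF assms(1) subset_UNIV]])
  moreover have "(\<lambda>x. indicator (cball 0 R) x *\<^sub>R w x) = w"
    using assms(2) by (auto simp: fun_eq_iff indicator_def not_le)
  ultimately show ?thesis by simp
qed

lemma integral_pd_eq_0:
  fixes w :: "real ^ 'n \<Rightarrow> real"
  assumes w: "Ck_on 1 UNIV w" and supp: "\<And>x. norm x > R \<Longrightarrow> w x = 0"
  shows "integrable lborel (pd i w)" and "(LINT x|lborel. pd i w x) = 0"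
proof -
  have d: "w differentiable (at x)" for x using w by (simp add: Ck_on_Suc_pd)
  have cw: "continuous_on UNIV w" using w by (rule Ck_on_continuous)
  have cpd: "continuous_on UNIV (pd i w)" using w by (simp add: Ck_on_Suc_pd)
  have supp': "pd i w x = 0" if "norm x > R" for x
  proof -
    have "open {x :: real ^ 'n. norm x > R}" by (intro open_Collect_less continuous_intros)
    then have "pd i w x = pd i (\<lambda>y. 0) x"
      using that supp by (intro pd_cong) auto
    then show ?thesis by simp
  qed
  show ipd: "integrable lborel (pd i w)" by (rule continuous_support_integrable[OF cpd supp'])
  have "bounded (pd i w ` cball 0 R)"
    by (intro compact_imp_bounded compact_continuous_image compact_cball continuous_on_subset[OF cpd]) simp
  then obtain B0 where B0: "\<And>y. y \<in> pd i w ` cball 0 R \<Longrightarrow> norm y \<le> B0" unfolding bounded_iff by blast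
  define B where "B = max 0 B0"
  have B: "\<bar>pd i w x\<bar> \<le> B" for x
  proof (cases "norm x > R")
    case False
    then have "norm (pd i w x) \<le> B0" by (intro B0 imageI) simp
    then show ?thesis by (simp add: B_def)
  qed (simp add: supp' B_def)
  txt \<open>The difference quotients \<open>q n\<close> have integral zero by translation invariance of Lebesgue measure.\<close>
  define h where "h n = inverse (real (Suc n))" for n
  have h: "0 < h n" "h n \<le> 1" for n by (simp_all add: h_def inverse_le_1_iff)
  have h0: "h \<longlonglongrightarrow> 0" unfolding h_def[abs_def] by (rule LIMSEQ_inverse_real_of_nat)
  define q where "q n x = (w (x + h n *\<^sub>R axis i 1) - w x) / h n" for n x
  have der: "((\<lambda>s. w (x + s *\<^sub>R axis i 1)) has_real_derivative pd i w (x + s *\<^sub>R axis i 1)) (at s)" for x s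
    by (rule pd_line) (rule d)
  have lim: "(\<lambda>n. q n x) \<longlonglongrightarrow> pd i w x" for x
  proof -
    have "((\<lambda>t. (w (x + t *\<^sub>R axis i 1) - w x) / t) \<longlongrightarrow> pd i w x) (at 0)"
      using der[of x 0] by (simp add: DERIV_def)
    moreover have "filterlim h (at 0) sequentially"
      using h0 h(1) by (auto simp: filterlim_at intro!: always_eventually less_imp_neq[THEN not_sym])
    ultimately show ?thesis unfolding q_def by (rule filterlim_compose)
  qed
  \<comment> \<open>By the mean value theorem a difference quotient is a value of the derivative, so
    one bound \<open>B\<close> serves all \<open>n\<close>.\<close>
  have bnd: "\<bar>q n x\<bar> \<le> B" for n x
  proof -
    obtain z where "w (x + h n *\<^sub>R axis i 1) - w (x + 0 *\<^sub>R axis i 1) = (h n - 0) * pd i w (x + z *\<^sub>R axis i 1)"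
      using MVT2[OF h(1)[of n], of "\<lambda>s. w (x + s *\<^sub>R axis i 1)" "\<lambda>s. pd i w (x + s *\<^sub>R axis i 1)"] der by blast
    then have "q n x = pd i w (x + z *\<^sub>R axis i 1)" using h(1)[of n] by (simp add: q_def)
    then show ?thesis using B by simp
  qed
  \<comment> \<open>The steps \<open>h n\<close> are at most 1, so radius \<open>R + 1\<close>
    contains the support of every quotient; \<open>B\<close> on that ball is the dominating
    function.\<close>
  have suppq: "q n x = 0" if "norm x > R + 1" for n x
  proof -
    have "norm x \<le> norm (x + h n *\<^sub>R axis i 1) + norm (h n *\<^sub>R axis i 1 :: real ^ 'n)"
      using norm_triangle_ineq4[of "x + h n *\<^sub>R axis i 1" "h n *\<^sub>R axis i 1"] by simp
    moreover have "norm (h n *\<^sub>R axis i 1 :: real ^ 'n) \<le> 1" using h[of n] by simp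
    ultimately show ?thesis using that by (simp add: q_def supp)
  qed
  have [measurable]: "w \<in> borel_measurable borel" "pd i w \<in> borel_measurable borel"
    using cw cpd borel_measurable_continuous_onI by blast+
  have "(\<lambda>n. LINT x|lborel. q n x) \<longlonglongrightarrow> (LINT x|lborel. pd i w x)"
  proof (rule integral_dominated_convergence)
    show "integrable lborel (\<lambda>x :: real ^ 'n. indicator (cball 0 (R + 1)) x *\<^sub>R B)"
      by (rule borel_integrable_compact[OF compact_cball continuous_on_const])
    show "AE x in lborel. norm (q n x) \<le> indicator (cball 0 (R + 1)) x *\<^sub>R B" for n
      using bnd suppq by (intro AE_I2) (auto simp: indicator_def not_le)
    show "q n \<in> borel_measurable lborel" for n unfolding q_def[abs_def] by measurable
    show "AE x in lborel. (\<lambda>n. q n x) \<longlonglongrightarrow> pd i w x" using lim by simp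
  qed simp
  moreover have "(LINT x|lborel. q n x) = 0" for n
  proof -
    have iw: "integrable lborel w" by (rule continuous_support_integrable[OF cw supp])
    have ds: "distr lborel borel (\<lambda>x. h n *\<^sub>R axis i 1 + x) = (lborel :: (real ^ 'n) measure)"
      using lborel_distr_plus[of "h n *\<^sub>R axis i 1 :: real ^ 'n"] by simp
    have m: "(\<lambda>x :: real ^ 'n. h n *\<^sub>R axis i 1 + x) \<in> measurable lborel borel" by simp
    have iw': "integrable lborel (\<lambda>x. w (h n *\<^sub>R axis i 1 + x))"
      using integrable_distr[OF m, of w] iw unfolding ds by simp
    have "(LINT x|lborel. w (h n *\<^sub>R axis i 1 + x)) = (LINT x|lborel. w x)"
      using integral_distr[OF m, of w] unfolding ds by simp
    then have "(LINT x|lborel. w (h n *\<^sub>R axis i 1 + x) - w x) = 0"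
      using iw iw' by simp
    then show ?thesis unfolding q_def by (simp add: add.commute)
  qed
  ultimately have "(\<lambda>n. 0) \<longlonglongrightarrow> (LINT x|lborel. pd i w x)" by simp
  from LIMSEQ_unique[OF this tendsto_const] show "(LINT x|lborel. pd i w x) = 0" .
qed

text \<open>Extended by zero, \<open>v\<close> is of class C1 on the whole space: it is so on
  \<open>U\<close> and, being zero, on the complement of \<open>K\<close>, and these two open sets
  cover everything.\<close>

lemma integral_pd_eq_0_on:
  fixes v :: "real ^ 'n \<Rightarrow> real"
  assumes U: "open U" and v: "Ck_on 1 U v" and K: "compact K" "K \<subseteq> U" and supp: "\<And>x. x \<in> U - K \<Longrightarrow> v x = 0"
  shows "integrable lborel (\<lambda>x. indicator U x * pd i v x)"
    and "(LINT x|lborel. indicator U x * pd i v x) = 0"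
proof -
  define w where "w x = (if x \<in> U then v x else 0)" for x
  have oK: "open (- K)" using K(1) compact_imp_closed open_Compl by blast
  have "Ck_on 1 U w" using Ck_on_cong[OF U, of w v] v by (simp add: w_def)
  moreover have w0: "w x = 0" if "x \<in> - K" for x using supp that by (auto simp: w_def)
  then have "Ck_on 1 (- K) w" using Ck_on_cong[OF oK, of w "\<lambda>x. 0"] Ck_on_const by blast
  ultimately have "Ck_on 1 (U \<union> - K) w" using U oK by (rule Ck_on_open_Un)
  moreover have "U \<union> - K = UNIV" using K(2) by blast
  ultimately have w: "Ck_on 1 UNIV w" by simp
  obtain R where R: "\<And>x. x \<in> K \<Longrightarrow> norm x \<le> R"
    using compact_imp_bounded[OF K(1)] unfolding bounded_iff by blast
  have supp': "w x = 0" if "norm x > R" for x using R[of x] w0[of x] that by force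
  have eq: "indicator U x * pd i v x = pd i w x" for x
  proof (cases "x \<in> U")
    case True
    then show ?thesis using pd_cong[OF U True, of w v] by (simp add: w_def)
  next
    case False
    then have "x \<in> - K" using K(2) by blast
    then show ?thesis using pd_cong[OF oK, of x w "\<lambda>y. 0" i] w0 False by simp
  qed
  show "integrable lborel (\<lambda>x. indicator U x * pd i v x)" "(LINT x|lborel. indicator U x * pd i v x) = 0"
    unfolding eq using integral_pd_eq_0[OF w supp'] by blast+
qed

section \<open>Bump functions and a partition of unity\<close>

lemma Ck_on_nth: "Ck_on k S (\<lambda>x :: real ^ 'n. x $ i)"
proof (cases k)
  case (Suc j)
  have der: "((\<lambda>x :: real ^ 'n. x $ i) has_derivative (\<lambda>v. v $ i)) (at x)" for x
    by (rule bounded_linear.has_derivative[OF bounded_linear_vec_nth has_derivative_ident])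
  then have "pd l (\<lambda>x :: real ^ 'n. x $ i) = (\<lambda>x. axis l 1 $ i)" for l
    by (simp add: fun_eq_iff pd_eqI[OF der])
  then show ?thesis using der Suc by (auto simp: Ck_on_Suc_pd Ck_on_const differentiable_def)
qed (simp add: continuous_on_component continuous_on_id)

text \<open>Bump functions of class \<open>C\<^sup>1\<close> suffice for a partition of unity, since the divergence
  theorem differentiates them only once.\<close>

definition bump :: "real ^ 'n \<Rightarrow> real \<Rightarrow> real ^ 'n \<Rightarrow> real" where
  "bump a r x = (max 0 (r\<^sup>2 - (\<Sum>i\<in>UNIV. (x $ i - a $ i) * (x $ i - a $ i))))\<^sup>2"

text \<open>The definition spells out a polynomial, to which the \<open>Ck_on\<close> closure rules
  apply; supports are read off from the distance.\<close>

lemma bump_eq: "bump a r x = (max 0 (r\<^sup>2 - (dist a x)\<^sup>2))\<^sup>2"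
proof -
  have "(\<Sum>i\<in>UNIV. (x $ i - a $ i) * (x $ i - a $ i)) = (dist a x)\<^sup>2"
    by (simp add: dist_norm power2_norm_eq_inner inner_vec_def algebra_simps)
  then show ?thesis by (simp add: bump_def)
qed

lemma bump_nonneg: "bump a r x \<ge> 0"
  by (simp add: bump_def)

lemma bump_pos: "dist a x < r \<Longrightarrow> bump a r x > 0"
  using power_strict_mono[of "dist a x" r 2] by (simp add: bump_eq)

lemma bump_eq_0: "0 < r \<Longrightarrow> x \<notin> cball a r \<Longrightarrow> bump a r x = 0"
  using power_mono[of r "dist a x" 2] by (simp add: bump_eq)

text \<open>Squaring the positive part removes its corner at 0, which makes \<open>bump\<close>
  continuously differentiable across the boundary of the ball.\<close>

lemma DERIV_max_0_power2: "((\<lambda>t::real. (max 0 t)\<^sup>2) has_real_derivative 2 * max 0 t) (at t)"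
proof -
  consider "t < 0" | "t > 0" | "t = 0" by linarith
  then show ?thesis
  proof cases
    case 1
    have "((\<lambda>t::real. 0) has_real_derivative 0) (at t)" by simp
    then have "((\<lambda>t::real. (max 0 t)\<^sup>2) has_real_derivative 0) (at t)"
      by (rule has_field_derivative_transform_within[where d = "- t"]) (use 1 in \<open>auto simp: dist_real_def\<close>)
    then show ?thesis using 1 by simp
  next
    case 2
    have "((\<lambda>t::real. t\<^sup>2) has_real_derivative 2 * t) (at t)" by (auto intro!: derivative_eq_intros)
    then have "((\<lambda>t::real. (max 0 t)\<^sup>2) has_real_derivative 2 * t) (at t)"
      by (rule has_field_derivative_transform_within[where d = t]) (use 2 in \<open>auto simp: dist_real_def\<close>)
    then show ?thesis using 2 by simp
  next
    case 3
    have "((\<lambda>s::real. ((max 0 s)\<^sup>2 - (max 0 0)\<^sup>2) / s) \<longlongrightarrow> 0) (at 0)"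
    proof (rule tendsto_sandwich[of "\<lambda>s. 0" _ _ "\<lambda>s. \<bar>s\<bar>"])
      have "0 \<le> (max 0 s)\<^sup>2 / s \<and> (max 0 s)\<^sup>2 / s \<le> \<bar>s\<bar>" for s :: real
        by (cases "s > 0") (auto simp: max_def power2_eq_square)
      then show "\<forall>\<^sub>F s in at 0. 0 \<le> ((max 0 s)\<^sup>2 - (max 0 (0::real))\<^sup>2) / s"
        "\<forall>\<^sub>F s in at 0. ((max 0 s)\<^sup>2 - (max 0 (0::real))\<^sup>2) / s \<le> \<bar>s\<bar>"
        by (auto intro!: always_eventually)
      show "((\<lambda>s::real. \<bar>s\<bar>) \<longlongrightarrow> 0) (at 0)" using tendsto_rabs_zero[OF tendsto_ident_at] .
    qed simp
    then show ?thesis using 3 by (simp add: DERIV_def)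
  qed
qed

lemma Ck_on_bump: "Ck_on 1 UNIV (bump a r)"
proof -
  let ?u = "\<lambda>x :: real ^ 'a. r\<^sup>2 - (\<Sum>i\<in>UNIV. (x $ i - a $ i) * (x $ i - a $ i))"
  have u: "Ck_on 1 UNIV ?u"
    by (intro Ck_on_diff Ck_on_sum Ck_on_mult Ck_on_const Ck_on_nth open_UNIV)
  have du: "(?u has_derivative frechet_derivative ?u (at x)) (at x)" for x
    using u frechet_derivative_works by (auto simp: Ck_on_Suc_pd)
  have der: "(bump a r has_derivative (\<lambda>v. 2 * max 0 (?u x) * frechet_derivative ?u (at x) v)) (at x)" for x
    unfolding bump_def[abs_def]
    using has_derivative_compose[OF du DERIV_max_0_power2[unfolded has_field_derivative_def]] .
  have "pd i (bump a r) = (\<lambda>x. 2 * max 0 (?u x) * pd i ?u x)" for i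
    using pd_eqI[OF der] by (simp add: fun_eq_iff pd_def)
  moreover have "continuous_on UNIV (\<lambda>x. 2 * max 0 (?u x) * pd i ?u x)" for i
    using u Ck_on_continuous[OF u]
    by (intro continuous_on_mult continuous_on_const continuous_on_max) (auto simp: Ck_on_Suc_pd)
  ultimately show ?thesis using der by (auto simp: Ck_on_Suc_pd differentiable_def)
qed

context compact_riemannian
begin

lemma continuous_map_point_of:
  assumes c: "c \<in> A" shows "continuous_map (top_of_set (U c)) M (point_of c)"
  unfolding continuous_map_def
proof (intro conjI allI impI)
  show "point_of c \<in> topspace (top_of_set (U c)) \<rightarrow> topspace M"
    using point_of_coord[OF c] dom_subset[OF c] by auto
  fix V assume "openin M V"
  then have "open (coord c ` (V \<inter> dom_of c))"
    by (intro open_coord_image c openin_Int openin_dom) auto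
  moreover have "{x \<in> topspace (top_of_set (U c)). point_of c x \<in> V} = coord c ` (V \<inter> dom_of c)"
    using vimage_point_of[OF c, of V] by auto
  ultimately show "openin (top_of_set (U c)) {x \<in> topspace (top_of_set (U c)). point_of c x \<in> V}"
    by (simp add: open_subset image_mono)
qed

text \<open>Hausdorffness enters here: compact sets are closed, so the set off the support of a
  cut-off function is open in every chart.\<close>

lemma closedin_point_of_image:
  assumes c: "c \<in> A" and K: "compact K" "K \<subseteq> U c" shows "closedin M (point_of c ` K)"
proof -
  have "compactin (top_of_set (U c)) K" using K by (simp add: compactin_subtopology)
  then have "compactin M (point_of c ` K)"
    using image_compactin continuous_map_point_of[OF c] by blast
  then show ?thesis using compactin_imp_closedin Hausdorff by blast
qed

lemma open_coord_image_Diff: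
  assumes c: "c \<in> A" and d: "d \<in> A" and K: "compact K" "K \<subseteq> U c"
  shows "open (coord d ` (dom_of d - point_of c ` K))"
  using closedin_point_of_image[OF c K] openin_dom[OF d]
  by (intro open_coord_image[OF d] openin_diff) auto

definition chart_bump :: "('a, 'n) chart \<Rightarrow> real ^ 'n \<Rightarrow> real \<Rightarrow> 'a \<Rightarrow> real" where
  "chart_bump c a r q = (if q \<in> dom_of c then bump a r (coord c q) else 0)"

lemma chart_bump_eq_0:
  assumes c: "c \<in> A" "0 < r" "q \<notin> point_of c ` cball a r" shows "chart_bump c a r q = 0"
proof (cases "q \<in> dom_of c")
  case True
  then have "q = point_of c (coord c q)" using c(1) by simp
  then have "coord c q \<notin> cball a r" using c(3) by blast
  then have "bump a r (coord c q) = 0" by (rule bump_eq_0[OF c(2)])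
  then show ?thesis by (simp add: chart_bump_def)
qed (simp add: chart_bump_def)

text \<open>In the chart \<open>d\<close> two open sets cover: the overlap with \<open>c\<close>,
  where the function is \<open>bump\<close> after the transition map, and the complement of the
  closed ball, where it is zero.\<close>

lemma Ck_on_chart_bump:
  assumes c: "c \<in> A" and d: "d \<in> A" and r: "0 < r" "cball a r \<subseteq> U c"
  shows "Ck_on 1 (U d) (chart_bump c a r \<circ> point_of d)"
proof -
  let ?T = "coord d ` (dom_of d - point_of c ` cball a r)"
  have oT: "open ?T" by (rule open_coord_image_Diff[OF c d compact_cball r(2)])
  have oW: "open (W d c)" by (rule open_W[OF d c])
  have C: "Ck_on 1 (W d c) (\<lambda>x. bump a r (transition d c x))"
  proof (rule Ck_on_compose[where u = "bump a r" and \<phi> = "transition d c", OF oW _ subset_UNIV Ck_on_bump])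
    show "Ck_on 1 (W d c) (\<lambda>y. transition d c y $ j)" for j
      using smooth_transition[OF d c, of j] unfolding smooth_on_def by blast
  qed
  have eq: "bump a r (transition d c x) = (chart_bump c a r \<circ> point_of d) x" if x: "x \<in> W d c" for x
  proof -
    obtain q where q: "q \<in> dom_of d" "q \<in> dom_of c" "x = coord d q" using x by blast
    then show ?thesis using transition_coord[OF d q(1)] d by (simp add: chart_bump_def)
  qed
  have 1: "Ck_on 1 (W d c) (chart_bump c a r \<circ> point_of d)"
    using C by (rule iffD1[OF Ck_on_cong[OF oW], rotated]) (rule eq)
  have "0 = (chart_bump c a r \<circ> point_of d) x" if x: "x \<in> ?T" for x
  proof -
    obtain q where q: "q \<in> dom_of d" "q \<notin> point_of c ` cball a r" "x = coord d q" using x by blast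
    then show ?thesis using chart_bump_eq_0[OF c r(1) q(2)] d by simp
  qed
  then have 2: "Ck_on 1 ?T (chart_bump c a r \<circ> point_of d)"
    using iffD1[OF Ck_on_cong[OF oT, of "\<lambda>x. 0" "chart_bump c a r \<circ> point_of d" 1] Ck_on_const] by blast
  have "point_of c ` cball a r \<subseteq> dom_of c" by (rule image_subsetI, rule point_of_in) (rule subsetD[OF r(2)])
  then have "W d c \<union> ?T = U d" by blast
  then show ?thesis using Ck_on_open_Un[OF 1 2 oW oT] by simp
qed

text \<open>Chart bumps divided by their sum, which is positive because the open balls
  cover.\<close>

lemma partition_of_unity:
  "\<exists>P ch K \<eta>. finite P \<and>
     (\<forall>p\<in>P. ch p \<in> A \<and> compact (K p) \<and> K p \<subseteq> U (ch p)
        \<and> (\<forall>q. q \<notin> point_of (ch p) ` K p \<longrightarrow> \<eta> p q = 0)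
        \<and> (\<forall>d\<in>A. Ck_on 1 (U d) (\<eta> p \<circ> point_of d))) \<and>
     (\<forall>q\<in>topspace M. (\<Sum>p\<in>(P :: 'a set). \<eta> p q) = 1)"
proof -
  obtain P ch r where cov: "ball_cover P ch r" using ex_ball_cover by blast
  note P = ball_coverD[OF cov]
  define b where "b p = chart_bump (ch p) (coord (ch p) p) (r p)" for p
  define s where "s q = (\<Sum>p\<in>P. b p q)" for q
  have b: "Ck_on 1 (U d) (b p \<circ> point_of d)" if "p \<in> P" "d \<in> A" for p d
    unfolding b_def by (rule Ck_on_chart_bump[OF P(2)[OF that(1)] that(2) P(3)[OF that(1)] P(4)[OF that(1)]])
  have b0: "b p q \<ge> 0" for p q by (simp add: b_def chart_bump_def bump_nonneg)
  have s: "s q > 0" if q: "q \<in> topspace M" for q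
  proof -
    obtain p x where p: "p \<in> P" and x: "x \<in> ball (coord (ch p) p) (r p)" "q = point_of (ch p) x"
      using q P(5) by blast
    have xU: "x \<in> U (ch p)" using P(4)[OF p] x(1) ball_subset_cball by blast
    have "q \<in> dom_of (ch p)" "coord (ch p) q = x"
      unfolding x(2) by (rule point_of_in[OF xU], rule coord_point_of[OF xU])
    then have "b p q > 0" using x(1) by (simp add: b_def chart_bump_def bump_pos)
    then show ?thesis unfolding s_def using P(1) p b0 by (intro sum_pos2[of P p]) auto
  qed
  have Cs: "Ck_on 1 (U d) (\<lambda>x. \<Sum>p\<in>P. (b p \<circ> point_of d) x)" if "d \<in> A" for d
    by (rule Ck_on_sum[OF open_U[OF that]]) (rule b[OF _ that])
  have "Ck_on 1 (U d) ((\<lambda>q. b p q / s q) \<circ> point_of d)" if p: "p \<in> P" and d: "d \<in> A" for p d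
  proof -
    have "Ck_on 1 (U d) (\<lambda>x. (b p \<circ> point_of d) x / (\<Sum>p\<in>P. (b p \<circ> point_of d) x))"
    proof (rule Ck_on_divide[OF open_U[OF d] b[OF p d] Cs[OF d]])
      fix x assume "x \<in> U d"
      then have "point_of d x \<in> topspace M" by (intro subsetD[OF dom_subset[OF d]] point_of_in)
      then show "(\<Sum>p\<in>P. (b p \<circ> point_of d) x) \<noteq> 0" using s[of "point_of d x"] by (simp add: s_def)
    qed
    then show ?thesis by (simp add: s_def o_def)
  qed
  moreover have "b p q / s q = 0" if "p \<in> P" "q \<notin> point_of (ch p) ` cball (coord (ch p) p) (r p)" for p q
    using chart_bump_eq_0[OF P(2)[OF that(1)] P(3)[OF that(1)] that(2)] by (simp add: b_def)
  moreover have "(\<Sum>p\<in>P. b p q / s q) = 1" if "q \<in> topspace M" for q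
    using s[OF that] by (simp add: sum_divide_distrib[symmetric] s_def[symmetric])
  ultimately show ?thesis
    using P by (intro exI[of _ P] exI[of _ ch] exI[of _ "\<lambda>p. cball (coord (ch p) p) (r p)"]
        exI[of _ "\<lambda>p q. b p q / s q"]) (simp add: compact_cball)
qed

end


section \<open>Integration of divergences over the manifold\<close>

context compact_riemannian
begin

abbreviation "chart_div Z c x \<equiv> trace (metric_patch.nab g c (Z c) x)"

text \<open>Invariance makes \<open>at_point\<close> denote; continuity then makes the resulting
  function integrable on the compact manifold.\<close>

definition scalar_field :: "(('a, 'n) chart \<Rightarrow> real ^ 'n \<Rightarrow> real) \<Rightarrow> bool" where
  "scalar_field s \<longleftrightarrow> invariant s \<and> (\<forall>c\<in>A. continuous_on (U c) (s c))"

lemma at_point_chart: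
  assumes "invariant s" "c \<in> A" "x \<in> U c" shows "at_point A s (point_of c x) = s c x"
  using at_point_eq[OF assms(1,2) point_of_in[OF assms(3)]] coord_point_of[OF assms(3)] by simp

lemma continuous_map_scalar_field:
  assumes s: "scalar_field s" shows "continuous_map M euclideanreal (at_point A s)"
proof (rule continuous_map_chartwise)
  fix c assume c: "c \<in> A"
  have "invariant s" "continuous_on (U c) (s c)" using s c unfolding scalar_field_def by blast+
  then show "continuous_on (U c) (\<lambda>x. at_point A s (point_of c x))"
    using at_point_chart[OF _ c, of s] by (simp cong: continuous_on_cong)
qed

lemma integrable_scalar_field: "scalar_field s \<Longrightarrow> integrable vol (at_point A s)"
  by (rule continuous_map_integrable) (rule continuous_map_scalar_field)

lemma continuous_map_smooth_fun: "smooth_fun A u \<Longrightarrow> continuous_map M euclideanreal u"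
proof (rule continuous_map_chartwise)
  fix c assume "smooth_fun A u" "c \<in> A"
  then have "smooth_on (U c) (u \<circ> point_of c)" unfolding smooth_fun_def by blast
  then show "continuous_on (U c) (\<lambda>x. u (point_of c x))"
    using smooth_on_continuous unfolding o_def by blast
qed

lemma integrable_mult_scalar_field:
  assumes u: "smooth_fun A u" and s: "scalar_field s"
  shows "integrable vol (\<lambda>p. u p * at_point A s p)"
  by (intro continuous_map_integrable continuous_map_real_mult continuous_map_smooth_fun[OF u]
      continuous_map_scalar_field[OF s])

text \<open>The divergence is half the trace of the Lie derivative of the metric, from which it
  inherits independence of the chart.\<close>

lemma scalar_field_chart_div:
  assumes Z: "vector_field A Z" shows "scalar_field (chart_div Z)"
  unfolding scalar_field_def
proof (intro conjI ballI)
  have eq: "chart_div Z c x = tensor_trace g c x (lie_metric Z g c x) / 2" if "c \<in> A" "x \<in> U c" for c x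
    using metric_patch.tensor_trace_lie_metric[OF metric_patch[OF that(1)] that(2), of Z] by simp
  show "invariant (chart_div Z)"
    unfolding invariant_def
  proof (intro ballI)
    fix c d p assume cd: "c \<in> A" "d \<in> A" "p \<in> dom_of c \<inter> dom_of d"
    then show "chart_div Z c (coord c p) = chart_div Z d (coord d p)"
      using invariantD[OF invariant_tensor_trace[OF tensor_field_lie_metric[OF Z]] cd(1,2), of p]
      by (simp add: eq)
  qed
  fix c assume c: "c \<in> A"
  interpret c: metric_patch g c "U c" by (rule metric_patch[OF c])
  have Zc: "smooth_on (U c) (\<lambda>y. Z c y $ b)" for b using Z c unfolding vector_field_def by blast
  have "smooth_on (U c) (\<lambda>y. c.Gam i y $ b $ a)" for i a b
    using c.smooth_Gam[of i] unfolding smooth_matrix_def by blast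
  then have "smooth_on (U c) (\<lambda>x. trace (c.nab (Z c) x))"
    unfolding trace_def c.nab_def vec_lambda_beta
    by (intro smooth_on_sum smooth_on_add smooth_on_mult smooth_on_pd Zc c.open_U)
  then show "continuous_on (U c) (\<lambda>x. trace (c.nab (Z c) x))" by (rule smooth_on_continuous)
qed

abbreviation "along \<eta> Z c x \<equiv> (\<Sum>i\<in>UNIV. Z c x $ i * pd i (\<eta> \<circ> point_of c) x)"

lemma scalar_field_along:
  assumes Z: "vector_field A Z" and eta: "\<And>d. d \<in> A \<Longrightarrow> Ck_on 1 (U d) (\<eta> \<circ> point_of d)"
  shows "scalar_field (along \<eta> Z)"
  unfolding scalar_field_def
proof (intro conjI ballI)
  show "invariant (along \<eta> Z)"
    unfolding invariant_def
  proof (intro ballI)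
    fix c d p assume cd: "c \<in> A" "d \<in> A" and p: "p \<in> dom_of c \<inter> dom_of d"
    have "(\<eta> \<circ> point_of d) differentiable (at (coord d p))"
      using eta[OF cd(2)] p by (simp add: Ck_on_Suc_pd)
    then have pd: "pd i (\<eta> \<circ> point_of c) (coord c p)
      = (\<Sum>a\<in>UNIV. Jac c d (coord c p) $ a $ i *\<^sub>R pd a (\<eta> \<circ> point_of d) (coord d p))" for i
      using p cd by (intro pd_transition) auto
    have Zd: "Z d (coord d p) $ a = (\<Sum>i\<in>UNIV. Jac c d (coord c p) $ a $ i * Z c (coord c p) $ i)" for a
      using vector_field_transform[OF Z cd, of p] p by (simp add: matrix_vector_mult_def)
    show "along \<eta> Z c (coord c p) = along \<eta> Z d (coord d p)"
      unfolding pd Zd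
      by (simp add: sum_distrib_left sum_distrib_right mult_ac) (rule sum.swap)
  qed
  fix c assume c: "c \<in> A"
  have "continuous_on (U c) (\<lambda>y. Z c y $ b)" for b
    using Z c smooth_on_continuous unfolding vector_field_def by blast
  moreover have "continuous_on (U c) (pd i (\<eta> \<circ> point_of c))" for i
    using eta[OF c] by (simp add: Ck_on_Suc_pd)
  ultimately show "continuous_on (U c) (along \<eta> Z c)"
    by (intro continuous_on_sum continuous_on_mult)
qed

text \<open>\<open>F\<close> is the divergence of \<eta> Z, expanded by the Leibniz rule because
  \<eta> is only of class C1, whereas \<open>vector_field\<close> demands smooth components.\<close>

lemma integral_localized_divergence:
  assumes Z: "vector_field A Z" and c: "c \<in> A" and K: "compact K" "K \<subseteq> U c"
    and supp: "\<And>q. q \<notin> point_of c ` K \<Longrightarrow> \<eta> q = 0"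
    and eta: "\<And>d. d \<in> A \<Longrightarrow> Ck_on 1 (U d) (\<eta> \<circ> point_of d)"
  defines "F \<equiv> \<lambda>q. \<eta> q * at_point A (chart_div Z) q + at_point A (along \<eta> Z) q"
  shows "integrable vol F" "(LINT q|vol. F q) = 0"
proof -
  interpret c: metric_patch g c "U c" by (rule metric_patch[OF c])
  note sD = scalar_field_chart_div[OF Z] and sE = scalar_field_along[OF Z eta]
  have iD: "invariant (chart_div Z)" and iE: "invariant (along \<eta> Z)"
    using sD sE unfolding scalar_field_def by blast+
  have ceta: "continuous_map M euclideanreal \<eta>"
    by (rule continuous_map_chartwise) (use Ck_on_continuous[OF eta] in \<open>simp add: o_def\<close>)
  have contF: "continuous_map M euclideanreal F"
    unfolding F_def
    by (intro continuous_map_add continuous_map_real_mult ceta continuous_map_scalar_field sD sE)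
  show iF: "integrable vol F" by (rule continuous_map_integrable[OF contF])
  \<comment> \<open>Outside the chart \<eta> vanishes on a whole neighbourhood of \<open>q\<close>,
    so its derivatives at \<open>q\<close> vanish as well.\<close>
  have F0: "F q = 0" if q: "q \<in> topspace M - dom_of c" for q
  proof -
    obtain d where d: "d \<in> A" "q \<in> dom_of d" using q unfolding topspace_eq by blast
    let ?T = "coord d ` (dom_of d - point_of c ` K)"
    have oT: "open ?T" by (rule open_coord_image_Diff[OF c d(1) K])
    have "point_of c ` K \<subseteq> dom_of c" by (rule image_subsetI, rule point_of_in) (rule subsetD[OF K(2)])
    then have nK: "q \<notin> point_of c ` K" using q by blast
    then have qT: "coord d q \<in> ?T" using d(2) by blast
    have "(\<eta> \<circ> point_of d) y = 0" if y: "y \<in> ?T" for y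
    proof -
      obtain q' where q': "q' \<in> dom_of d" "q' \<notin> point_of c ` K" "y = coord d q'" using y by blast
      then show ?thesis using supp[OF q'(2)] d(1) by simp
    qed
    then have "pd i (\<eta> \<circ> point_of d) (coord d q) = 0" for i
      using pd_cong[OF oT qT, of "\<eta> \<circ> point_of d" "\<lambda>y. 0" i] by simp
    then show ?thesis
      using supp[OF nK] at_point_eq[OF iE d] by (simp add: F_def)
  qed
  \<comment> \<open>Components of \<eta> Z times the volume density: the sum of their partial
    derivatives is the weighted divergence.\<close>
  let ?v = "\<lambda>i y. rho c y * ((\<eta> \<circ> point_of c) y * Z c y $ i)"
  have Zc: "Ck_on k (U c) (\<lambda>y. Z c y $ b)" for b k
    using Z c unfolding vector_field_def smooth_on_def by blast
  have Cv: "Ck_on 1 (U c) (?v i)" for i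
    by (intro Ck_on_mult c.open_U c.Ck_on_sqrt_det eta[OF c] Zc)
  have v0: "?v i x = 0" if x: "x \<in> U c - K" for i x
  proof -
    have "point_of c x \<notin> point_of c ` K"
    proof
      assume "point_of c x \<in> point_of c ` K"
      then obtain y where y: "y \<in> K" "point_of c x = point_of c y" by blast
      then have "coord c (point_of c x) = coord c (point_of c y)" by simp
      then have "x = y" using x y(1) K(2) coord_point_of[of x c] coord_point_of[of y c] by auto
      then show False using x y(1) by blast
    qed
    then show ?thesis using supp by simp
  qed
  have eq: "rho c x * F (point_of c x) = (\<Sum>i\<in>UNIV. pd i (?v i) x)" if x: "x \<in> U c" for x
  proof -
    have du: "(\<eta> \<circ> point_of c) differentiable (at x)"
      by (rule Ck_on_1_differentiable[OF eta[OF c] x])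
    have dZ: "(\<lambda>y. Z c y $ b) differentiable (at x)" for b
      by (rule Ck_on_1_differentiable[OF Zc x])
    have d: "(\<lambda>y. ((\<eta> \<circ> point_of c) y *\<^sub>R Z c y) $ b) differentiable (at x)" for b
      using differentiable_mult[OF du dZ] by simp
    have "F (point_of c x) = trace (c.nab (\<lambda>y. (\<eta> \<circ> point_of c) y *\<^sub>R Z c y) x)"
      unfolding F_def at_point_chart[OF iD c x] at_point_chart[OF iE c x] c.trace_nab_scaleR[OF du dZ] by simp
    then show ?thesis using c.divergence_weighted[OF x d] by simp
  qed
  have "(LINT q|vol. F q) = (LINT x|lborel. indicator (U c) x * (rho c x * F (point_of c x)))"
    using borel_measurable_integrable[OF iF] F0 by (rule integral_chart[OF c])
  also have "\<dots> = (LINT x|lborel. (\<Sum>i\<in>UNIV. indicator (U c) x * pd i (?v i) x))"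
    using eq by (intro Bochner_Integration.integral_cong refl) (auto simp: indicator_def)
  also have "\<dots> = (\<Sum>i\<in>UNIV. (LINT x|lborel. indicator (U c) x * pd i (?v i) x))"
    by (rule Bochner_Integration.integral_sum) (rule integral_pd_eq_0_on(1)[OF c.open_U Cv K v0])
  also have "\<dots> = 0"
    by (intro sum.neutral ballI) (rule integral_pd_eq_0_on(2)[OF c.open_U Cv K v0])
  finally show "(LINT q|vol. F q) = 0" .
qed

text \<open>Summing the localized divergences over the partition of unity leaves div Z alone: the
  derivatives of its members along \<open>Z\<close> add up to the derivative of the constant
  1.\<close>

theorem integral_divergence:
  assumes Z: "vector_field A Z" shows "(LINT q|vol. at_point A (chart_div Z) q) = 0"
proof -
  obtain P :: "'a set" and ch K \<eta> where fin: "finite P"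
    and all: "\<forall>p\<in>P. ch p \<in> A \<and> compact (K p) \<and> K p \<subseteq> U (ch p)
        \<and> (\<forall>q. q \<notin> point_of (ch p) ` K p \<longrightarrow> \<eta> p q = 0)
        \<and> (\<forall>d\<in>A. Ck_on 1 (U d) (\<eta> p \<circ> point_of d))"
    and one: "\<forall>q\<in>topspace M. (\<Sum>p\<in>P. \<eta> p q) = 1"
    using partition_of_unity by blast
  have P: "ch p \<in> A" "compact (K p)" "K p \<subseteq> U (ch p)" "\<And>q. q \<notin> point_of (ch p) ` K p \<Longrightarrow> \<eta> p q = 0"
    "\<And>d. d \<in> A \<Longrightarrow> Ck_on 1 (U d) (\<eta> p \<circ> point_of d)" if "p \<in> P" for p
    using all that by blast+
  define F where "F p q = \<eta> p q * at_point A (chart_div Z) q + at_point A (along (\<eta> p) Z) q" for p q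
  have F: "integrable vol (F p)" "(LINT q|vol. F p q) = 0" if "p \<in> P" for p
    unfolding F_def[abs_def] using integral_localized_divergence[OF Z P[OF that]] by blast+
  have "(\<Sum>p\<in>P. F p q) = at_point A (chart_div Z) q" if q: "q \<in> topspace M" for q
  proof -
    obtain c where c: "c \<in> A" "q \<in> dom_of c" using q unfolding topspace_eq by blast
    have x: "coord c q \<in> U c" using c(2) by blast
    have E: "at_point A (along (\<eta> p) Z) q = along (\<eta> p) Z c (coord c q)" if "p \<in> P" for p
      using scalar_field_along[OF Z P(5)[OF that]] at_point_eq[OF _ c] unfolding scalar_field_def by blast
    have d: "(\<eta> p \<circ> point_of c) differentiable (at (coord c q))" if "p \<in> P" for p
      by (rule Ck_on_1_differentiable[OF P(5)[OF that c(1)] x])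
    have "(\<Sum>p\<in>P. pd i (\<eta> p \<circ> point_of c) (coord c q)) = 0" for i
    proof -
      have "(\<Sum>p\<in>P. pd i (\<eta> p \<circ> point_of c) (coord c q)) = pd i (\<lambda>y. \<Sum>p\<in>P. (\<eta> p \<circ> point_of c) y) (coord c q)"
        by (rule pd_sum[symmetric]) (rule d)
      also have "\<dots> = pd i (\<lambda>y. 1) (coord c q)"
      proof (rule pd_cong[OF open_U[OF c(1)] x])
        fix y assume "y \<in> U c"
        then have "point_of c y \<in> topspace M" by (intro subsetD[OF dom_subset[OF c(1)]] point_of_in)
        then show "(\<Sum>p\<in>P. (\<eta> p \<circ> point_of c) y) = 1" using one by simp
      qed
      finally show ?thesis by simp
    qed
    then have "(\<Sum>p\<in>P. along (\<eta> p) Z c (coord c q)) = 0"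
      by (subst sum.swap) (simp add: sum_distrib_left[symmetric])
    then show ?thesis
      using one q E by (simp add: F_def sum.distrib sum_distrib_right[symmetric])
  qed
  then have "(LINT q|vol. at_point A (chart_div Z) q) = (LINT q|vol. (\<Sum>p\<in>P. F p q))"
    by (intro Bochner_Integration.integral_cong refl) (simp add: space_vol)
  also have "\<dots> = (\<Sum>p\<in>P. (LINT q|vol. F p q))" by (rule Bochner_Integration.integral_sum) (rule F(1))
  also have "\<dots> = 0" using F(2) by simp
  finally show ?thesis .
qed

end


section \<open>Integral formulas for the soliton\<close>

lemma tensor_inner_bilinear:
  "tensor_inner g c x (S + S') T = tensor_inner g c x S T + tensor_inner g c x S' T"
  "tensor_inner g c x S (T + T') = tensor_inner g c x S T + tensor_inner g c x S T'"
  "tensor_inner g c x (S - S') T = tensor_inner g c x S T - tensor_inner g c x S' T"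
  "tensor_inner g c x S (T - T') = tensor_inner g c x S T - tensor_inner g c x S T'"
  "tensor_inner g c x (k *\<^sub>R S) T = k * tensor_inner g c x S T"
  "tensor_inner g c x S (k *\<^sub>R T) = k * tensor_inner g c x S T"
  by (simp_all add: tensor_inner_def sum.distrib sum_subtractf sum_distrib_left algebra_simps)

lemma (in metric_patch) tensor_inner_commute:
  assumes x: "x \<in> U" shows "tensor_inner g c x S T = tensor_inner g c x T S"
proof -
  have "trace (S ** H x ** transpose T ** H x) = trace (transpose (S ** H x ** transpose T ** H x))"
    by (simp add: trace_def transpose_nth)
  also have "\<dots> = trace (H x ** (T ** H x ** transpose S))"
    by (simp add: matrix_transpose_mul sym_ginv[OF x] matrix_mul_assoc)
  also have "\<dots> = trace (T ** H x ** transpose S ** H x)" by (rule trace_mul_sym)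
  finally show ?thesis by (simp add: tensor_inner_eq[OF x])
qed

context compact_riemannian
begin

text \<open>For a value known in advance: agreement of the charts at the single point
  \<open>q\<close> is enough.\<close>

lemma at_point_eqI:
  assumes "q \<in> topspace M" "\<And>c. c \<in> A \<Longrightarrow> q \<in> dom_of c \<Longrightarrow> s c (coord c q) = r"
  shows "at_point A s q = r"
  unfolding at_point_def
proof (rule the_equality)
  show "\<forall>c\<in>A. q \<in> dom_of c \<longrightarrow> s c (coord c q) = r" using assms(2) by blast
  obtain c where "c \<in> A" "q \<in> dom_of c" using assms(1) unfolding topspace_eq by blast
  then show "r' = r" if "\<forall>c\<in>A. q \<in> dom_of c \<longrightarrow> s c (coord c q) = r'" for r'
    using that assms(2) by metis
qed

lemma scalar_field_tensor_inner:
  assumes "tensor_field S" "tensor_field T"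
  shows "scalar_field (\<lambda>c x. tensor_inner g c x (S c x) (T c x))"
  unfolding scalar_field_def
proof (intro conjI ballI)
  show "invariant (\<lambda>c x. tensor_inner g c x (S c x) (T c x))" by (rule invariant_tensor_inner[OF assms])
  fix c assume c: "c \<in> A"
  interpret c: metric_patch g c "U c" by (rule metric_patch[OF c])
  have S: "smooth_on (U c) (\<lambda>x. S c x $ i $ j)" and T: "smooth_on (U c) (\<lambda>x. T c x $ i $ j)" for i j
    using assms c unfolding tensor_field_def smooth_matrix_def by blast+
  show "continuous_on (U c) (\<lambda>x. tensor_inner g c x (S c x) (T c x))"
    unfolding tensor_inner_def
    by (intro smooth_on_continuous smooth_on_sum smooth_on_mult c.smooth_on_ginv S T c.open_U)
qed

text \<open>The Hessian is half the Lie derivative of the metric along the gradient, so its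
  transformation law is already known.\<close>

lemma tensor_field_hessian:
  assumes f: "smooth_fun A f" shows "tensor_field (hessian g f)"
  unfolding tensor_field_def
proof (intro conjI ballI)
  have fc: "smooth_on (U c) (f \<circ> point_of c)" if "c \<in> A" for c using f that unfolding smooth_fun_def by blast
  show "smooth_matrix (U c) (hessian g f c)" if "c \<in> A" for c
    by (rule metric_patch.smooth_hessian[OF metric_patch[OF that] fc[OF that]])
  have eq: "hessian g f c x = (1 / 2) *\<^sub>R lie_metric (gradient g f) g c x" if "c \<in> A" "x \<in> U c" for c x
    using metric_patch.lie_metric_gradient[OF metric_patch[OF that(1)] fc[OF that(1)] that(2)] by simp
  fix c d p assume cd: "c \<in> A" "d \<in> A" and p: "p \<in> dom_of c \<inter> dom_of d"
  have "lie_metric (gradient g f) g c (coord c p)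
    = transpose (Jac c d (coord c p)) ** lie_metric (gradient g f) g d (coord d p) ** Jac c d (coord c p)"
    using tensor_field_lie_metric[OF vector_field_gradient[OF f]] cd p unfolding tensor_field_def by blast
  then show "hessian g f c (coord c p)
    = transpose (Jac c d (coord c p)) ** hessian g f d (coord d p) ** Jac c d (coord c p)"
    using p by (simp add: eq cd matrix_mult_linear)
qed

end

section \<open>Consequences of the soliton equation for the Ricci tensor and its divergence\<close>

locale soliton = compact_riemannian M A g
  for M :: "'a topology" and A :: "('a, 'n::finite) chart set" and g :: "('a, 'n) tfield" +
  fixes \<xi> Y :: "('a, 'n) vfield" and h lam f :: "'a \<Rightarrow> real" and \<rho> :: real
  assumes soliton: "h_almost_RB_soliton M A g \<xi> h lam \<rho>"
    and hodge: "hodge_decomposition M A g \<xi> f Y"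
begin

abbreviation "R \<equiv> scalar_curvature A g"
abbreviation "grad_f \<equiv> gradient g f"
abbreviation "Hess \<equiv> hessian g f"
abbreviation "Lie_Y \<equiv> lie_metric Y g"

lemma smooth_fun_f: "smooth_fun A f" and vector_field_Y: "vector_field A Y"
  and vector_field_xi: "vector_field A \<xi>" and smooth_fun_h: "smooth_fun A h"
  using soliton hodge unfolding h_almost_RB_soliton_def hodge_decomposition_def by blast+

lemma smooth_on_f: "c \<in> A \<Longrightarrow> smooth_on (U c) (f \<circ> point_of c)"
  using smooth_fun_f unfolding smooth_fun_def by blast

lemma vector_field_grad_f: "vector_field A grad_f"
  by (rule vector_field_gradient[OF smooth_fun_f])

lemma vector_field_smooth: "vector_field A X \<Longrightarrow> c \<in> A \<Longrightarrow> smooth_on (U c) (\<lambda>y. X c y $ b)"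
  unfolding vector_field_def by blast

lemma vector_field_differentiable:
  "vector_field A X \<Longrightarrow> c \<in> A \<Longrightarrow> x \<in> U c \<Longrightarrow> (\<lambda>y. X c y $ b) differentiable (at x)"
  by (rule smooth_on_differentiable[OF vector_field_smooth])

lemma xi_eq: "c \<in> A \<Longrightarrow> x \<in> U c \<Longrightarrow> \<xi> c x = grad_f c x + Y c x"
  using hodge unfolding hodge_decomposition_def by blast

lemma lie_metric_xi:
  assumes c: "c \<in> A" and x: "x \<in> U c"
  shows "lie_metric \<xi> g c x = 2 *\<^sub>R Hess c x + Lie_Y c x"
proof -
  interpret c: metric_patch g c "U c" by (rule metric_patch[OF c])
  have "c.nab (\<xi> c) x = c.nab (\<lambda>y. grad_f c y + Y c y) x"
    unfolding c.nab_def xi_eq[OF c x] using pd_cong[OF c.open_U x, of "\<lambda>y. \<xi> c y $ _" "\<lambda>y. (grad_f c y + Y c y) $ _"]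
    by (simp add: vec_eq_iff xi_eq[OF c])
  also have "\<dots> = c.nab (grad_f c) x + c.nab (Y c) x"
    by (intro c.nab_add vector_field_differentiable vector_field_grad_f vector_field_Y c x)
  finally have "lie_metric \<xi> g c x = lie_metric grad_f g c x + Lie_Y c x"
    by (simp add: c.lie_metric_eq[OF x] matrix_mult_linear transpose_linear)
  then show ?thesis by (simp add: c.lie_metric_gradient[OF smooth_on_f[OF c] x])
qed

abbreviation "\<mu> q \<equiv> lam q + \<rho> * R q"

lemma ricci_eq_lie:
  assumes "c \<in> A" "q \<in> dom_of c"
  shows "ricci g c (coord c q) = \<mu> q *\<^sub>R g c (coord c q) - (h q / 2) *\<^sub>R lie_metric \<xi> g c (coord c q)"
proof -
  have "ricci g c (coord c q) + (h q / 2) *\<^sub>R lie_metric \<xi> g c (coord c q) = \<mu> q *\<^sub>R g c (coord c q)"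
    using soliton assms unfolding h_almost_RB_soliton_def by blast
  then show ?thesis by (simp add: eq_diff_eq)
qed

lemma ricci_eq:
  assumes "c \<in> A" "q \<in> dom_of c"
  shows "ricci g c (coord c q) = \<mu> q *\<^sub>R g c (coord c q) - h q *\<^sub>R Hess c (coord c q) - (h q / 2) *\<^sub>R Lie_Y c (coord c q)"
  unfolding ricci_eq_lie[OF assms] lie_metric_xi[OF assms(1) imageI[OF assms(2)]]
  by (simp add: scaleR_add_right)

text \<open>The soliton equation expresses the Ricci tensor through tensor fields, so its behaviour under
  changes of charts need not be computed from the Christoffel symbols.\<close>

lemma tensor_field_ricci: "tensor_field (ricci g)"
  unfolding tensor_field_def
proof (intro conjI ballI)
  show "smooth_matrix (U c) (ricci g c)" if "c \<in> A" for c
    by (rule metric_patch.smooth_ricci[OF metric_patch[OF that]])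
  fix c d q assume cd: "c \<in> A" "d \<in> A" and q: "q \<in> dom_of c \<inter> dom_of d"
  have "lie_metric \<xi> g c (coord c q)
    = transpose (Jac c d (coord c q)) ** lie_metric \<xi> g d (coord d q) ** Jac c d (coord c q)"
    using tensor_field_lie_metric[OF vector_field_xi] cd q unfolding tensor_field_def by blast
  moreover have "g c (coord c q) = transpose (Jac c d (coord c q)) ** g d (coord d q) ** Jac c d (coord c q)"
    using metric_transform[OF cd] q by blast
  ultimately show "ricci g c (coord c q)
    = transpose (Jac c d (coord c q)) ** ricci g d (coord d q) ** Jac c d (coord c q)"
    using ricci_eq_lie[OF cd(1)] ricci_eq_lie[OF cd(2)] q by (simp add: matrix_mult_linear)
qed

text \<open>Symmetry is read off from the soliton equation, where the metric and its Lie derivative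
  are symmetric. It supplies the hypothesis of the contracted Bianchi identity.\<close>

lemma transpose_ricci:
  assumes c: "c \<in> A" and x: "x \<in> U c" shows "transpose (ricci g c x) = ricci g c x"
proof -
  interpret c: metric_patch g c "U c" by (rule metric_patch[OF c])
  obtain q where q: "q \<in> dom_of c" "x = coord c q" using x by blast
  show ?thesis
    using c.sym_g[OF x] c.transpose_lie_metric[OF x] unfolding q(2)
    by (simp add: ricci_eq_lie[OF c q(1)] transpose_linear)
qed

lemma R_eq: "c \<in> A \<Longrightarrow> x \<in> U c \<Longrightarrow> R (point_of c x) = tensor_trace g c x (ricci g c x)"
  unfolding scalar_curvature_def
  by (rule at_point_chart[OF invariant_tensor_trace[OF tensor_field_ricci]])

lemma R_eq_Ric_up: "c \<in> A \<Longrightarrow> x \<in> U c \<Longrightarrow> R (point_of c x) = trace (metric_patch.Ric_up g c x)"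
  using R_eq metric_patch.tensor_trace_eq[OF metric_patch] metric_patch.Ric_up_def[OF metric_patch] by metis

lemma smooth_fun_R: "smooth_fun A R"
  unfolding smooth_fun_def
proof
  fix c assume c: "c \<in> A"
  interpret c: metric_patch g c "U c" by (rule metric_patch[OF c])
  have "smooth_on (U c) (\<lambda>x. trace (c.Ric_up x))"
    unfolding trace_def using c.smooth_Ric_up
    by (intro smooth_on_sum c.open_U) (simp add: smooth_matrix_def)
  then show "smooth_on (U c) (R \<circ> point_of c)"
    by (rule iffD2[OF smooth_on_cong[OF c.open_U], rotated]) (simp add: R_eq_Ric_up[OF c])
qed

definition Ric_field :: "('a, 'n) vfield \<Rightarrow> ('a, 'n) vfield" where
  "Ric_field X c x = metric_patch.Ric_up g c x *v X c x"

definition R_field :: "('a, 'n) vfield \<Rightarrow> ('a, 'n) vfield" where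
  "R_field X c x = (R \<circ> point_of c) x *\<^sub>R X c x"

lemma vector_field_Ric_field:
  assumes X: "vector_field A X" shows "vector_field A (Ric_field X)"
  unfolding vector_field_def
proof (intro conjI ballI allI)
  fix c i assume c: "c \<in> A"
  interpret c: metric_patch g c "U c" by (rule metric_patch[OF c])
  have "smooth_on (U c) (\<lambda>x. c.Ric_up x $ i $ j)" for j
    using c.smooth_Ric_up unfolding smooth_matrix_def by blast
  then show "smooth_on (U c) (\<lambda>x. Ric_field X c x $ i)"
    unfolding Ric_field_def matrix_vector_mult_def vec_lambda_beta
    by (intro smooth_on_sum smooth_on_mult vector_field_smooth[OF X c] c.open_U)
next
  fix c d p assume cd: "c \<in> A" "d \<in> A" and p: "p \<in> dom_of c \<inter> dom_of d"
  interpret c: metric_patch g c "U c" by (rule metric_patch[OF cd(1)])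
  interpret d: metric_patch g d "U d" by (rule metric_patch[OF cd(2)])
  have "ricci g c (coord c p) = transpose (Jac c d (coord c p)) ** ricci g d (coord d p) ** Jac c d (coord c p)"
    using tensor_field_ricci cd p unfolding tensor_field_def by blast
  then show "Ric_field X d (coord d p) = jacobian (transition c d) (at (coord c p)) *v Ric_field X c (coord c p)"
    using p ginv_transform[OF cd, of p] vector_field_transform[OF X cd, of p]
      jacobian_transition[OF cd, of "coord c p"]
    by (simp add: Ric_field_def c.Ric_up_def d.Ric_up_def matrix_vector_mul_assoc matrix_mul_assoc)
qed

lemma vector_field_R_field:
  assumes X: "vector_field A X" shows "vector_field A (R_field X)"
  unfolding vector_field_def
proof (intro conjI ballI allI)
  fix c i assume c: "c \<in> A"
  have "smooth_on (U c) (R \<circ> point_of c)" using smooth_fun_R c unfolding smooth_fun_def by blast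
  then show "smooth_on (U c) (\<lambda>x. R_field X c x $ i)"
    unfolding R_field_def vector_scaleR_component real_scaleR_def
    by (intro smooth_on_mult vector_field_smooth[OF X c] open_U[OF c])
next
  fix c d p assume cd: "c \<in> A" "d \<in> A" and p: "p \<in> dom_of c \<inter> dom_of d"
  then show "R_field X d (coord d p) = jacobian (transition c d) (at (coord c p)) *v R_field X c (coord c p)"
    using vector_field_transform[OF X cd, of p] jacobian_transition[OF cd, of "coord c p"]
    by (simp add: R_field_def matrix_vector_mult_scaleR)
qed

lemma chart_div_Ric_field:
  assumes X: "vector_field A X" and c: "c \<in> A" and x: "x \<in> U c"
  shows "chart_div (Ric_field X) c x
    = along R X c x / 2 + tensor_inner g c x (ricci g c x) (lie_metric X g c x) / 2"
proof -
  interpret c: metric_patch g c "U c" by (rule metric_patch[OF c])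
  have "pd b (\<lambda>y. trace (c.Ric_up y)) x = pd b (R \<circ> point_of c) x" for b
    by (rule pd_cong[OF c.open_U x]) (simp add: R_eq_Ric_up[OF c])
  then show ?thesis
    using c.divergence_Ric_up[where X = X, OF x transpose_ricci[OF c] vector_field_smooth[OF X c]]
    by (simp add: Ric_field_def[abs_def])
qed

lemma chart_div_R_field:
  assumes X: "vector_field A X" and c: "c \<in> A" and x: "x \<in> U c"
  shows "chart_div (R_field X) c x = along R X c x + R (point_of c x) * chart_div X c x"
proof -
  interpret c: metric_patch g c "U c" by (rule metric_patch[OF c])
  have "(R \<circ> point_of c) differentiable (at x)"
    using smooth_fun_R c x smooth_on_differentiable unfolding smooth_fun_def by blast
  from c.trace_nab_scaleR[OF this vector_field_differentiable[OF X c x]] show ?thesis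
    by (simp add: R_field_def[abs_def])
qed

lemma chart_div_Y:
  assumes c: "c \<in> A" and x: "x \<in> U c" shows "chart_div Y c x = 0"
proof -
  have qc: "point_of c x \<in> dom_of c" by (rule point_of_in[OF x])
  then have q: "point_of c x \<in> topspace M" using dom_subset[OF c] by blast
  have inv: "invariant (chart_div Y)"
    using scalar_field_chart_div[OF vector_field_Y] unfolding scalar_field_def by blast
  have "divergence A g Y (point_of c x) = chart_div Y c x"
    unfolding divergence_def
  proof (rule at_point_eqI[OF q])
    fix d assume d: "d \<in> A" "point_of c x \<in> dom_of d"
    show "(\<Sum>i\<in>UNIV. pderiv_at i (\<lambda>y. Y d y $ i) (coord d (point_of c x))
        + (\<Sum>k\<in>UNIV. christoffel g d (coord d (point_of c x)) i i k * Y d (coord d (point_of c x)) $ k))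
      = chart_div Y c x"
      unfolding metric_patch.divergence_eq_trace_nab[OF metric_patch[OF d(1)]]
      using invariantD[OF inv d(1) c d(2) qc] coord_point_of[OF x] by simp
  qed
  moreover have "divergence A g Y (point_of c x) = 0"
    using hodge q unfolding hodge_decomposition_def by blast
  ultimately show ?thesis by simp
qed

section \<open>Pointwise identities and their integrals\<close>

abbreviation "dR X q \<equiv> at_point A (along R X) q"
abbreviation "div_Ric X q \<equiv> at_point A (chart_div (Ric_field X)) q"
abbreviation "div_R X q \<equiv> at_point A (chart_div (R_field X)) q"
abbreviation "HH q \<equiv> at_point A (\<lambda>c x. tensor_inner g c x (Hess c x) (Hess c x)) q"
abbreviation "HL q \<equiv> at_point A (\<lambda>c x. tensor_inner g c x (Hess c x) (Lie_Y c x)) q"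
abbreviation "LL q \<equiv> at_point A (\<lambda>c x. tensor_inner g c x (Lie_Y c x) (Lie_Y c x)) q"
abbreviation "lap q \<equiv> laplacian A g f q"

lemma scalar_fields:
  shows "vector_field A X \<Longrightarrow> scalar_field (along R X)"
    and "scalar_field (\<lambda>c x. tensor_inner g c x (Hess c x) (Lie_Y c x))"
    and "scalar_field (\<lambda>c x. tensor_inner g c x (Lie_Y c x) (Lie_Y c x))"
proof -
  show "scalar_field (along R X)" if "vector_field A X"
    using that smooth_fun_R by (intro scalar_field_along) (auto simp only: smooth_fun_def smooth_on_def)
qed (intro scalar_field_tensor_inner tensor_field_hessian smooth_fun_f tensor_field_lie_metric vector_field_Y)+

text \<open>The pairings among the metric, the Hessian and the Lie derivative along
  \<open>Y\<close>, which occur in every bilinear expansion below. Those of the latter with the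
  metric vanish because div Y = 0, and the formula for \<open>R q\<close> is the trace of the
  soliton equation.\<close>

lemma values_at:
  assumes q: "c \<in> A" "q \<in> dom_of c"
  defines "x \<equiv> coord c q"
  shows "tensor_inner g c x (g c x) (g c x) = real CARD('n)"
    and "tensor_inner g c x (Hess c x) (g c x) = lap q" "tensor_inner g c x (g c x) (Hess c x) = lap q"
    and "tensor_inner g c x (Lie_Y c x) (g c x) = 0" "tensor_inner g c x (g c x) (Lie_Y c x) = 0"
    and "tensor_inner g c x (Hess c x) (Hess c x) = HH q"
    and "tensor_inner g c x (Hess c x) (Lie_Y c x) = HL q" "tensor_inner g c x (Lie_Y c x) (Hess c x) = HL q"
    and "tensor_inner g c x (Lie_Y c x) (Lie_Y c x) = LL q"
    and "R q = real CARD('n) * \<mu> q - h q * lap q"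
    and "ricci g c x = \<mu> q *\<^sub>R g c x - h q *\<^sub>R Hess c x - (h q / 2) *\<^sub>R Lie_Y c x"
proof -
  interpret c: metric_patch g c "U c" by (rule metric_patch[OF q(1)])
  have x: "x \<in> U c" unfolding x_def using q(2) by blast
  note tH = tensor_field_hessian[OF smooth_fun_f] and tL = tensor_field_lie_metric[OF vector_field_Y]
  note at = at_point_eq[OF _ q, folded x_def, symmetric]
  show gg: "tensor_inner g c x (g c x) (g c x) = real CARD('n)"
    by (simp add: c.tensor_inner_g[OF x] c.tensor_trace_g[OF x])
  show Hg: "tensor_inner g c x (Hess c x) (g c x) = lap q"
    unfolding c.tensor_inner_g[OF x] laplacian_def by (rule at[OF invariant_tensor_trace[OF tH]])
  then show "tensor_inner g c x (g c x) (Hess c x) = lap q" using c.tensor_inner_commute[OF x] by simp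
  show Lg: "tensor_inner g c x (Lie_Y c x) (g c x) = 0"
    unfolding c.tensor_inner_g[OF x] c.tensor_trace_lie_metric[OF x] chart_div_Y[OF q(1) x] by simp
  then show "tensor_inner g c x (g c x) (Lie_Y c x) = 0" using c.tensor_inner_commute[OF x] by simp
  show "tensor_inner g c x (Hess c x) (Hess c x) = HH q" by (rule at[OF invariant_tensor_inner[OF tH tH]])
  show HL: "tensor_inner g c x (Hess c x) (Lie_Y c x) = HL q" by (rule at[OF invariant_tensor_inner[OF tH tL]])
  then show "tensor_inner g c x (Lie_Y c x) (Hess c x) = HL q" using c.tensor_inner_commute[OF x] by simp
  show "tensor_inner g c x (Lie_Y c x) (Lie_Y c x) = LL q" by (rule at[OF invariant_tensor_inner[OF tL tL]])
  show ric: "ricci g c x = \<mu> q *\<^sub>R g c x - h q *\<^sub>R Hess c x - (h q / 2) *\<^sub>R Lie_Y c x"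
    unfolding x_def by (rule ricci_eq[OF q])
  have "R q = tensor_inner g c x (ricci g c x) (g c x)"
    using R_eq[OF q(1) x] q by (simp add: x_def c.tensor_inner_g[OF x[unfolded x_def]])
  then show "R q = real CARD('n) * \<mu> q - h q * lap q"
    unfolding ric by (simp add: tensor_inner_bilinear gg Hg Lg mult.commute)
qed

text \<open>With \<open>H\<close> and \<open>L\<close> as in the overview, the second value is the
  square of the norm of h H + (h/2) L; the mixed term is \<open>HL\<close> with the full Hessian
  because \<open>L\<close> is orthogonal to the metric.\<close>

lemma pointwise_values:
  assumes q: "q \<in> topspace M"
  shows "at_point A (\<lambda>c x. (tensor_norm g c x (Hess c x - (lap q / real CARD('n)) *\<^sub>R g c x))\<^sup>2) q = HH q - (lap q)\<^sup>2 / real CARD('n)"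
    and "at_point A (\<lambda>c x. (tensor_norm g c x (ricci g c x - (R q / real CARD('n)) *\<^sub>R g c x))\<^sup>2) q
      = (h q)\<^sup>2 * (HH q - (lap q)\<^sup>2 / real CARD('n)) + (h q)\<^sup>2 * HL q + (h q)\<^sup>2 / 4 * LL q"
    and "at_point A (\<lambda>c x. (tensor_norm g c x (Lie_Y c x))\<^sup>2) q = LL q"
    and "at_point A (\<lambda>c x. vec_inner g c x (gradient g R c x) (X c x)) q = dR X q"
proof -
  have n0: "real CARD('n) \<noteq> 0" by simp
  have x: "coord c q \<in> U c" if "q \<in> dom_of c" for c :: "('a, 'n) chart" using that by blast
  have norm: "(tensor_norm g c (coord c q) T)\<^sup>2 = tensor_inner g c (coord c q) T T"
    if "c \<in> A" "q \<in> dom_of c" for c T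
    by (rule metric_patch.tensor_norm_power2[OF metric_patch[OF that(1)] x[OF that(2)]])
  show "at_point A (\<lambda>c x. (tensor_norm g c x (Hess c x - (lap q / real CARD('n)) *\<^sub>R g c x))\<^sup>2) q = HH q - (lap q)\<^sup>2 / real CARD('n)"
  proof (rule at_point_eqI[OF q])
    fix c assume c: "c \<in> A" "q \<in> dom_of c"
    show "(tensor_norm g c (coord c q) (Hess c (coord c q) - (lap q / real CARD('n)) *\<^sub>R g c (coord c q)))\<^sup>2 = HH q - (lap q)\<^sup>2 / real CARD('n)"
      unfolding norm[OF c] using n0
      by (simp add: tensor_inner_bilinear values_at(1-9)[OF c] field_simps power2_eq_square)
  qed
  show "at_point A (\<lambda>c x. (tensor_norm g c x (ricci g c x - (R q / real CARD('n)) *\<^sub>R g c x))\<^sup>2) q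
      = (h q)\<^sup>2 * (HH q - (lap q)\<^sup>2 / real CARD('n)) + (h q)\<^sup>2 * HL q + (h q)\<^sup>2 / 4 * LL q"
  proof (rule at_point_eqI[OF q])
    fix c assume c: "c \<in> A" "q \<in> dom_of c"
    let ?x = "coord c q"
    have "\<mu> q - R q / real CARD('n) = h q * lap q / real CARD('n)"
      using n0 values_at(10)[OF c] by (simp add: field_simps)
    moreover have "ricci g c ?x - (R q / real CARD('n)) *\<^sub>R g c ?x
      = (\<mu> q - R q / real CARD('n)) *\<^sub>R g c ?x - h q *\<^sub>R Hess c ?x - (h q / 2) *\<^sub>R Lie_Y c ?x"
      unfolding values_at(11)[OF c] by (simp add: algebra_simps)
    ultimately have T: "ricci g c ?x - (R q / real CARD('n)) *\<^sub>R g c ?x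
      = (h q * lap q / real CARD('n)) *\<^sub>R g c ?x - h q *\<^sub>R Hess c ?x - (h q / 2) *\<^sub>R Lie_Y c ?x" by simp
    show "(tensor_norm g c ?x (ricci g c ?x - (R q / real CARD('n)) *\<^sub>R g c ?x))\<^sup>2
      = (h q)\<^sup>2 * (HH q - (lap q)\<^sup>2 / real CARD('n)) + (h q)\<^sup>2 * HL q + (h q)\<^sup>2 / 4 * LL q"
      unfolding norm[OF c] T using n0
      by (simp add: tensor_inner_bilinear values_at(1-9)[OF c] field_simps power2_eq_square)
  qed
  show "at_point A (\<lambda>c x. (tensor_norm g c x (Lie_Y c x))\<^sup>2) q = LL q"
    by (rule at_point_eqI[OF q]) (simp add: norm values_at)
  have vi: "vec_inner g c (coord c q) (gradient g R c (coord c q)) (X c (coord c q)) = along R X c (coord c q)"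
    if "c \<in> A" "q \<in> dom_of c" for c
    by (rule metric_patch.vec_inner_gradient[OF metric_patch[OF that(1)] x[OF that(2)]])
  \<comment> \<open>\<open>X\<close> is arbitrary here, so charts need not agree. The two definite
    descriptions still coincide, since they describe by the same predicate.\<close>
  have "(\<forall>c\<in>A. q \<in> dom_of c \<longrightarrow> vec_inner g c (coord c q) (gradient g R c (coord c q)) (X c (coord c q)) = r)
    \<longleftrightarrow> (\<forall>c\<in>A. q \<in> dom_of c \<longrightarrow> along R X c (coord c q) = r)" for r
    by (rule ball_cong[OF refl], rule imp_cong[OF refl]) (simp only: vi)
  then show "at_point A (\<lambda>c x. vec_inner g c x (gradient g R c x) (X c x)) q = dR X q"
    unfolding at_point_def by simp
qed

text \<open>In div (R \<nabla>f) / n - div (Ric \<nabla>f) the products of \<open>\<mu> q\<close>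
  with the Laplacian cancel, and \<open>dR grad_f q\<close> is left with the coefficient 1/n - 1/2,
  whose negative is the one in the formula. For \<open>Y\<close>, doubling div (Ric Y) clears the
  factor 1/2, and its \<open>dR Y\<close> term is the divergence of \<open>R Y\<close>.\<close>

lemma pointwise_identities:
  assumes q: "q \<in> topspace M"
  shows "h q * (HH q - (lap q)\<^sup>2 / real CARD('n))
      = (real CARD('n) - 2) / (2 * real CARD('n)) * dR grad_f q - 1 / 2 * (h q * HL q) + (div_R grad_f q / real CARD('n) - div_Ric grad_f q)"
    and "h q * HL q = div_R Y q - 2 * div_Ric Y q - 1 / 2 * (h q * LL q)"
    and "dR Y q = div_R Y q" and "dR \<xi> q = dR grad_f q + dR Y q"
proof -
  obtain c where c: "c \<in> A" "q \<in> dom_of c" using q unfolding topspace_eq by blast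
  interpret c: metric_patch g c "U c" by (rule metric_patch[OF c(1)])
  define x where "x = coord c q"
  have x: "x \<in> U c" and px: "point_of c x = q" unfolding x_def using c by simp_all
  note val = values_at[OF c, folded x_def]
  have at: "at_point A s q = s c x" if "scalar_field s" for s
    using that at_point_eq[OF _ c] unfolding scalar_field_def x_def by blast
  have vr: "dR X q = along R X c x" "div_R X q = dR X q + R q * chart_div X c x"
    "div_Ric X q = dR X q / 2 + tensor_inner g c x (ricci g c x) (lie_metric X g c x) / 2"
    if X: "vector_field A X" for X
    using chart_div_R_field[OF X c(1) x] chart_div_Ric_field[OF X c(1) x]
    by (simp_all add: at[OF scalar_fields(1)[OF X]] at[OF scalar_field_chart_div[OF vector_field_R_field[OF X]]]
        at[OF scalar_field_chart_div[OF vector_field_Ric_field[OF X]]] px)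
  have divf: "chart_div grad_f c x = lap q"
    using c.tensor_trace_lie_metric[OF x, of grad_f] val(2)
    unfolding c.lie_metric_gradient[OF smooth_on_f[OF c(1)] x] c.tensor_inner_g[OF x, symmetric]
    by (simp add: tensor_inner_bilinear)
  have ricH: "tensor_inner g c x (ricci g c x) (Hess c x) = \<mu> q * lap q - h q * HH q - h q / 2 * HL q"
    unfolding val(11) by (simp add: tensor_inner_bilinear val(1-9))
  have ricL: "tensor_inner g c x (ricci g c x) (Lie_Y c x) = - h q * HL q - h q / 2 * LL q"
    unfolding val(11) by (simp add: tensor_inner_bilinear val(1-9))
  have "div_R grad_f q = dR grad_f q + R q * lap q"
    using vr(2)[OF vector_field_grad_f] divf by simp
  then have f1: "div_R grad_f q = dR grad_f q + (real CARD('n) * \<mu> q - h q * lap q) * lap q"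
    by (rule trans) (rule arg_cong[OF val(10)])
  have f2: "div_Ric grad_f q = dR grad_f q / 2 + (\<mu> q * lap q - h q * HH q - h q / 2 * HL q)"
    using vr(3)[OF vector_field_grad_f] ricH
    unfolding c.lie_metric_gradient[OF smooth_on_f[OF c(1)] x] by (simp add: tensor_inner_bilinear)
  \<comment> \<open>The letters stand for \<open>h q\<close>, \<open>HH q\<close>,
    \<open>lap q\<close>, the dimension, \<open>dR grad_f q\<close>, \<open>HL q\<close> and
    \<open>\<mu> q\<close>, in the order \<open>t a d m r b s\<close>.\<close>
  have alg: "t * (a - d\<^sup>2 / m) = (m - 2) / (2 * m) * r - 1 / 2 * (t * b)
      + ((r + (m * s - t * d) * d) / m - (r / 2 + (s * d - t * a - t / 2 * b)))"
    if "m \<noteq> 0" for t a d m r b s :: real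
    using that by (simp add: field_simps power2_eq_square)
  show "h q * (HH q - (lap q)\<^sup>2 / real CARD('n))
      = (real CARD('n) - 2) / (2 * real CARD('n)) * dR grad_f q - 1 / 2 * (h q * HL q) + (div_R grad_f q / real CARD('n) - div_Ric grad_f q)"
    unfolding f1 f2 by (rule alg) simp
  show Y: "dR Y q = div_R Y q"
    using vr(2)[OF vector_field_Y] chart_div_Y[OF c(1) x] by simp
  show "h q * HL q = div_R Y q - 2 * div_Ric Y q - 1 / 2 * (h q * LL q)"
    using vr(3)[OF vector_field_Y] ricL Y by (simp add: field_simps)
  show "dR \<xi> q = dR grad_f q + dR Y q"
    unfolding vr(1)[OF vector_field_xi] vr(1)[OF vector_field_grad_f] vr(1)[OF vector_field_Y]
    by (simp add: xi_eq[OF c(1) x] distrib_right sum.distrib)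
qed

lemma integrals:
  shows "(LINT q|vol. h q * (HH q - (lap q)\<^sup>2 / real CARD('n)))
      = (real CARD('n) - 2) / (2 * real CARD('n)) * (LINT q|vol. dR grad_f q) - 1 / 2 * (LINT q|vol. h q * HL q)"
    and "(LINT q|vol. h q * HL q) = - 1 / 2 * (LINT q|vol. h q * LL q)"
    and "(LINT q|vol. dR \<xi> q) = (LINT q|vol. dR grad_f q)"
    and "(LINT q|vol. h q * (HH q - (lap q)\<^sup>2 / real CARD('n)) + h q * HL q + 1 / 4 * (h q * LL q))
      = (real CARD('n) - 2) / (2 * real CARD('n)) * (LINT q|vol. dR grad_f q)"
proof -
  have dR: "integrable vol (dR X)" if "vector_field A X" for X
    by (rule integrable_scalar_field[OF scalar_fields(1)[OF that]])
  have hHL: "integrable vol (\<lambda>q. h q * HL q)" and hLL: "integrable vol (\<lambda>q. h q * LL q)"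
    by (rule integrable_mult_scalar_field[OF smooth_fun_h scalar_fields(2)],
        rule integrable_mult_scalar_field[OF smooth_fun_h scalar_fields(3)])
  have dvR: "integrable vol (div_R X)" "(LINT q|vol. div_R X q) = 0" if "vector_field A X" for X
    by (rule integrable_scalar_field[OF scalar_field_chart_div[OF vector_field_R_field[OF that]]],
        rule integral_divergence[OF vector_field_R_field[OF that]])
  have dvRic: "integrable vol (div_Ric X)" "(LINT q|vol. div_Ric X q) = 0" if "vector_field A X" for X
    by (rule integrable_scalar_field[OF scalar_field_chart_div[OF vector_field_Ric_field[OF that]]],
        rule integral_divergence[OF vector_field_Ric_field[OF that]])
  note int = dR[OF vector_field_grad_f] hHL hLL dvR[OF vector_field_grad_f] dvR[OF vector_field_Y]
    dvRic[OF vector_field_grad_f] dvRic[OF vector_field_Y] dR[OF vector_field_Y]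
  have cong: "(LINT q|vol. u q) = (LINT q|vol. v q)" if "\<And>q. q \<in> topspace M \<Longrightarrow> u q = v q" for u v :: "'a \<Rightarrow> real"
    using that by (intro Bochner_Integration.integral_cong refl) (simp add: space_vol)
  let ?E = "\<lambda>q. (real CARD('n) - 2) / (2 * real CARD('n)) * dR grad_f q - 1 / 2 * (h q * HL q) + (div_R grad_f q / real CARD('n) - div_Ric grad_f q)"
  have E: "integrable vol ?E"
    "(LINT q|vol. ?E q) = (real CARD('n) - 2) / (2 * real CARD('n)) * (LINT q|vol. dR grad_f q) - 1 / 2 * (LINT q|vol. h q * HL q)"
    using int by simp_all
  show "(LINT q|vol. h q * (HH q - (lap q)\<^sup>2 / real CARD('n)))
      = (real CARD('n) - 2) / (2 * real CARD('n)) * (LINT q|vol. dR grad_f q) - 1 / 2 * (LINT q|vol. h q * HL q)"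
    using cong[OF pointwise_identities(1)] E(2) by simp
  have "(LINT q|vol. h q * HL q) = (LINT q|vol. div_R Y q - 2 * div_Ric Y q - 1 / 2 * (h q * LL q))"
    by (rule cong[OF pointwise_identities(2)])
  also have "\<dots> = - 1 / 2 * (LINT q|vol. h q * LL q)" using int by simp
  finally show HL: "(LINT q|vol. h q * HL q) = - 1 / 2 * (LINT q|vol. h q * LL q)" .
  have "(LINT q|vol. dR Y q) = 0" using cong[OF pointwise_identities(3)] dvR(2)[OF vector_field_Y] by simp
  then show "(LINT q|vol. dR \<xi> q) = (LINT q|vol. dR grad_f q)"
    using cong[OF pointwise_identities(4)] int by simp
  \<comment> \<open>This integrand is the norm squared of the trace-free Ricci tensor over
    \<open>h\<close>. Replacing its first summand by \<open>?E\<close> leaves \<open>HL\<close> with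
    factor 1 - 1/2 = 1/2, and by \<open>HL\<close> = -1/2 \<open>LL\<close> under the integral this
    cancels the 1/4 of \<open>LL\<close>.\<close>
  have "(LINT q|vol. h q * (HH q - (lap q)\<^sup>2 / real CARD('n)) + h q * HL q + 1 / 4 * (h q * LL q))
     = (LINT q|vol. ?E q + h q * HL q + 1 / 4 * (h q * LL q))"
    by (rule cong) (simp only: pointwise_identities(1))
  also have "\<dots> = (LINT q|vol. ?E q) + (LINT q|vol. h q * HL q) + 1 / 4 * (LINT q|vol. h q * LL q)"
    using E(1) hHL hLL by (simp only: Bochner_Integration.integral_add Bochner_Integration.integrable_add
        integrable_mult_right integral_mult_right_zero)
  finally show "(LINT q|vol. h q * (HH q - (lap q)\<^sup>2 / real CARD('n)) + h q * HL q + 1 / 4 * (h q * LL q))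
      = (real CARD('n) - 2) / (2 * real CARD('n)) * (LINT q|vol. dR grad_f q)"
    unfolding E(2) HL by simp
qed

end

theorem proposition3p4:
  fixes M :: "'a topology"
    and A :: "('a, 'n::finite) chart set"
    and g :: "('a, 'n) tfield"
    and \<xi> Y :: "('a, 'n) vfield"
    and h lam f :: "'a \<Rightarrow> real"
    and \<rho> :: real
  assumes "compact_space M"
    and "riemannian_manifold M A g"
    and "h_almost_RB_soliton M A g \<xi> h lam \<rho>"
    and "hodge_decomposition M A g \<xi> f Y"
  shows
    "(LINT p|riemannian_measure M A g. h p * at_point A (\<lambda>c x.
          (tensor_norm g c x
            (hessian g f c x - (laplacian A g f p / real CARD('n)) *\<^sub>R g c x))\<^sup>2) p)
      = (real CARD('n) - 2) / (2 * real CARD('n)) *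
          (LINT p|riemannian_measure M A g. at_point A (\<lambda>c x.
            vec_inner g c x (gradient g (scalar_curvature A g) c x) (gradient g f c x)) p)
        - 1 / 2 * (LINT p|riemannian_measure M A g. h p * at_point A (\<lambda>c x.
            tensor_inner g c x (hessian g f c x) (lie_metric Y g c x)) p)
     \<and>
     (LINT p|riemannian_measure M A g. h p * at_point A (\<lambda>c x.
          (tensor_norm g c x
            (hessian g f c x - (laplacian A g f p / real CARD('n)) *\<^sub>R g c x))\<^sup>2) p)
      = (real CARD('n) - 2) / (2 * real CARD('n)) *
          (LINT p|riemannian_measure M A g. at_point A (\<lambda>c x.
            vec_inner g c x (gradient g (scalar_curvature A g) c x) (gradient g f c x)) p)
        + 1 / 4 * (LINT p|riemannian_measure M A g. h p * at_point A (\<lambda>c x.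
            (tensor_norm g c x (lie_metric Y g c x))\<^sup>2) p)
     \<and>
     ((\<forall>p\<in>topspace M. h p \<noteq> 0) \<longrightarrow>
       (LINT p|riemannian_measure M A g. 1 / h p * at_point A (\<lambda>c x.
          (tensor_norm g c x
            (ricci g c x - (scalar_curvature A g p / real CARD('n)) *\<^sub>R g c x))\<^sup>2) p)
        = (real CARD('n) - 2) / (2 * real CARD('n)) *
          (LINT p|riemannian_measure M A g. at_point A (\<lambda>c x.
            vec_inner g c x (gradient g (scalar_curvature A g) c x) (gradient g f c x)) p)
       \<and>
       (real CARD('n) - 2) / (2 * real CARD('n)) *
          (LINT p|riemannian_measure M A g. at_point A (\<lambda>c x.
            vec_inner g c x (gradient g (scalar_curvature A g) c x) (gradient g f c x)) p)
        = (real CARD('n) - 2) / (2 * real CARD('n)) *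
          (LINT p|riemannian_measure M A g. at_point A (\<lambda>c x.
            vec_inner g c x (gradient g (scalar_curvature A g) c x) (\<xi> c x)) p))"
proof -
  interpret soliton M A g \<xi> Y h lam f \<rho>
    using assms by unfold_locales
  have cong: "(LINT p|vol. u p) = (LINT p|vol. v p)" if "\<And>p. p \<in> topspace M \<Longrightarrow> u p = v p" for u v :: "'a \<Rightarrow> real"
    using that by (intro Bochner_Integration.integral_cong refl) (simp add: space_vol)
  let ?k = "(real CARD('n) - 2) / (2 * real CARD('n))"
  have H: "(LINT p|vol. h p * at_point A (\<lambda>c x. (tensor_norm g c x (Hess c x - (lap p / real CARD('n)) *\<^sub>R g c x))\<^sup>2) p)
      = ?k * (LINT p|vol. dR grad_f p) - 1 / 2 * (LINT p|vol. h p * HL p)"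
    unfolding integrals(1)[symmetric] by (rule cong) (simp only: pointwise_values(1))
  have L: "(LINT p|vol. h p * at_point A (\<lambda>c x. (tensor_norm g c x (Lie_Y c x))\<^sup>2) p) = (LINT p|vol. h p * LL p)"
    by (rule cong) (simp only: pointwise_values(3))
  have dR: "(LINT p|vol. at_point A (\<lambda>c x. vec_inner g c x (gradient g R c x) (X c x)) p) = (LINT p|vol. dR X p)" for X
    by (rule cong) (rule pointwise_values(4))
  have T: "(LINT p|vol. 1 / h p * at_point A (\<lambda>c x. (tensor_norm g c x (ricci g c x - (R p / real CARD('n)) *\<^sub>R g c x))\<^sup>2) p)
      = ?k * (LINT p|vol. dR grad_f p)" if h0: "\<forall>p\<in>topspace M. h p \<noteq> 0"
  proof -
    \<comment> \<open>The factor \<open>1 / h p\<close> meets a square of \<open>h p\<close> in each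
      summand, so the integrand has no quotient by \<open>h\<close> left.\<close>
    have alg: "1 / t * (t\<^sup>2 * a + t\<^sup>2 * b + t\<^sup>2 / 4 * l) = t * a + t * b + 1 / 4 * (t * l)" if "t \<noteq> 0" for t a b l :: real
      using that by (simp add: field_simps power2_eq_square)
    show ?thesis
      unfolding integrals(4)[symmetric]
    proof (rule cong)
      fix p assume p: "p \<in> topspace M"
      show "1 / h p * at_point A (\<lambda>c x. (tensor_norm g c x (ricci g c x - (R p / real CARD('n)) *\<^sub>R g c x))\<^sup>2) p
        = h p * (HH p - (lap p)\<^sup>2 / real CARD('n)) + h p * HL p + 1 / 4 * (h p * LL p)"
        unfolding pointwise_values(2)[OF p] using h0 p by (intro alg) blast
    qed
  qed
  \<comment> \<open>The second formula is the first with \<open>HL\<close> eliminated: the product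
    of -1/2 and -1/2 is its 1/4.\<close>
  show ?thesis
    unfolding H L dR integrals(2,3) using T by simp
qed


end
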